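(* Let $\theta,\theta_2,\theta_3\in[0,1]$ and $\Delta t>0$, and let $(\rho_h^n,\mathbf M_h^n,\mathbf E_h^n,\mathbf B_h^n,(\mathbf X_p^n,\mathbf U_p^n)_{p=1}^N)$, $n=0,1,2,\dots$, with $\rho_h^n\in DG_{k+1}$, $\mathbf M_h^n\in RT_k$, $\mathbf E_h^n\in\mathring N_k$, $\mathbf B_h^n\in\mathring{RT}_k$, $\mathbf X_p^n\in\Omega_h$, be a solution of the fully discrete implicit scheme with fluxes (IF) described in the context. Then the following quantities are exactly conserved, i.e. independent of $n$: 1. the total fluid mass $\int_{\Omega_h}\rho_h^n\,dx$; 2. the total particle mass $\sum_{p=1}^N w_p$; 3. the total energy $$\int_{\Omega_h}\rho_h^n\big(\gamma(m\mathbf M_h^n/\rho_h^n)-1\big)c^2\,dx+\sum_{p=1}^N w_p\big(\gamma(\mathbf U_p^n)-1\big)mc^2+\frac1{8\pi}\int_{\Omega_h}\big(|\mathbf E_h^n|^2+|\mathbf B_h^n|^2\big)\,dx;$$ 4. the weak Gauss law residual $$\int_{\Omega_h}\Big[\nabla_w\cdot\mathbf E_h^n-4\pi e\Big(\frac{\rho_h^n}{m}+\sum_{p=1}^N w_p\,\delta(\mathbf x-\mathbf X_p^n)\Big)\Big]\phi_h\,dx$$ for every $\phi_h\in\mathring Q_{k+1}$ (where $\int_{\Omega_h}\delta(\mathbf x-\mathbf X_p^n)\phi_h\,dx=\phi_h(\mathbf X_p^n)$); 5. the divergence $\nabla\cdot\mathbf B_h^n$.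
   Context: Let $d=3$, let $\Omega\subset\mathbb R^3$ be a bounded domain with a (finite, conforming, polyhedral) partition $\mathcal T_h$ into cells $K$, $\Omega_h=\bigcup_{K\in\mathcal T_h}K$ (identified with $\Omega$), $\mathcal E_h$ the set of interior faces, and $k\ge0$ an integer. The constants $c>0$ (speed of light), $m>0$ (mass), $e$ (charge, a nonzero real number) and the particle weights $w_p$, $p=1,\dots,N$, are fixed. For $\mathbf u\in\mathbb R^3$, $\gamma(\mathbf u)=\sqrt{1+\frac{\mathbf u\cdot\mathbf u}{m^2c^2}}$. Finite element spaces ($P_k(K)$: polynomials of degree at most $k$ on $K$): $Q_k=\{f\in H^1(\Omega): f|_K\in P_k(K)\ \forall K\}$; $N_k=\{f\in H(\mathrm{curl},\Omega): f|_K\in P_k(K)^d+\mathbf x\times P_k(K)^d\ \forall K\}$; $RT_k=\{f\in H(\mathrm{div},\Omega): f|_K\in P_k(K)^d+\mathbf x P_k(K)\ \forall K\}$; $DG_k=\{f\in L^2(\Omega): f|_K\in P_k(K)\ \forall K\}$. $\mathring Q_k$, $\mathring N_k$, $\mathring{RT}_k$ are the subspaces of functions with, respectively, $f=0$, $\mathbf n\times f=0$, $\mathbf n\cdot f=0$ on $\partial\Omega$. The weak divergence $\nabla_w\cdot:\mathring N_k\to\mathring Q_{k+1}$ is defined by $\int_\Omega(\nabla_w\cdot\mathbf E_h)\phi_h\,dx=-\int_\Omega\mathbf E_h\cdot\nabla\phi_h\,dx$ for all $\phi_h\in\mathring Q_{k+1}$. Vector-gradient notation: $(\mathbf a\cdot\nabla\mathbf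 b)\cdot\mathbf c=\sum_{i,j}a_i(\partial_i b_j)c_j$; gradients of discontinuous piecewise polynomials are taken cell by cell. Jumps and fluxes: for a face $e=K_1\cap K_2\in\mathcal E_h$ (in $\int_e$ and $\mathcal E_h$, $e$ denotes a face, elsewhere the charge), let $\mathbf n_1$ be the unit normal pointing from $K_1$ to $K_2$, $\mathbf n_2=-\mathbf n_1$, and let $\mathbf n=\mathbf n_1$ be the normal assigned to $e$. For a scalar $g$ with traces $g_1,g_2$: $[\![g]\!]=g_1\mathbf n_1+g_2\mathbf n_2$. For a vector field $\mathbf a$: $[\![\mathbf a]\!]=\mathbf a_1-\mathbf a_2$, $\{\mathbf a\}=\frac{\mathbf a_1+\mathbf a_2}2$. The upwind flux of a vector quantity is $(\mathbf a)^*=\{\mathbf a\}+\frac12\frac{\mathbf M\cdot\mathbf n}{|\mathbf M\cdot\mathbf n|}[\![\mathbf a]\!]$, where $\mathbf M\in RT_k$ is a discrete momentum field for the current time step (an interpolant of $\mathbf M_h^n$ and $\mathbf M_h^{n+1}$), the same one in all fluxes, and the quotient is taken to be $0$ where $\mathbf M\cdot\mathbf n=0$. Time interpolation: for any discrete unknown $u$ and $\alpha\in[0,1]$, $u^{n,\alpha}=(1-\alpha)u^{n+1}+\alpha u^n$; write $u^\xi=u^{n,\xi}$ for the variable $\xi$ of integration over $[0,1]$, and $u^{n+1/2}=\frac12(u^n+u^{n+1})$. Particle trajectories: within each time step particle $p$ moves along the straight segment from $\mathbf X_p^n$ to $\mathbf X_p^{n+1}$, assumed contained in $\Omega_h$ and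 crossing $s=s_p$ cells. Put $\mathbf A_{p,0}=\mathbf X_p^n$, $\mathbf A_{p,s}=\mathbf X_p^{n+1}$, and let $\mathbf A_{p,1},\dots,\mathbf A_{p,s-1}$ be, in order along the segment, its intersection points with the element boundaries crossed, so that each sub-segment $[\mathbf A_{p,i-1},\mathbf A_{p,i}]$ ($i=1,\dots,s$) lies in one closed cell; fields on this sub-segment are evaluated from that cell (if there are several such cells, one fixed choice is used for all fields). Let $\mathbf X_{p,i}^\xi=(1-\xi)\mathbf A_{p,i}+\xi\mathbf A_{p,i-1}$. Let $\mathbf D_i=\mathbf D_{p,i}$ be the diagonal $3\times3$ matrix with entries $\frac{(\mathbf A_{p,i}-\mathbf A_{p,i-1})_j}{(\mathbf X_p^{n+1}-\mathbf X_p^n)_j}$, $j=1,2,3$. If $\mathbf X_p^{n+1}=\mathbf X_p^n$ then $s=1$ and $\mathbf D_1=\mathbf I$. If $\mathbf X_p^{n+1}\neq\mathbf X_p^n$ but the $j$-th denominator vanishes, the $j$-th entry is the common ratio $\lambda_i$ defined by $\mathbf A_{p,i}-\mathbf A_{p,i-1}=\lambda_i(\mathbf X_p^{n+1}-\mathbf X_p^n)$. Scheme (IF). Let $\mathbf w_h$ be the $L^2(\Omega)$-projection onto $RT_k$ of $\int_0^1\frac{\mathbf M_h^\xi}{\rho_h^\xi\gamma(m\mathbf M_h^\xi/\rho_h^\xi)}\,d\xi$, and $G_h$ the $L^2(\Omega)$-projection onto $DG_{k+1}$ of $\int_0^1\Big(\gamma(m\mathbf M_h^\xi/\rho_h^\xi)-1-\frac{|\mathbf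 M_h^\xi|^2}{c^2(\rho_h^\xi)^2\gamma(m\mathbf M_h^\xi/\rho_h^\xi)}\Big)d\xi$. Then for each $n$: $$\int_\Omega\frac{\rho_h^{n+1}-\rho_h^n}{\Delta t}\phi_h\,dx=\int_\Omega\rho_h^{n,\theta}\mathbf w_h\cdot\nabla\phi_h\,dx-\sum_{e\in\mathcal E_h}\int_e(\rho_h^{n,\theta_2}\mathbf w_h)^*\cdot[\![\phi_h]\!]\,ds\quad\forall\phi_h\in DG_{k+1},$$ $$\begin{aligned}\int_\Omega\frac{\mathbf M_h^{n+1}-\mathbf M_h^n}{\Delta t}\cdot\boldsymbol\mu_h\,dx&=\int_\Omega(\mathbf w_h\cdot\nabla\boldsymbol\mu_h-\boldsymbol\mu_h\cdot\nabla\mathbf w_h)\cdot\mathbf M_h^{n+1/2}\,dx-\int_\Omega\rho_h^{n,\theta}\,\boldsymbol\mu_h\cdot\nabla G_h\,c^2\,dx\\&\quad+\frac em\int_\Omega\rho_h^{n,\theta}\Big(\mathbf E_h^{n+1/2}+\mathbf w_h\times\frac{\mathbf B_h^{n+1/2}}c\Big)\cdot\boldsymbol\mu_h\,dx\\&\quad+\sum_{e\in\mathcal E_h}\int_e(\mathbf n\times\mathbf M_h^{n,\theta_3})^*\cdot[\![\boldsymbol\mu_h\times\mathbf w_h]\!]\,ds+\sum_{e\in\mathcal E_h}\int_e(\rho_h^{n,\theta_2}\boldsymbol\mu_h)^*\cdot[\![G_h]\!]\,c^2\,ds\quad\forall\boldsymbol\mu_h\in RT_k,\end{aligned}$$ $$\begin{aligned}\int_\Omega\frac{\mathbf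 E_h^{n+1}-\mathbf E_h^n}{\Delta t}\cdot\boldsymbol\nu_h\,dx&=c\int_\Omega\mathbf B_h^{n+1/2}\cdot(\nabla\times\boldsymbol\nu_h)\,dx-\frac{4\pi e}m\int_\Omega\rho_h^{n,\theta}\mathbf w_h\cdot\boldsymbol\nu_h\,dx\\&\quad-4\pi e\sum_{p=1}^N\sum_{i=1}^{s}w_p\frac{\mathbf A_{p,i}-\mathbf A_{p,i-1}}{\Delta t}\cdot\int_0^1\boldsymbol\nu_h(\mathbf X_{p,i}^\xi)\,d\xi\quad\forall\boldsymbol\nu_h\in\mathring N_k,\end{aligned}$$ $$\int_\Omega\frac{\mathbf B_h^{n+1}-\mathbf B_h^n}{\Delta t}\cdot\boldsymbol\tau_h\,dx=-c\int_\Omega\boldsymbol\tau_h\cdot(\nabla\times\mathbf E_h^{n+1/2})\,dx\quad\forall\boldsymbol\tau_h\in\mathring{RT}_k,$$ $$\frac{\mathbf X_p^{n+1}-\mathbf X_p^n}{\Delta t}=\int_0^1\frac{\mathbf U_p^\xi}{m\gamma(\mathbf U_p^\xi)}\,d\xi,$$ $$\frac{\mathbf U_p^{n+1}-\mathbf U_p^n}{\Delta t}=e\Big(\sum_{i=1}^s\mathbf D_i\int_0^1\mathbf E_h^{n+1/2}(\mathbf X_{p,i}^\xi)\,d\xi+\frac1m\int_0^1\frac{\mathbf U_p^\xi}{\gamma(\mathbf U_p^\xi)}\,d\xi\times\frac{\mathbf B_h^{n+1/2}(\mathbf X_p^{n+1/2})}c\Big).$$ A solution is understood to be such that $\rho_h^\xi$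 vanishes nowhere on each closed cell for $\xi\in[0,1]$, so that all expressions are defined. The value $\mathbf B_h^{n+1/2}(\mathbf X_p^{n+1/2})$ at a point on a face is the trace from one fixed adjacent cell. *)

theory Defs
  imports "HOL-Analysis.Analysis"
begin

section \<open>Differential operators and Sobolev spaces\<close>

abbreviation pderiv_at :: "3 \<Rightarrow> (real^3 \<Rightarrow> 'b::real_normed_vector) \<Rightarrow> real^3 \<Rightarrow> 'b" where
  "pderiv_at i f x \<equiv> frechet_derivative f (at x) (axis i 1)"

definition grad :: "(real^3 \<Rightarrow> real) \<Rightarrow> real^3 \<Rightarrow> real^3" where
  "grad f x = (\<chi> i. pderiv_at i f x)"

definition curl :: "(real^3 \<Rightarrow> real^3) \<Rightarrow> real^3 \<Rightarrow> real^3" where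
  "curl f x = vector [pderiv_at 2 f x $ 3 - pderiv_at 3 f x $ 2,
                      pderiv_at 3 f x $ 1 - pderiv_at 1 f x $ 3,
                      pderiv_at 1 f x $ 2 - pderiv_at 2 f x $ 1]"

text \<open>The contraction $(a \cdot \nabla b) \cdot c$ of the values \<open>a\<close>, \<open>c\<close> with the gradient of
  the field \<open>b\<close> at \<open>x\<close>.\<close>

definition vgrad :: "real^3 \<Rightarrow> (real^3 \<Rightarrow> real^3) \<Rightarrow> real^3 \<Rightarrow> real^3 \<Rightarrow> real" where
  "vgrad a b c x = (\<Sum>i\<in>UNIV. \<Sum>j\<in>UNIV. a $ i * (pderiv_at i b x $ j) * c $ j)"

primrec C_diff :: "nat \<Rightarrow> (real^3 \<Rightarrow> 'b::real_normed_vector) \<Rightarrow> bool" where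
  "C_diff 0 f \<longleftrightarrow> continuous_on UNIV f"
| "C_diff (Suc r) f \<longleftrightarrow>
     f differentiable_on UNIV \<and> (\<forall>v. C_diff r (\<lambda>x. frechet_derivative f (at x) v))"

definition test_functions :: "(real^3) set \<Rightarrow> (real^3 \<Rightarrow> 'b::real_normed_vector) set" where
  "test_functions \<Omega> = {\<psi>. (\<forall>r. C_diff r \<psi>) \<and>
     compact (closure {x. \<psi> x \<noteq> 0}) \<and> closure {x. \<psi> x \<noteq> 0} \<subseteq> \<Omega>}"

text \<open>Elements of $L^2$ and of the spaces below are represented by functions; functions that agree
  almost everywhere are not identified. Everything that follows depends on a field only through its
  values in the interiors of the mesh cells.\<close>

definition L2 :: "(real^3) set \<Rightarrow> (real^3 \<Rightarrow> 'b::euclidean_space) set" where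
  "L2 \<Omega> = {f. f \<in> borel_measurable (lebesgue_on \<Omega>) \<and>
              integrable (lebesgue_on \<Omega>) (\<lambda>x. (norm (f x))\<^sup>2)}"

definition has_weak_grad :: "(real^3) set \<Rightarrow> (real^3 \<Rightarrow> real) \<Rightarrow> (real^3 \<Rightarrow> real^3) \<Rightarrow> bool" where
  "has_weak_grad \<Omega> f g \<longleftrightarrow> g \<in> L2 \<Omega> \<and> (\<forall>\<psi>\<in>test_functions \<Omega>.
     (LINT x|lebesgue_on \<Omega>. f x *\<^sub>R grad \<psi> x) = - (LINT x|lebesgue_on \<Omega>. \<psi> x *\<^sub>R g x))"

definition has_weak_curl :: "(real^3) set \<Rightarrow> (real^3 \<Rightarrow> real^3) \<Rightarrow> (real^3 \<Rightarrow> real^3) \<Rightarrow> bool" where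
  "has_weak_curl \<Omega> f g \<longleftrightarrow> g \<in> L2 \<Omega> \<and> (\<forall>\<psi>\<in>test_functions \<Omega>.
     (LINT x|lebesgue_on \<Omega>. f x \<bullet> curl \<psi> x) = (LINT x|lebesgue_on \<Omega>. g x \<bullet> \<psi> x))"

definition has_weak_div :: "(real^3) set \<Rightarrow> (real^3 \<Rightarrow> real^3) \<Rightarrow> (real^3 \<Rightarrow> real) \<Rightarrow> bool" where
  "has_weak_div \<Omega> f g \<longleftrightarrow> g \<in> L2 \<Omega> \<and> (\<forall>\<psi>\<in>test_functions \<Omega>.
     (LINT x|lebesgue_on \<Omega>. f x \<bullet> grad \<psi> x) = - (LINT x|lebesgue_on \<Omega>. g x * \<psi> x))"

definition H1 :: "(real^3) set \<Rightarrow> (real^3 \<Rightarrow> real) set" where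
  "H1 \<Omega> = {f \<in> L2 \<Omega>. \<exists>g. has_weak_grad \<Omega> f g}"

definition Hcurl :: "(real^3) set \<Rightarrow> (real^3 \<Rightarrow> real^3) set" where
  "Hcurl \<Omega> = {f \<in> L2 \<Omega>. \<exists>g. has_weak_curl \<Omega> f g}"

definition Hdiv :: "(real^3) set \<Rightarrow> (real^3 \<Rightarrow> real^3) set" where
  "Hdiv \<Omega> = {f \<in> L2 \<Omega>. \<exists>g. has_weak_div \<Omega> f g}"


section \<open>Meshes\<close>

definition bounded_domain :: "(real^3) set \<Rightarrow> bool" where
  "bounded_domain \<Omega> \<longleftrightarrow> open \<Omega> \<and> connected \<Omega> \<and> bounded \<Omega> \<and> \<Omega> \<noteq> {}"

text \<open>Cells are closed convex polytopes. The last two conditions make precise in which sense the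
  union of the closed cells is identified with the open set \<open>\<Omega>\<close>.\<close>

definition conforming_mesh :: "(real^3) set \<Rightarrow> (real^3) set set \<Rightarrow> bool" where
  "conforming_mesh \<Omega> \<T> \<longleftrightarrow>
     finite \<T> \<and>
     (\<forall>K\<in>\<T>. polytope K \<and> interior K \<noteq> {}) \<and>
     (\<forall>K\<in>\<T>. \<forall>L\<in>\<T>. K \<noteq> L \<longrightarrow> interior K \<inter> interior L = {} \<and>
        (K \<inter> L) face_of K \<and> (K \<inter> L) face_of L) \<and>
     \<Union>\<T> = closure \<Omega> \<and> \<Omega> = interior (\<Union>\<T>)"

definition interior_faces :: "(real^3) set set \<Rightarrow> (real^3) set set" where
  "interior_faces \<T> = {F. \<exists>K\<in>\<T>. \<exists>L\<in>\<T>. K \<noteq> L \<and> F = K \<inter> L \<and> aff_dim F = 2}"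

definition outward_normal :: "(real^3) set \<Rightarrow> (real^3) set \<Rightarrow> real^3" where
  "outward_normal K F = (THE n. norm n = 1 \<and> (\<forall>x\<in>K. \<forall>y\<in>F. n \<bullet> (x - y) \<le> 0))"

definition cell_trace :: "(real^3) set \<Rightarrow> (real^3 \<Rightarrow> 'b::real_normed_vector) \<Rightarrow> real^3 \<Rightarrow> 'b" where
  "cell_trace K f x = Lim (at x within interior K) f"

text \<open>The value at \<open>x\<close> of the continuous representative of a field defined in the open cells.\<close>

definition point_value :: "(real^3) set set \<Rightarrow> (real^3 \<Rightarrow> real) \<Rightarrow> real^3 \<Rightarrow> real" where
  "point_value \<T> f x = Lim (at x within (\<Union>K\<in>\<T>. interior K)) f"

text \<open>Surface integral over a planar polygon \<open>F\<close>: a distance-preserving map of the plane whose range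
  contains \<open>F\<close> is an arc-length chart of the plane of \<open>F\<close>, and Lebesgue measure on the plane does
  not depend on the choice of the chart.\<close>

definition face_integral :: "(real^3) set \<Rightarrow> (real^3 \<Rightarrow> real) \<Rightarrow> real" where
  "face_integral F f =
     (let g = (SOME g :: real^2 \<Rightarrow> real^3. (\<forall>u v. dist (g u) (g v) = dist u v) \<and> F \<subseteq> range g)
      in LINT u|lebesgue_on (g -` F). f (g u))"


section \<open>Finite element spaces\<close>

definition polys :: "nat \<Rightarrow> (real^3 \<Rightarrow> real) set" where
  "polys k = {p. \<exists>a :: (3 \<Rightarrow> nat) \<Rightarrow> real.
     p = (\<lambda>x. \<Sum>\<alpha> | (\<Sum>i\<in>UNIV. \<alpha> i) \<le> k. a \<alpha> * (\<Prod>i\<in>UNIV. (x $ i) ^ \<alpha> i))}"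

definition vpolys :: "nat \<Rightarrow> (real^3 \<Rightarrow> real^3) set" where
  "vpolys k = {p. \<forall>i. (\<lambda>x. p x $ i) \<in> polys k}"

definition N_local :: "nat \<Rightarrow> (real^3 \<Rightarrow> real^3) set" where
  "N_local k = {\<lambda>x. p x + cross3 x (q x) | p q. p \<in> vpolys k \<and> q \<in> vpolys k}"

definition RT_local :: "nat \<Rightarrow> (real^3 \<Rightarrow> real^3) set" where
  "RT_local k = {\<lambda>x. p x + q x *\<^sub>R x | p q. p \<in> vpolys k \<and> q \<in> polys k}"

text \<open>The condition that the restriction of \<open>f\<close> to each cell belongs to \<open>P\<close> is imposed in the open
  cells, because fields may have different traces from the two sides of a face.\<close>

definition cellwise ::
    "(real^3) set set \<Rightarrow> (real^3 \<Rightarrow> 'b) set \<Rightarrow> (real^3 \<Rightarrow> 'b) \<Rightarrow> bool" where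
  "cellwise \<T> P f \<longleftrightarrow> (\<forall>K\<in>\<T>. \<exists>p\<in>P. \<forall>x\<in>interior K. f x = p x)"

definition Q_space :: "(real^3) set \<Rightarrow> (real^3) set set \<Rightarrow> nat \<Rightarrow> (real^3 \<Rightarrow> real) set" where
  "Q_space \<Omega> \<T> k = {f \<in> H1 \<Omega>. cellwise \<T> (polys k) f}"

definition N_space :: "(real^3) set \<Rightarrow> (real^3) set set \<Rightarrow> nat \<Rightarrow> (real^3 \<Rightarrow> real^3) set" where
  "N_space \<Omega> \<T> k = {f \<in> Hcurl \<Omega>. cellwise \<T> (N_local k) f}"

definition RT_space :: "(real^3) set \<Rightarrow> (real^3) set set \<Rightarrow> nat \<Rightarrow> (real^3 \<Rightarrow> real^3) set" where
  "RT_space \<Omega> \<T> k = {f \<in> Hdiv \<Omega>. cellwise \<T> (RT_local k) f}"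

definition DG_space :: "(real^3) set \<Rightarrow> (real^3) set set \<Rightarrow> nat \<Rightarrow> (real^3 \<Rightarrow> real) set" where
  "DG_space \<Omega> \<T> k = {f \<in> L2 \<Omega>. cellwise \<T> (polys k) f}"

definition Q0_space :: "(real^3) set \<Rightarrow> (real^3) set set \<Rightarrow> nat \<Rightarrow> (real^3 \<Rightarrow> real) set" where
  "Q0_space \<Omega> \<T> k = {f \<in> Q_space \<Omega> \<T> k.
     \<forall>K\<in>\<T>. \<forall>x\<in>K \<inter> frontier \<Omega>. cell_trace K f x = 0}"

definition N0_space :: "(real^3) set \<Rightarrow> (real^3) set set \<Rightarrow> nat \<Rightarrow> (real^3 \<Rightarrow> real^3) set" where
  "N0_space \<Omega> \<T> k = {f \<in> N_space \<Omega> \<T> k.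
     \<forall>K\<in>\<T>. \<forall>F. F facet_of K \<and> F \<subseteq> frontier \<Omega> \<longrightarrow>
       (\<forall>x\<in>F. cross3 (outward_normal K F) (cell_trace K f x) = 0)}"

definition RT0_space :: "(real^3) set \<Rightarrow> (real^3) set set \<Rightarrow> nat \<Rightarrow> (real^3 \<Rightarrow> real^3) set" where
  "RT0_space \<Omega> \<T> k = {f \<in> RT_space \<Omega> \<T> k.
     \<forall>K\<in>\<T>. \<forall>F. F facet_of K \<and> F \<subseteq> frontier \<Omega> \<longrightarrow>
       (\<forall>x\<in>F. outward_normal K F \<bullet> cell_trace K f x = 0)}"

definition is_L2_projection ::
    "(real^3) set \<Rightarrow> (real^3 \<Rightarrow> 'b::euclidean_space) set \<Rightarrow> (real^3 \<Rightarrow> 'b) \<Rightarrow> (real^3 \<Rightarrow> 'b) \<Rightarrow> bool" where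
  "is_L2_projection \<Omega> V f g \<longleftrightarrow> g \<in> V \<and>
     (\<forall>v\<in>V. (LINT x|lebesgue_on \<Omega>. g x \<bullet> v x) = (LINT x|lebesgue_on \<Omega>. f x \<bullet> v x))"

text \<open>The discrete weak divergence \<open>\<nabla>\<^sub>w\<cdot>\<close> into \<open>Q0_space \<Omega> \<T> (k + 1)\<close>; it is determined almost everywhere.\<close>

definition discrete_div ::
    "(real^3) set \<Rightarrow> (real^3) set set \<Rightarrow> nat \<Rightarrow> (real^3 \<Rightarrow> real^3) \<Rightarrow> real^3 \<Rightarrow> real" where
  "discrete_div \<Omega> \<T> k E = (SOME d. d \<in> Q0_space \<Omega> \<T> (k + 1) \<and>
     (\<forall>\<phi>\<in>Q0_space \<Omega> \<T> (k + 1).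
        (LINT x|lebesgue_on \<Omega>. d x * \<phi> x) = - (LINT x|lebesgue_on \<Omega>. E x \<bullet> grad \<phi> x)))"


section \<open>The scheme\<close>

text \<open>\<open>cell1 F\<close> and \<open>cell2 F\<close> are the two cells $K_1$, $K_2$ at an interior face \<open>F\<close>, in the order
  that fixes the normal assigned to \<open>F\<close>.\<close>

record setting =
  dom :: "(real^3) set"
  cells :: "(real^3) set set"
  cell1 :: "(real^3) set \<Rightarrow> (real^3) set"
  cell2 :: "(real^3) set \<Rightarrow> (real^3) set"
  deg :: nat
  light :: real
  mass :: real
  charge :: real
  npart :: nat
  weight :: "nat \<Rightarrow> real"
  theta :: real
  theta2 :: real
  theta3 :: real
  dt :: real

text \<open>The unknowns $(\rho_h, M_h, E_h, B_h, (X_p, U_p)_p)$ at one time level.\<close>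

record state =
  rho :: "real^3 \<Rightarrow> real"
  mom :: "real^3 \<Rightarrow> real^3"
  elec :: "real^3 \<Rightarrow> real^3"
  magn :: "real^3 \<Rightarrow> real^3"
  pos :: "nat \<Rightarrow> real^3"
  imp :: "nat \<Rightarrow> real^3"

text \<open>Auxiliary quantities of one time step: the projections $w_h$ and $G_h$; the momentum field used
  for upwinding; and for each particle the number $s$ of sub-segments, the points $A_0, \dots, A_s$,
  the cell from which fields are evaluated on the segment $[A_{i-1}, A_i]$, and the cell from which
  the magnetic field is evaluated at the midpoint of the trajectory.\<close>

record step_data =
  wh :: "real^3 \<Rightarrow> real^3"
  Gh :: "real^3 \<Rightarrow> real"
  upw :: "real^3 \<Rightarrow> real^3"
  nseg :: "nat \<Rightarrow> nat"
  brk :: "nat \<Rightarrow> nat \<Rightarrow> real^3"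
  segcell :: "nat \<Rightarrow> nat \<Rightarrow> (real^3) set"
  midcell :: "nat \<Rightarrow> (real^3) set"

definition face_orientation :: "setting \<Rightarrow> bool" where
  "face_orientation S \<longleftrightarrow> (\<forall>F\<in>interior_faces (cells S).
     cell1 S F \<in> cells S \<and> cell2 S F \<in> cells S \<and> cell1 S F \<noteq> cell2 S F \<and>
     F = cell1 S F \<inter> cell2 S F)"

text \<open>$u^{n,\alpha}$, where \<open>u\<close> is the value at time level $n$ and \<open>u'\<close> the one at level $n+1$.\<close>

definition interp :: "real \<Rightarrow> 'b::real_vector \<Rightarrow> 'b \<Rightarrow> 'b" where
  "interp \<alpha> u u' = (1 - \<alpha>) *\<^sub>R u' + \<alpha> *\<^sub>R u"

definition finterp :: "real \<Rightarrow> ('a \<Rightarrow> 'b::real_vector) \<Rightarrow> ('a \<Rightarrow> 'b) \<Rightarrow> 'a \<Rightarrow> 'b" where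
  "finterp \<alpha> u u' = (\<lambda>x. interp \<alpha> (u x) (u' x))"

definition gam :: "setting \<Rightarrow> real^3 \<Rightarrow> real" where
  "gam S u = sqrt (1 + (u \<bullet> u) / ((mass S)\<^sup>2 * (light S)\<^sup>2))"

definition face_normal :: "setting \<Rightarrow> (real^3) set \<Rightarrow> real^3" where
  "face_normal S F = outward_normal (cell1 S F) F"

definition sjump :: "setting \<Rightarrow> (real^3) set \<Rightarrow> (real^3 \<Rightarrow> real) \<Rightarrow> real^3 \<Rightarrow> real^3" where
  "sjump S F g x = cell_trace (cell1 S F) g x *\<^sub>R face_normal S F
                 + cell_trace (cell2 S F) g x *\<^sub>R (- face_normal S F)"

definition vjump :: "setting \<Rightarrow> (real^3) set \<Rightarrow> (real^3 \<Rightarrow> real^3) \<Rightarrow> real^3 \<Rightarrow> real^3" where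
  "vjump S F a x = cell_trace (cell1 S F) a x - cell_trace (cell2 S F) a x"

definition average :: "setting \<Rightarrow> (real^3) set \<Rightarrow> (real^3 \<Rightarrow> real^3) \<Rightarrow> real^3 \<Rightarrow> real^3" where
  "average S F a x = (1/2) *\<^sub>R (cell_trace (cell1 S F) a x + cell_trace (cell2 S F) a x)"

text \<open>For \<open>M\<close> in \<open>RT_space\<close> the normal component on \<open>F\<close> is the same from both cells. Division by
  zero gives the quotient the value 0 where it vanishes.\<close>

definition upwind_flux ::
    "setting \<Rightarrow> (real^3 \<Rightarrow> real^3) \<Rightarrow> (real^3) set \<Rightarrow> (real^3 \<Rightarrow> real^3) \<Rightarrow> real^3 \<Rightarrow> real^3" where
  "upwind_flux S M F a x =
     (let Mn = cell_trace (cell1 S F) M x \<bullet> face_normal S F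
      in average S F a x + ((1/2) * (Mn / \<bar>Mn\<bar>)) *\<^sub>R vjump S F a x)"

definition admissible :: "setting \<Rightarrow> state \<Rightarrow> bool" where
  "admissible S u \<longleftrightarrow>
     rho u \<in> DG_space (dom S) (cells S) (deg S + 1) \<and>
     mom u \<in> RT_space (dom S) (cells S) (deg S) \<and>
     elec u \<in> N0_space (dom S) (cells S) (deg S) \<and>
     magn u \<in> RT0_space (dom S) (cells S) (deg S) \<and>
     (\<forall>p\<in>{1..npart S}. pos u p \<in> \<Union>(cells S))"

definition nonvanishing_density :: "setting \<Rightarrow> state \<Rightarrow> state \<Rightarrow> bool" where
  "nonvanishing_density S u u' \<longleftrightarrow> (\<forall>K\<in>cells S. \<forall>x\<in>K. \<forall>\<xi>\<in>{0..1}.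
     interp \<xi> (cell_trace K (rho u) x) (cell_trace K (rho u') x) \<noteq> 0)"

definition velocity_projection :: "setting \<Rightarrow> state \<Rightarrow> step_data \<Rightarrow> state \<Rightarrow> bool" where
  "velocity_projection S u d u' \<longleftrightarrow>
     is_L2_projection (dom S) (RT_space (dom S) (cells S) (deg S))
       (\<lambda>x. integral {0..1} (\<lambda>\<xi>.
          let r = finterp \<xi> (rho u) (rho u') x; M = finterp \<xi> (mom u) (mom u') x
          in (1 / (r * gam S ((mass S / r) *\<^sub>R M))) *\<^sub>R M))
       (wh d)"

definition G_projection :: "setting \<Rightarrow> state \<Rightarrow> step_data \<Rightarrow> state \<Rightarrow> bool" where
  "G_projection S u d u' \<longleftrightarrow>
     is_L2_projection (dom S) (DG_space (dom S) (cells S) (deg S + 1))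
       (\<lambda>x. integral {0..1} (\<lambda>\<xi>.
          let r = finterp \<xi> (rho u) (rho u') x; M = finterp \<xi> (mom u) (mom u') x;
              g = gam S ((mass S / r) *\<^sub>R M)
          in g - 1 - (norm M)\<^sup>2 / ((light S)\<^sup>2 * r\<^sup>2 * g)))
       (Gh d)"

text \<open>The trajectory is parametrised by \<open>t\<close>, and each interior point \<open>brk d p i\<close> lies on the boundary of
  some cell.\<close>

definition trajectory :: "setting \<Rightarrow> state \<Rightarrow> step_data \<Rightarrow> state \<Rightarrow> nat \<Rightarrow> bool" where
  "trajectory S u d u' p \<longleftrightarrow>
     closed_segment (pos u p) (pos u' p) \<subseteq> \<Union>(cells S) \<and>
     nseg d p \<ge> 1 \<and> (pos u' p = pos u p \<longrightarrow> nseg d p = 1) \<and>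
     brk d p 0 = pos u p \<and> brk d p (nseg d p) = pos u' p \<and>
     (\<exists>t :: nat \<Rightarrow> real. t 0 = 0 \<and> t (nseg d p) = 1 \<and>
        (\<forall>i<nseg d p. t i < t (Suc i)) \<and>
        (\<forall>i\<le>nseg d p. brk d p i = pos u p + t i *\<^sub>R (pos u' p - pos u p))) \<and>
     (\<forall>i\<in>{1..<nseg d p}. brk d p i \<in> (\<Union>K\<in>cells S. frontier K)) \<and>
     (\<forall>i\<in>{1..nseg d p}. segcell d p i \<in> cells S \<and>
        closed_segment (brk d p (i - 1)) (brk d p i) \<subseteq> segcell d p i) \<and>
     midcell d p \<in> cells S \<and> (1/2) *\<^sub>R (pos u p + pos u' p) \<in> midcell d p"

definition segpoint :: "step_data \<Rightarrow> nat \<Rightarrow> nat \<Rightarrow> real \<Rightarrow> real^3" where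
  "segpoint d p i \<xi> = (1 - \<xi>) *\<^sub>R brk d p i + \<xi> *\<^sub>R brk d p (i - 1)"

definition Dmat :: "state \<Rightarrow> step_data \<Rightarrow> state \<Rightarrow> nat \<Rightarrow> nat \<Rightarrow> real^3^3" where
  "Dmat u d u' p i =
     (let \<Delta>X = pos u' p - pos u p; \<Delta>A = brk d p i - brk d p (i - 1) in
      \<chi> a b. if a \<noteq> b then 0
             else if \<Delta>X = 0 then 1
             else if \<Delta>X $ a \<noteq> 0 then \<Delta>A $ a / \<Delta>X $ a
             else (THE r. \<Delta>A = r *\<^sub>R \<Delta>X))"

definition density_eq :: "setting \<Rightarrow> state \<Rightarrow> step_data \<Rightarrow> state \<Rightarrow> bool" where
  "density_eq S u d u' \<longleftrightarrow> (\<forall>\<phi>\<in>DG_space (dom S) (cells S) (deg S + 1).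
     (LINT x|lebesgue_on (dom S). (rho u' x - rho u x) / dt S * \<phi> x)
     = (LINT x|lebesgue_on (dom S). finterp (theta S) (rho u) (rho u') x * (wh d x \<bullet> grad \<phi> x))
     - (\<Sum>F\<in>interior_faces (cells S). face_integral F (\<lambda>x.
          upwind_flux S (upw d) F
            (\<lambda>y. finterp (theta2 S) (rho u) (rho u') y *\<^sub>R wh d y) x \<bullet> sjump S F \<phi> x)))"

definition momentum_eq :: "setting \<Rightarrow> state \<Rightarrow> step_data \<Rightarrow> state \<Rightarrow> bool" where
  "momentum_eq S u d u' \<longleftrightarrow> (\<forall>\<mu>\<in>RT_space (dom S) (cells S) (deg S).
     (LINT x|lebesgue_on (dom S). ((1 / dt S) *\<^sub>R (mom u' x - mom u x)) \<bullet> \<mu> x)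
     = (LINT x|lebesgue_on (dom S).
          (let Mh = finterp (1/2) (mom u) (mom u') x
           in vgrad (wh d x) \<mu> Mh x - vgrad (\<mu> x) (wh d) Mh x))
     - (LINT x|lebesgue_on (dom S).
          finterp (theta S) (rho u) (rho u') x * (\<mu> x \<bullet> grad (Gh d) x) * (light S)\<^sup>2)
     + charge S / mass S * (LINT x|lebesgue_on (dom S).
          finterp (theta S) (rho u) (rho u') x *
          ((finterp (1/2) (elec u) (elec u') x
            + cross3 (wh d x) ((1 / light S) *\<^sub>R finterp (1/2) (magn u) (magn u') x)) \<bullet> \<mu> x))
     + (\<Sum>F\<in>interior_faces (cells S). face_integral F (\<lambda>x.
          upwind_flux S (upw d) F
            (\<lambda>y. cross3 (face_normal S F) (finterp (theta3 S) (mom u) (mom u') y)) x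
          \<bullet> vjump S F (\<lambda>y. cross3 (\<mu> y) (wh d y)) x))
     + (\<Sum>F\<in>interior_faces (cells S). face_integral F (\<lambda>x.
          upwind_flux S (upw d) F
            (\<lambda>y. finterp (theta2 S) (rho u) (rho u') y *\<^sub>R \<mu> y) x
          \<bullet> sjump S F (Gh d) x * (light S)\<^sup>2)))"

definition ampere_eq :: "setting \<Rightarrow> state \<Rightarrow> step_data \<Rightarrow> state \<Rightarrow> bool" where
  "ampere_eq S u d u' \<longleftrightarrow> (\<forall>\<nu>\<in>N0_space (dom S) (cells S) (deg S).
     (LINT x|lebesgue_on (dom S). ((1 / dt S) *\<^sub>R (elec u' x - elec u x)) \<bullet> \<nu> x)
     = light S * (LINT x|lebesgue_on (dom S). finterp (1/2) (magn u) (magn u') x \<bullet> curl \<nu> x)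
     - 4 * pi * charge S / mass S *
         (LINT x|lebesgue_on (dom S). finterp (theta S) (rho u) (rho u') x * (wh d x \<bullet> \<nu> x))
     - 4 * pi * charge S * (\<Sum>p=1..npart S. \<Sum>i=1..nseg d p. weight S p *
         (((1 / dt S) *\<^sub>R (brk d p i - brk d p (i - 1)))
          \<bullet> integral {0..1} (\<lambda>\<xi>. cell_trace (segcell d p i) \<nu> (segpoint d p i \<xi>)))))"

definition faraday_eq :: "setting \<Rightarrow> state \<Rightarrow> state \<Rightarrow> bool" where
  "faraday_eq S u u' \<longleftrightarrow> (\<forall>\<tau>\<in>RT0_space (dom S) (cells S) (deg S).
     (LINT x|lebesgue_on (dom S). ((1 / dt S) *\<^sub>R (magn u' x - magn u x)) \<bullet> \<tau> x)
     = - light S * (LINT x|lebesgue_on (dom S). \<tau> x \<bullet> curl (finterp (1/2) (elec u) (elec u')) x))"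

definition position_eq :: "setting \<Rightarrow> state \<Rightarrow> state \<Rightarrow> nat \<Rightarrow> bool" where
  "position_eq S u u' p \<longleftrightarrow>
     (1 / dt S) *\<^sub>R (pos u' p - pos u p)
     = integral {0..1} (\<lambda>\<xi>. let v = interp \<xi> (imp u p) (imp u' p)
                             in (1 / (mass S * gam S v)) *\<^sub>R v)"

definition impulse_eq :: "setting \<Rightarrow> state \<Rightarrow> step_data \<Rightarrow> state \<Rightarrow> nat \<Rightarrow> bool" where
  "impulse_eq S u d u' p \<longleftrightarrow>
     (1 / dt S) *\<^sub>R (imp u' p - imp u p)
     = charge S *\<^sub>R
        ((\<Sum>i=1..nseg d p. Dmat u d u' p i *v
            integral {0..1} (\<lambda>\<xi>. cell_trace (segcell d p i)
              (finterp (1/2) (elec u) (elec u')) (segpoint d p i \<xi>)))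
         + cross3
            ((1 / mass S) *\<^sub>R integral {0..1} (\<lambda>\<xi>. let v = interp \<xi> (imp u p) (imp u' p)
                                                   in (1 / gam S v) *\<^sub>R v))
            ((1 / light S) *\<^sub>R cell_trace (midcell d p) (finterp (1/2) (magn u) (magn u'))
              ((1/2) *\<^sub>R (pos u p + pos u' p))))"

definition IF_step :: "setting \<Rightarrow> state \<Rightarrow> step_data \<Rightarrow> state \<Rightarrow> bool" where
  "IF_step S u d u' \<longleftrightarrow>
     nonvanishing_density S u u' \<and>
     upw d \<in> RT_space (dom S) (cells S) (deg S) \<and>
     velocity_projection S u d u' \<and> G_projection S u d u' \<and>
     density_eq S u d u' \<and> momentum_eq S u d u' \<and> ampere_eq S u d u' \<and> faraday_eq S u u' \<and>
     (\<forall>p\<in>{1..npart S}. trajectory S u d u' p \<and> position_eq S u u' p \<and> impulse_eq S u d u' p)"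

definition IF_solution :: "setting \<Rightarrow> (nat \<Rightarrow> state) \<Rightarrow> bool" where
  "IF_solution S u \<longleftrightarrow>
     (\<forall>n. admissible S (u n)) \<and> (\<forall>n. \<exists>d. IF_step S (u n) d (u (Suc n)))"


section \<open>Conserved quantities\<close>

definition fluid_mass :: "setting \<Rightarrow> state \<Rightarrow> real" where
  "fluid_mass S u = (LINT x|lebesgue_on (dom S). rho u x)"

text \<open>The weights are part of the setting, so that this quantity does not depend on the state.\<close>

definition particle_mass :: "setting \<Rightarrow> state \<Rightarrow> real" where
  "particle_mass S u = (\<Sum>p=1..npart S. weight S p)"

definition total_energy :: "setting \<Rightarrow> state \<Rightarrow> real" where
  "total_energy S u =
     (LINT x|lebesgue_on (dom S).
        rho u x * (gam S ((mass S / rho u x) *\<^sub>R mom u x) - 1) * (light S)\<^sup>2)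
     + (\<Sum>p=1..npart S. weight S p * (gam S (imp u p) - 1) * mass S * (light S)\<^sup>2)
     + 1 / (8 * pi) * (LINT x|lebesgue_on (dom S). (norm (elec u x))\<^sup>2 + (norm (magn u x))\<^sup>2)"

definition gauss_residual :: "setting \<Rightarrow> state \<Rightarrow> (real^3 \<Rightarrow> real) \<Rightarrow> real" where
  "gauss_residual S u \<phi> =
     (LINT x|lebesgue_on (dom S).
        (discrete_div (dom S) (cells S) (deg S) (elec u) x
         - 4 * pi * charge S * (rho u x / mass S)) * \<phi> x)
     - 4 * pi * charge S * (\<Sum>p=1..npart S. weight S p * point_value (cells S) \<phi> (pos u p))"

end

theory Submission
  imports Defs
begin

text \<open>Each conservation law follows from testing one step of the scheme with suitable discrete
  fields. The algebra of the tests is short; what has to be proved is that the test fields are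
  admissible.

  Mass: the constant 1 has neither gradient nor jumps. Energy: the fluid energy changes by the pairing
  of the increments of density and momentum with the time averages of the derivatives of the energy,
  and the projections \<open>Gh\<close> and \<open>wh\<close> replace these averages by discrete fields
  (\<open>fluid_energy_step\<close>). Tested with them, the density and momentum equations leave only the work of
  the electric field (\<open>fluid_work\<close>). The particles gain the work along their sub-segments
  (\<open>particle_energy_step\<close>), and the Ampere and Faraday laws, tested with the midpoint fields, take the
  same amounts out of the field energy.

  Gauss law: the gradient of a test function \<open>\<phi>\<close> is a test field for the Ampere law
  (\<open>grad_in_N0\<close>). Its curl vanishes, the fluid current is the one in the density equation tested with
  \<open>\<phi>\<close>, and the particle current telescopes to the difference of two values of \<open>\<phi>\<close>. This requires
  that \<open>\<phi>\<close> is continuous across the cells (\<open>Q0_traces_agree\<close>), and that the discrete weak divergence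
  exists (\<open>discrete_div_exists\<close>). Magnetic field: the curl of the discrete electric field is a test
  field for the Faraday law (\<open>curl_in_RT0\<close>), so that law holds pointwise in the cells, and weak curls
  have no divergence.

  These facts rest on a comparison of weak and cellwise derivatives. Smooth cutoffs of the convex
  polytopes (\<open>polytope_cutoffs\<close>) show that a weak gradient or curl of a cellwise polynomial is the
  cellwise one, as far as test functions can see (\<open>H1_cellwise_grad\<close>, \<open>Hcurl_cellwise_curl\<close>).
  Exactness then comes from the symmetry of the second derivatives of test functions, and continuity
  from translating a bump function between two cells (\<open>H1_Lipschitz_between_cells\<close>): its pairing with
  \<open>\<phi>\<close> changes at a rate bounded by the gradient. The boundary conditions of gradients and curls are
  verified on each boundary facet by differentiating in tangential directions.\<close>


section \<open>Smooth functions on space\<close>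

lemma has_frechet_derivative:
  assumes "(f has_derivative f') (at x)"
  shows "(f has_derivative frechet_derivative f (at x)) (at x)"
  by (subst frechet_derivative_works[symmetric]) (rule differentiableI[OF assms])

lemma frechet_derivative_eqI:
  assumes "(f has_derivative f') (at x)" shows "frechet_derivative f (at x) v = f' v"
  using frechet_derivative_at[OF assms] by simp

lemma C_diff_SucI:
  assumes "\<And>x. (f has_derivative f' x) (at x)" "\<And>v. C_diff r (\<lambda>x. f' x v)"
  shows "C_diff (Suc r) f"
proof -
  have "frechet_derivative f (at x) = f' x" for x
    using frechet_derivative_at[OF assms(1)] by simp
  moreover have "f differentiable_on UNIV"
    using assms(1) by (auto simp: differentiable_on_def differentiable_def)
  ultimately show ?thesis using assms(2) by simp
qed

lemma C_diff_has_derivative: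
  "C_diff (Suc r) f \<Longrightarrow> (f has_derivative frechet_derivative f (at x)) (at x)"
  by (auto simp: differentiable_on_def frechet_derivative_works)

lemma C_diff_derivative: "C_diff (Suc r) f \<Longrightarrow> C_diff r (\<lambda>x. frechet_derivative f (at x) v)"
  by simp

lemma C_diff_continuous: "C_diff r f \<Longrightarrow> continuous_on UNIV f"
  by (cases r) (auto intro: differentiable_imp_continuous_on)

lemma C_diff_Suc_imp: "C_diff (Suc r) f \<Longrightarrow> C_diff r f"
proof (induction r arbitrary: f)
  case 0
  then show ?case using C_diff_continuous[of "Suc 0" f] by simp
next
  case (Suc r)
  then show ?case by (meson C_diff.simps(2))
qed

lemma C_diff_const: "C_diff r (\<lambda>x. c)"
  by (induction r arbitrary: c) auto

lemma C_diff_add: "C_diff r f \<Longrightarrow> C_diff r g \<Longrightarrow> C_diff r (\<lambda>x. f x + g x)"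
proof (induction r arbitrary: f g)
  case 0 then show ?case by (auto intro: continuous_intros)
next
  case (Suc r)
  show ?case
    by (rule C_diff_SucI[where f' = "\<lambda>x v. frechet_derivative f (at x) v + frechet_derivative g (at x) v"])
       (use Suc in \<open>auto intro!: has_derivative_add intro: C_diff_has_derivative\<close>)
qed

lemma C_diff_sum: "(\<And>i. i \<in> I \<Longrightarrow> C_diff r (f i)) \<Longrightarrow> C_diff r (\<lambda>x. \<Sum>i\<in>I. f i x)"
  by (induction I rule: infinite_finite_induct) (auto intro: C_diff_const C_diff_add)

lemma C_diff_bilinear:
  assumes "bounded_bilinear b"
  shows "C_diff r f \<Longrightarrow> C_diff r g \<Longrightarrow> C_diff r (\<lambda>x. b (f x) (g x))"
proof (induction r arbitrary: f g)
  case 0 then show ?case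
    using bounded_bilinear.continuous_on[OF assms] by auto
next
  case (Suc r)
  have d: "((\<lambda>x. b (f x) (g x)) has_derivative
     (\<lambda>v. b (f x) (frechet_derivative g (at x) v) + b (frechet_derivative f (at x) v) (g x))) (at x)" for x
    using bounded_bilinear.FDERIV[OF assms C_diff_has_derivative[OF Suc.prems(1)] C_diff_has_derivative[OF Suc.prems(2)]] .
  show ?case
    by (rule C_diff_SucI[OF d])
       (intro C_diff_add Suc.IH C_diff_derivative Suc.prems C_diff_Suc_imp[OF Suc.prems(1)] C_diff_Suc_imp[OF Suc.prems(2)])
qed

lemmas C_diff_mult = C_diff_bilinear[OF bounded_bilinear_mult]
lemmas C_diff_scaleR = C_diff_bilinear[OF bounded_bilinear_scaleR]
lemmas C_diff_inner = C_diff_bilinear[OF bounded_bilinear_inner]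

lemma C_diff_minus: "C_diff r f \<Longrightarrow> C_diff r (\<lambda>x. - f x)"
  using C_diff_scaleR[OF C_diff_const[of r "-1"]] by auto

lemma C_diff_diff: "C_diff r f \<Longrightarrow> C_diff r g \<Longrightarrow> C_diff r (\<lambda>x. f x - g x)"
  using C_diff_add[OF _ C_diff_minus, of r f g] by auto

lemma C_diff_prod:
  fixes f :: "'i \<Rightarrow> real^3 \<Rightarrow> real"
  shows "(\<And>i. i \<in> I \<Longrightarrow> C_diff r (f i)) \<Longrightarrow> C_diff r (\<lambda>x. \<Prod>i\<in>I. f i x)"
  by (induction I rule: infinite_finite_induct) (auto intro: C_diff_const C_diff_mult)

lemma C_diff_component: "C_diff r f \<Longrightarrow> C_diff r (\<lambda>x. f x $ i)" for f :: "real^3 \<Rightarrow> real^3"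
  using C_diff_inner[OF _ C_diff_const, of r f "axis i 1"] by (simp add: cart_eq_inner_axis)

lemma C_diff_vec:
  fixes f :: "real^3 \<Rightarrow> real^3"
  assumes "\<And>i. C_diff r (\<lambda>x. f x $ i)" shows "C_diff r f"
proof -
  have "f x = (\<Sum>i\<in>UNIV. f x $ i *\<^sub>R axis i 1)" for x
    using basis_expansion[of "f x"] by (simp add: scalar_mult_eq_scaleR)
  then have "f = (\<lambda>x. \<Sum>i\<in>UNIV. f x $ i *\<^sub>R axis i 1)" by blast
  moreover have "C_diff r \<dots>" by (intro C_diff_sum C_diff_scaleR assms C_diff_const)
  ultimately show ?thesis by metis
qed

lemma C_diff_shift: "C_diff r f \<Longrightarrow> C_diff r (\<lambda>x. f (x - a))"
proof (induction r arbitrary: f)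
  case 0 then show ?case
    by (auto intro!: continuous_intros continuous_on_compose2[of UNIV f])
next
  case (Suc r)
  have d: "((\<lambda>x. f (x - a)) has_derivative frechet_derivative f (at (x - a))) (at x)" for x
  proof -
    have "((\<lambda>x. x - a) has_derivative (\<lambda>v. v)) (at x)" by (auto intro!: derivative_eq_intros)
    from diff_chain_at[OF this C_diff_has_derivative[OF Suc.prems]] show ?thesis by (simp add: o_def)
  qed
  show ?case by (rule C_diff_SucI[OF d]) (use Suc in auto)
qed

lemma C_diff_line_derivative:
  fixes f :: "real^3 \<Rightarrow> real"
  assumes f: "C_diff (Suc 0) f"
  shows "((\<lambda>s. f (x + s *\<^sub>R v)) has_field_derivative frechet_derivative f (at (x + s *\<^sub>R v)) v) (at s)"
proof -
  have "((\<lambda>s. x + s *\<^sub>R v) has_derivative (\<lambda>k. k *\<^sub>R v)) (at s)"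
    by (auto intro!: derivative_eq_intros)
  from diff_chain_at[OF this C_diff_has_derivative[OF f]]
  have "((\<lambda>s. f (x + s *\<^sub>R v)) has_derivative (\<lambda>k. k * frechet_derivative f (at (x + s *\<^sub>R v)) v)) (at s)"
    using linear_scale[OF has_derivative_linear[OF C_diff_has_derivative[OF f]]]
    by (simp add: o_def)
  then show ?thesis by (rule has_derivative_imp_has_field_derivative) simp
qed

text \<open>Both mixed derivatives are limits of the same second difference quotient: the mean value
  theorem, applied in either order, writes it as a mixed derivative at a point that converges
  to \<open>x\<close>.\<close>

lemma symmetric_second_derivatives:
  fixes f :: "real^3 \<Rightarrow> real"
  assumes f: "C_diff 2 f"
  shows "frechet_derivative (\<lambda>y. frechet_derivative f (at y) u) (at x) v
       = frechet_derivative (\<lambda>y. frechet_derivative f (at y) v) (at x) u"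
proof -
  define D where "D u v x = frechet_derivative (\<lambda>y. frechet_derivative f (at y) u) (at x) v" for u v x
  have f2: "C_diff (Suc (Suc 0)) f" using f by (simp add: numeral_2_eq_2)
  have cont: "continuous_on UNIV (D u v)" for u v
    unfolding D_def using f2 by auto
  have mv: "\<exists>s\<in>{0<..<h}. \<exists>t\<in>{0<..<h}.
      f (x + h *\<^sub>R u + h *\<^sub>R v) - f (x + h *\<^sub>R u) - f (x + h *\<^sub>R v) + f x = h * h * D u v (x + s *\<^sub>R u + t *\<^sub>R v)"
    if h: "h > 0" for h u v
  proof -
    have d1: "((\<lambda>s. f (x + s *\<^sub>R u + h *\<^sub>R v) - f (x + s *\<^sub>R u)) has_derivative
       (\<lambda>k. k * (frechet_derivative f (at (x + s *\<^sub>R u + h *\<^sub>R v)) u - frechet_derivative f (at (x + s *\<^sub>R u)) u))) (at s)" for s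
    proof -
      have "((\<lambda>s. f (x + s *\<^sub>R u + w)) has_derivative (\<lambda>k. k * frechet_derivative f (at (x + s *\<^sub>R u + w)) u)) (at s)" for w
      proof -
        have "((\<lambda>s. x + s *\<^sub>R u + w) has_derivative (\<lambda>k. k *\<^sub>R u)) (at s)"
          by (auto intro!: derivative_eq_intros)
        from diff_chain_at[OF this C_diff_has_derivative[OF f2]]
        show ?thesis
          using linear_scale[OF has_derivative_linear[OF C_diff_has_derivative[OF f2]]]
          by (simp add: o_def)
      qed
      from has_derivative_diff[OF this[of "h *\<^sub>R v"] this[of 0]] show ?thesis
        by (simp add: algebra_simps)
    qed
    obtain s where s: "0 < s" "s < h" and es:
      "f (x + h *\<^sub>R u + h *\<^sub>R v) - f (x + h *\<^sub>R u) - (f (x + h *\<^sub>R v) - f x)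
         = h * (frechet_derivative f (at (x + s *\<^sub>R u + h *\<^sub>R v)) u - frechet_derivative f (at (x + s *\<^sub>R u)) u)"
    proof (rule mvt[of 0 h "(\<lambda>s. f (x + s *\<^sub>R u + h *\<^sub>R v) - f (x + s *\<^sub>R u))", OF h _ d1])
      show "continuous_on {0..h} (\<lambda>s. f (x + s *\<^sub>R u + h *\<^sub>R v) - f (x + s *\<^sub>R u))"
        by (rule continuous_at_imp_continuous_on) (use has_derivative_continuous[OF d1] in auto)
    qed auto
    let ?g = "\<lambda>y. frechet_derivative f (at y) u"
    have d2: "((\<lambda>t. ?g (x + s *\<^sub>R u + t *\<^sub>R v)) has_derivative (\<lambda>k. k * D u v (x + s *\<^sub>R u + t *\<^sub>R v))) (at t)" for t
    proof -
      have g: "C_diff (Suc 0) ?g" using f2 by (simp only: C_diff_derivative)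
      have "((\<lambda>t. x + s *\<^sub>R u + t *\<^sub>R v) has_derivative (\<lambda>k. k *\<^sub>R v)) (at t)"
        by (auto intro!: derivative_eq_intros)
      from diff_chain_at[OF this C_diff_has_derivative[OF g]]
      show ?thesis
        using linear_scale[OF has_derivative_linear[OF C_diff_has_derivative[OF g]]]
        by (simp add: o_def D_def)
    qed
    obtain t where t: "0 < t" "t < h" and et:
      "?g (x + s *\<^sub>R u + h *\<^sub>R v) - ?g (x + s *\<^sub>R u) = h * D u v (x + s *\<^sub>R u + t *\<^sub>R v)"
    proof (rule mvt[of 0 h "(\<lambda>t. ?g (x + s *\<^sub>R u + t *\<^sub>R v))", OF h _ d2])
      show "continuous_on {0..h} (\<lambda>t. ?g (x + s *\<^sub>R u + t *\<^sub>R v))"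
        by (rule continuous_at_imp_continuous_on) (use has_derivative_continuous[OF d2] in auto)
    qed auto
    show ?thesis using s t es et by (intro bexI[of _ s] bexI[of _ t]) (auto simp: algebra_simps)
  qed
  define h where "h n = 1 / real (Suc n)" for n
  have h0: "h n > 0" for n by (simp add: h_def)
  have hl: "h \<longlonglongrightarrow> 0" unfolding h_def by (rule LIMSEQ_Suc[OF lim_1_over_n])
  have "\<exists>s t s' t'. s \<in> {0<..<h n} \<and> t \<in> {0<..<h n} \<and> s' \<in> {0<..<h n} \<and> t' \<in> {0<..<h n} \<and>
       D u v (x + s *\<^sub>R u + t *\<^sub>R v) = D v u (x + s' *\<^sub>R v + t' *\<^sub>R u)" for n
  proof -
    obtain s t where 1: "s \<in> {0<..<h n}" "t \<in> {0<..<h n}" "f (x + h n *\<^sub>R u + h n *\<^sub>R v) - f (x + h n *\<^sub>R u) - f (x + h n *\<^sub>R v) + f x = h n * h n * D u v (x + s *\<^sub>R u + t *\<^sub>R v)"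
      using mv[OF h0] by blast
    obtain s' t' where 2: "s' \<in> {0<..<h n}" "t' \<in> {0<..<h n}" "f (x + h n *\<^sub>R v + h n *\<^sub>R u) - f (x + h n *\<^sub>R v) - f (x + h n *\<^sub>R u) + f x = h n * h n * D v u (x + s' *\<^sub>R v + t' *\<^sub>R u)"
      using mv[OF h0] by blast
    have "h n * h n * D u v (x + s *\<^sub>R u + t *\<^sub>R v) = h n * h n * D v u (x + s' *\<^sub>R v + t' *\<^sub>R u)"
    proof -
      have "x + h n *\<^sub>R v + h n *\<^sub>R u = x + h n *\<^sub>R u + h n *\<^sub>R v" by simp
      with 2(3) have "f (x + h n *\<^sub>R u + h n *\<^sub>R v) - f (x + h n *\<^sub>R v) - f (x + h n *\<^sub>R u) + f x
          = h n * h n * D v u (x + s' *\<^sub>R v + t' *\<^sub>R u)" by (simp only:)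
      with 1(3) show ?thesis by linarith
    qed
    then have "D u v (x + s *\<^sub>R u + t *\<^sub>R v) = D v u (x + s' *\<^sub>R v + t' *\<^sub>R u)"
      using h0[of n] by simp
    then show ?thesis using 1 2 by blast
  qed
  then obtain s t s' t' where st: "\<And>n. s n \<in> {0<..<h n}" "\<And>n. t n \<in> {0<..<h n}" "\<And>n. s' n \<in> {0<..<h n}"
     "\<And>n. t' n \<in> {0<..<h n}" and eq: "\<And>n. D u v (x + s n *\<^sub>R u + t n *\<^sub>R v) = D v u (x + s' n *\<^sub>R v + t' n *\<^sub>R u)"
    by metis
  have z: "r \<longlonglongrightarrow> 0" if "\<And>n. r n \<in> {0<..<h n}" for r :: "nat \<Rightarrow> real"
    by (rule real_tendsto_sandwich[OF _ _ tendsto_const hl]) (use that less_imp_le in \<open>auto simp: less_imp_le\<close>)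
  have lim: "(\<lambda>n. D u v (x + a n *\<^sub>R u' + b n *\<^sub>R v')) \<longlonglongrightarrow> D u v x"
    if "a \<longlonglongrightarrow> 0" "b \<longlonglongrightarrow> 0" for u v u' v' a b
  proof -
    have "(\<lambda>n. x + a n *\<^sub>R u' + b n *\<^sub>R v') \<longlonglongrightarrow> x + 0 *\<^sub>R u' + 0 *\<^sub>R v'"
      by (intro tendsto_intros that)
    then have "(\<lambda>n. x + a n *\<^sub>R u' + b n *\<^sub>R v') \<longlonglongrightarrow> x" by simp
    moreover have "isCont (D u v) x" using cont by (simp add: continuous_on_eq_continuous_at)
    ultimately show ?thesis by (rule isCont_tendsto_compose[rotated])
  qed
  have "D u v x = D v u x"
    using LIMSEQ_unique[OF lim[OF z[OF st(1)] z[OF st(2)], of u v u v]] lim[OF z[OF st(3)] z[OF st(4)], of v u v u] eq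
    by simp
  then show ?thesis by (simp add: D_def)
qed

text \<open>The function \<open>exp (-1/t)\<close> extended by 0 to \<open>t \<le> 0\<close>, divided by powers of \<open>t\<close>: the
  family is closed under differentiation up to linear combinations, which is how its smoothness at 0
  is proved.\<close>

definition flat_exp :: "nat \<Rightarrow> real \<Rightarrow> real" where
  "flat_exp k t = (if t > 0 then exp (- (1/t)) / t ^ k else 0)"

lemma flat_exp_tendsto_0: "(flat_exp k \<longlongrightarrow> 0) (at 0)"
proof -
  have "((\<lambda>t. (1/t) ^ k / exp (1/t)) \<longlongrightarrow> 0) (at_right (0::real))"
  proof -
    have "filterlim (\<lambda>t. 1/t) at_top (at_right (0::real))"
      using filterlim_inverse_at_top_right by (simp add: inverse_eq_divide)
    from filterlim_compose[OF tendsto_power_div_exp_0 this] show ?thesis .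
  qed
  then have "(flat_exp k \<longlongrightarrow> 0) (at_right 0)"
    by (rule Lim_transform_eventually)
       (auto simp: flat_exp_def eventually_at_right_field exp_minus field_simps intro!: exI[of _ 1])
  moreover have "(flat_exp k \<longlongrightarrow> 0) (at_left 0)"
    by (rule Lim_transform_eventually[OF tendsto_const])
       (auto simp: flat_exp_def eventually_at_left_field intro!: exI[of _ "-1"])
  ultimately show ?thesis by (simp add: filterlim_split_at)
qed

lemma flat_exp_has_derivative:
  "(flat_exp k has_field_derivative (flat_exp (k+2) t - k * flat_exp (k+1) t)) (at t)"
proof -
  consider "t > 0" | "t = 0" | "t < 0" by linarith
  then show ?thesis
  proof cases
    case 1
    have "((\<lambda>t. exp (- (1/t)) / t ^ k) has_field_derivative (flat_exp (k+2) t - k * flat_exp (k+1) t)) (at t)"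
    proof (cases k)
      case 0
      then show ?thesis using 1
        by (auto intro!: derivative_eq_intros simp: flat_exp_def field_simps power2_eq_square)
    next
      case (Suc j)
      have "j * (t * t ^ (j - Suc 0)) = j * t ^ j" by (cases j) auto
      then show ?thesis using 1 Suc
        by (auto intro!: derivative_eq_intros simp: flat_exp_def field_simps power2_eq_square)
    qed
    then show ?thesis
      by (rule has_field_derivative_transform_within_open[of _ _ _ "{0<..}"]) (use 1 in \<open>auto simp: flat_exp_def\<close>)
  next
    case 2
    have "flat_exp k h / h = flat_exp (k+1) h" for h
      by (simp add: flat_exp_def)
    then show ?thesis using 2 flat_exp_tendsto_0[of "k+1"]
      by (simp add: has_field_derivative_iff flat_exp_def[of _ 0])
  next
    case 3
    have "((\<lambda>t. 0) has_field_derivative (flat_exp (k+2) t - k * flat_exp (k+1) t)) (at t)"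
      using 3 by (auto simp: flat_exp_def)
    then show ?thesis
      by (rule has_field_derivative_transform_within_open[of _ _ _ "{..<0}"]) (use 3 in \<open>auto simp: flat_exp_def\<close>)
  qed
qed

lemma C_diff_flat_exp: "C_diff r (\<lambda>x. flat_exp k (a \<bullet> x + b))"
proof (induction r arbitrary: k)
  case 0
  have "continuous_on UNIV (flat_exp k)"
    using DERIV_isCont[OF flat_exp_has_derivative] by (auto simp: continuous_on_eq_continuous_at)
  then show ?case
    by (auto intro!: continuous_intros continuous_on_compose2[of UNIV "flat_exp k"])
next
  case (Suc r)
  have d: "((\<lambda>x. flat_exp k (a \<bullet> x + b)) has_derivative
       (\<lambda>v. (flat_exp (k+2) (a \<bullet> x + b) - k * flat_exp (k+1) (a \<bullet> x + b)) * (a \<bullet> v))) (at x)" for x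
  proof -
    have "((\<lambda>x. a \<bullet> x + b) has_derivative (\<lambda>v. a \<bullet> v)) (at x)"
      by (auto intro!: derivative_eq_intros)
    from diff_chain_at[OF this has_field_derivative_imp_has_derivative[OF flat_exp_has_derivative]]
    show ?thesis by (simp add: o_def)
  qed
  show ?case
    by (rule C_diff_SucI[OF d]) (intro C_diff_mult C_diff_diff C_diff_const Suc)
qed

lemma flat_exp_0_bounds: "0 \<le> flat_exp 0 t" "flat_exp 0 t \<le> 1"
  by (auto simp: flat_exp_def)

lemma flat_exp_0_tendsto_1: "c > 0 \<Longrightarrow> (\<lambda>n. flat_exp 0 (real n * c - 1)) \<longlonglongrightarrow> 1"
proof -
  assume c: "c > 0"
  have "filterlim (\<lambda>n. c * real n) at_top sequentially"
    using filterlim_tendsto_pos_mult_at_top[OF tendsto_const c filterlim_real_sequentially] .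
  then have f: "filterlim (\<lambda>n. real n * c - 1) at_top sequentially"
    using filterlim_tendsto_add_at_top[OF tendsto_const[of "-1"]] by (simp add: mult.commute)
  have "(\<lambda>n. exp (- (1 / (real n * c - 1)))) \<longlonglongrightarrow> exp (- 0)"
    by (intro tendsto_intros tendsto_divide_0[OF tendsto_const] filterlim_at_top_imp_at_infinity f)
  moreover have "\<forall>\<^sub>F n in sequentially. exp (- (1 / (real n * c - 1))) = flat_exp 0 (real n * c - 1)"
    using filterlim_at_top_dense[THEN iffD1, OF f, rule_format, of 0] by eventually_elim (simp add: flat_exp_def)
  ultimately show ?thesis by (simp add: Lim_transform_eventually)
qed

text \<open>The cutoffs are products over half-spaces that cut out the polytope. A factor vanishes unless its half-space
  condition holds with the margin \<open>1/n\<close>, so the supports stay away from the boundary.\<close>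

lemma polytope_cutoffs:
  fixes K :: "(real^3) set"
  assumes K: "polytope K"
  obtains \<kappa> :: "nat \<Rightarrow> real^3 \<Rightarrow> real" where
    "\<And>n r. C_diff r (\<kappa> n)" "\<And>n x. 0 \<le> \<kappa> n x" "\<And>n x. \<kappa> n x \<le> 1"
    "\<And>n. compact (closure {x. \<kappa> n x \<noteq> 0})" "\<And>n. closure {x. \<kappa> n x \<noteq> 0} \<subseteq> interior K"
    "\<And>x. x \<in> interior K \<Longrightarrow> (\<lambda>n. \<kappa> n x) \<longlonglongrightarrow> 1"
proof -
  obtain F where F: "finite F" "K = \<Inter>F" "\<forall>h\<in>F. \<exists>a b. a \<noteq> 0 \<and> h = {x. a \<bullet> x \<le> b}"
    using polytope_imp_polyhedron[OF K] unfolding polyhedron_def by blast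
  then obtain a b where ab: "\<And>h. h \<in> F \<Longrightarrow> a h \<noteq> 0 \<and> h = {x. a h \<bullet> x \<le> b h}" by metis
  define \<kappa> where "\<kappa> n x = (\<Prod>h\<in>F. flat_exp 0 (real n * (b h - a h \<bullet> x) - 1))" for n x
  have int: "interior K = (\<Inter>h\<in>F. {x. a h \<bullet> x < b h})"
  proof -
    have "interior K = (\<Inter>h\<in>F. interior h)"
      unfolding F(2) using F(1) by (induction F) auto
    also have "\<dots> = (\<Inter>h\<in>F. {x. a h \<bullet> x < b h})"
    proof (rule INF_cong[OF refl])
      fix h assume "h \<in> F"
      from ab[OF this] show "interior h = {x. a h \<bullet> x < b h}"
        using interior_halfspace_le by metis
    qed
    finally show ?thesis .
  qed
  have sub: "closure {x. \<kappa> n x \<noteq> 0} \<subseteq> {x. \<forall>h\<in>F. 1 \<le> real n * (b h - a h \<bullet> x)}" for n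
  proof (rule closure_minimal)
    show "{x. \<kappa> n x \<noteq> 0} \<subseteq> {x. \<forall>h\<in>F. 1 \<le> real n * (b h - a h \<bullet> x)}"
      using F(1) by (auto simp: \<kappa>_def flat_exp_def split: if_splits)
    have "{x. \<forall>h\<in>F. 1 \<le> real n * (b h - a h \<bullet> x)} = (\<Inter>h\<in>F. {x. 1 \<le> real n * (b h - a h \<bullet> x)})" by auto
    moreover have "closed {x. 1 \<le> real n * (b h - a h \<bullet> x)}" for h
      by (intro closed_Collect_le continuous_intros)
    ultimately show "closed {x. \<forall>h\<in>F. 1 \<le> real n * (b h - a h \<bullet> x)}" by auto
  qed
  have sub2: "closure {x. \<kappa> n x \<noteq> 0} \<subseteq> interior K" for n
  proof
    fix x assume "x \<in> closure {x. \<kappa> n x \<noteq> 0}"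
    then have 1: "\<forall>h\<in>F. 1 \<le> real n * (b h - a h \<bullet> x)" using sub by auto
    show "x \<in> interior K" unfolding int
    proof (intro INT_I CollectI)
      fix h assume "h \<in> F"
      with 1 have "0 < real n * (b h - a h \<bullet> x)" by fastforce
      then show "a h \<bullet> x < b h" by (simp add: zero_less_mult_iff)
    qed
  qed
  show ?thesis
  proof (rule that[of \<kappa>])
    fix n r
    have "flat_exp 0 (real n * (b h - a h \<bullet> x) - 1) = flat_exp 0 ((- (real n *\<^sub>R a h)) \<bullet> x + (real n * b h - 1))" for h x
      by (simp add: algebra_simps)
    then show "C_diff r (\<kappa> n)"
      unfolding \<kappa>_def by (simp only:) (intro C_diff_prod C_diff_flat_exp)
  next
    fix n x show "0 \<le> \<kappa> n x" "\<kappa> n x \<le> 1"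
      unfolding \<kappa>_def by (auto intro!: prod_nonneg prod_le_1 simp: flat_exp_0_bounds)
  next
    fix n
    show "closure {x. \<kappa> n x \<noteq> 0} \<subseteq> interior K" by (rule sub2)
    have "bounded (closure {x. \<kappa> n x \<noteq> 0})"
      using polytope_imp_bounded[OF K] sub2 interior_subset bounded_subset by metis
    then show "compact (closure {x. \<kappa> n x \<noteq> 0})" by (simp add: compact_eq_bounded_closed)
  next
    fix x assume "x \<in> interior K"
    then have "(\<lambda>n. \<Prod>h\<in>F. flat_exp 0 (real n * (b h - a h \<bullet> x) - 1)) \<longlonglongrightarrow> (\<Prod>h\<in>F. 1)"
      by (intro tendsto_prod flat_exp_0_tendsto_1) (auto simp: int)
    then show "(\<lambda>n. \<kappa> n x) \<longlonglongrightarrow> 1" by (simp add: \<kappa>_def)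
  qed
qed


section \<open>Integration of cellwise continuous fields\<close>

text \<open>The class of fields used for all integrability arguments: it contains every discrete field and
  all test functions, is closed under pointwise continuous operations, and its members are bounded
  in the open cells because the closed cells are compact.\<close>

definition cellwise_continuous :: "(real^3) set set \<Rightarrow> (real^3 \<Rightarrow> 'b::topological_space) \<Rightarrow> bool" where
  "cellwise_continuous \<T> f \<longleftrightarrow>
     (\<forall>K\<in>\<T>. \<exists>p. continuous_on K p \<and> (\<forall>x\<in>interior K. f x = p x))"

lemma cellwise_continuousI:
  "continuous_on UNIV f \<Longrightarrow> cellwise_continuous \<T> f"
  unfolding cellwise_continuous_def using continuous_on_subset by blast

lemma cellwise_continuous_compose2:
  assumes "cellwise_continuous \<T> f" "cellwise_continuous \<T> g"
    and h: "continuous_on UNIV (\<lambda>z. h (fst z) (snd z))"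
  shows "cellwise_continuous \<T> (\<lambda>x. h (f x) (g x))"
  unfolding cellwise_continuous_def
proof
  fix K assume "K \<in> \<T>"
  with assms obtain p q where pq: "continuous_on K p" "\<forall>x\<in>interior K. f x = p x"
    "continuous_on K q" "\<forall>x\<in>interior K. g x = q x"
    unfolding cellwise_continuous_def by meson
  have "continuous_on K (\<lambda>x. h (p x) (q x))"
    using continuous_on_compose2[OF h continuous_on_Pair[OF pq(1,3)]] by simp
  then show "\<exists>p. continuous_on K p \<and> (\<forall>x\<in>interior K. h (f x) (g x) = p x)"
    using pq by auto
qed

lemma bounded_bilinear_cross3: "bounded_bilinear cross3"
  using bilinear_cross bilinear_conv_bounded_bilinear by blast

lemma cellwise_continuous_bilinear:
  assumes "bounded_bilinear b" "cellwise_continuous \<T> f" "cellwise_continuous \<T> g"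
  shows "cellwise_continuous \<T> (\<lambda>x. b (f x) (g x))"
  by (rule cellwise_continuous_compose2[OF assms(2,3)])
     (intro bounded_bilinear.continuous_on[OF assms(1)] continuous_intros)

lemma cellwise_continuous_const: "cellwise_continuous \<T> (\<lambda>x. c)"
  by (intro cellwise_continuousI continuous_intros)

lemma cellwise_continuous_add:
  fixes f g :: "real^3 \<Rightarrow> 'b::real_normed_vector"
  shows "cellwise_continuous \<T> f \<Longrightarrow> cellwise_continuous \<T> g \<Longrightarrow> cellwise_continuous \<T> (\<lambda>x. f x + g x)"
  by (rule cellwise_continuous_compose2[of _ f g "\<lambda>u v. u + v"]) (auto intro!: continuous_intros)

lemma cellwise_continuous_diff:
  fixes f g :: "real^3 \<Rightarrow> 'b::real_normed_vector"
  shows "cellwise_continuous \<T> f \<Longrightarrow> cellwise_continuous \<T> g \<Longrightarrow> cellwise_continuous \<T> (\<lambda>x. f x - g x)"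
  by (rule cellwise_continuous_compose2[of _ f g "\<lambda>u v. u - v"]) (auto intro!: continuous_intros)

lemma cellwise_continuous_norm:
  fixes f :: "real^3 \<Rightarrow> 'b::real_normed_vector"
  shows "cellwise_continuous \<T> f \<Longrightarrow> cellwise_continuous \<T> (\<lambda>x. (norm (f x))\<^sup>2)"
  by (rule cellwise_continuous_compose2[of _ f f "\<lambda>u v. (norm u)\<^sup>2"]) (auto intro!: continuous_intros)

lemmas cellwise_continuous_intros =
  cellwise_continuous_const cellwise_continuous_add cellwise_continuous_diff cellwise_continuous_norm
  cellwise_continuous_bilinear[OF bounded_bilinear_mult]
  cellwise_continuous_bilinear[OF bounded_bilinear_scaleR]
  cellwise_continuous_bilinear[OF bounded_bilinear_inner]
  cellwise_continuous_bilinear[OF bounded_bilinear_cross3]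

lemma integrable_lebesgue_on_iff:
  assumes "S \<in> sets lebesgue"
  shows "integrable (lebesgue_on S) f \<longleftrightarrow> f absolutely_integrable_on S"
  using assms by (simp add: integrable_restrict_space set_integrable_def)

lemma LINT_eq_integral:
  fixes f :: "real^3 \<Rightarrow> 'b::euclidean_space"
  assumes "f absolutely_integrable_on S" "S \<in> sets lebesgue"
  shows "integral\<^sup>L (lebesgue_on S) f = integral S f"
  using assms by (simp add: lebesgue_integral_eq_integral integrable_lebesgue_on_iff)

locale fe_mesh =
  fixes \<Omega> :: "(real^3) set" and \<T> :: "(real^3) set set"
  assumes domain: "bounded_domain \<Omega>" and mesh: "conforming_mesh \<Omega> \<T>"
begin

lemma open_dom: "open \<Omega>" and bounded_dom: "bounded \<Omega>"
  using domain by (auto simp: bounded_domain_def)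

lemma dom_sets [simp]: "\<Omega> \<in> sets lebesgue" "\<Omega> \<in> sets borel"
  using open_dom by auto

lemma dom_lmeasurable: "\<Omega> \<in> lmeasurable"
  using open_dom bounded_dom by (simp add: lmeasurable_open)

lemmas mesh_unfolded = mesh[unfolded conforming_mesh_def]

lemmas finite_cells = mesh_unfolded[THEN conjunct1]

lemma cell_polytope: "K \<in> \<T> \<Longrightarrow> polytope K" and cell_interior: "K \<in> \<T> \<Longrightarrow> interior K \<noteq> {}"
  using mesh_unfolded[THEN conjunct2, THEN conjunct1] by simp_all

lemma cells_disjoint: "K \<in> \<T> \<Longrightarrow> L \<in> \<T> \<Longrightarrow> K \<noteq> L \<Longrightarrow> interior K \<inter> interior L = {}"
  using mesh_unfolded[THEN conjunct2, THEN conjunct2, THEN conjunct1] by simp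

lemmas cells_cover = mesh_unfolded[THEN conjunct2, THEN conjunct2, THEN conjunct2, THEN conjunct1]
lemmas dom_eq = mesh_unfolded[THEN conjunct2, THEN conjunct2, THEN conjunct2, THEN conjunct2]

lemma cell_convex: "K \<in> \<T> \<Longrightarrow> convex K" and cell_compact: "K \<in> \<T> \<Longrightarrow> compact K"
  and cell_closed: "K \<in> \<T> \<Longrightarrow> closed K"
  using cell_polytope[of K] polytope_imp_convex[of K] polytope_imp_compact[of K] polytope_imp_closed[of K]
  by simp_all

lemma interior_cell_subset: "K \<in> \<T> \<Longrightarrow> interior K \<subseteq> \<Omega>"
  by (subst dom_eq, rule interior_mono) auto

lemma negligible_skeleton: "negligible (\<Union>K\<in>\<T>. frontier K)"
  using finite_cells cell_convex negligible_convex_frontier by (auto intro!: negligible_Union)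

lemma skeleton_complement: "x \<in> \<Omega> - (\<Union>K\<in>\<T>. frontier K) \<Longrightarrow> \<exists>K\<in>\<T>. x \<in> interior K"
proof -
  assume x: "x \<in> \<Omega> - (\<Union>K\<in>\<T>. frontier K)"
  then have "x \<in> \<Union>\<T>" using cells_cover closure_subset by blast
  then obtain K where "K \<in> \<T>" "x \<in> K" by blast
  with x show ?thesis using cell_closed[of K] by (auto simp: frontier_def)
qed

lemma cellwise_spike:
  fixes f g :: "real^3 \<Rightarrow> 'b::euclidean_space"
  assumes "f absolutely_integrable_on \<Omega>" "\<And>K x. K \<in> \<T> \<Longrightarrow> x \<in> interior K \<Longrightarrow> g x = f x"
  shows "g absolutely_integrable_on \<Omega>"
  by (rule absolutely_integrable_spike[OF assms(1) negligible_skeleton])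
     (use skeleton_complement assms(2) in blast)

lemma cellwise_LINT_cong:
  fixes f g :: "real^3 \<Rightarrow> 'b::euclidean_space"
  assumes "integrable (lebesgue_on \<Omega>) f" "\<And>K x. K \<in> \<T> \<Longrightarrow> x \<in> interior K \<Longrightarrow> f x = g x"
  shows "integral\<^sup>L (lebesgue_on \<Omega>) f = integral\<^sup>L (lebesgue_on \<Omega>) g"
proof -
  have f: "f absolutely_integrable_on \<Omega>" using assms(1) by (simp add: integrable_lebesgue_on_iff)
  then have g: "g absolutely_integrable_on \<Omega>" using cellwise_spike assms(2) by metis
  have "integral \<Omega> f = integral \<Omega> g"
    by (rule integral_spike[OF negligible_skeleton]) (use skeleton_complement assms(2) in metis)
  then show ?thesis using f g by (simp add: LINT_eq_integral)
qed

lemma AE_in_cell: "AE x in lebesgue_on \<Omega>. \<exists>K\<in>\<T>. x \<in> interior K"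
proof -
  have "(\<Union>K\<in>\<T>. frontier K) \<in> null_sets lebesgue"
    using negligible_skeleton negligible_iff_null_sets by blast
  then have "AE x in lebesgue. x \<notin> (\<Union>K\<in>\<T>. frontier K)" by (rule AE_not_in)
  then have "AE x in lebesgue. x \<in> \<Omega> \<longrightarrow> (\<exists>K\<in>\<T>. x \<in> interior K)"
    by eventually_elim (use skeleton_complement in blast)
  then show ?thesis by (simp add: AE_restrict_space_iff)
qed

lemma cellwise_continuous_integrable:
  fixes f :: "real^3 \<Rightarrow> 'b::euclidean_space"
  assumes "cellwise_continuous \<T> f"
  shows "integrable (lebesgue_on \<Omega>) f"
proof -
  from assms obtain p where p: "\<And>K. K \<in> \<T> \<Longrightarrow> continuous_on K (p K)"
     "\<And>K x. K \<in> \<T> \<Longrightarrow> x \<in> interior K \<Longrightarrow> f x = p K x"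
    unfolding cellwise_continuous_def by metis
  have 1: "(\<lambda>x. indicator (interior K) x *\<^sub>R p K x) absolutely_integrable_on \<Omega>" if K: "K \<in> \<T>" for K
  proof -
    have "p K absolutely_integrable_on K"
    proof -
      have "integrable lborel (\<lambda>x. indicator K x *\<^sub>R p K x)"
        using borel_integrable_compact[OF cell_compact[OF K] p(1)[OF K]] .
      then show ?thesis unfolding set_integrable_def
        by (simp add: integrable_completion borel_measurable_integrable)
    qed
    then have "p K absolutely_integrable_on (interior K)"
      by (rule set_integrable_subset) (auto simp: interior_subset)
    then show ?thesis
      using interior_cell_subset[OF K] unfolding set_integrable_def
      by (elim Bochner_Integration.integrable_cong[THEN iffD1, rotated 2]) (auto simp: indicator_def)
  qed
  have "(\<lambda>x. \<Sum>K\<in>\<T>. indicator (interior K) x *\<^sub>R p K x) absolutely_integrable_on \<Omega>"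
    using 1 finite_cells by (intro absolutely_integrable_sum) auto
  then have "f absolutely_integrable_on \<Omega>"
  proof (rule cellwise_spike)
    fix K x assume K: "K \<in> \<T>" "x \<in> interior K"
    then have "L \<in> \<T> \<Longrightarrow> indicator (interior L) x *\<^sub>R p L x = (if L = K then p K x else 0)" for L
      using cells_disjoint[of K L] by (auto simp: indicator_def)
    then have "(\<Sum>L\<in>\<T>. indicator (interior L) x *\<^sub>R p L x) = p K x"
      using K finite_cells by simp
    then show "f x = (\<Sum>L\<in>\<T>. indicator (interior L) x *\<^sub>R p L x)" using p(2)[OF K] by simp
  qed
  then show ?thesis by (simp add: integrable_lebesgue_on_iff)
qed

lemma cellwise_continuous_L2:
  fixes f :: "real^3 \<Rightarrow> 'b::euclidean_space"
  assumes "cellwise_continuous \<T> f" shows "f \<in> L2 \<Omega>"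
  unfolding L2_def
  using borel_measurable_integrable[OF cellwise_continuous_integrable[OF assms]]
    cellwise_continuous_integrable[OF cellwise_continuous_norm[OF assms]] by simp

lemma cellwise_continuous_LINT_cong:
  fixes f g :: "real^3 \<Rightarrow> 'b::euclidean_space"
  assumes "cellwise_continuous \<T> f" "\<And>K x. K \<in> \<T> \<Longrightarrow> x \<in> interior K \<Longrightarrow> f x = g x"
  shows "integral\<^sup>L (lebesgue_on \<Omega>) f = integral\<^sup>L (lebesgue_on \<Omega>) g"
  using cellwise_LINT_cong cellwise_continuous_integrable assms by blast

end

lemma islimpt_interior_convex:
  fixes K :: "(real^3) set"
  assumes "convex K" "interior K \<noteq> {}" "x \<in> K" shows "x islimpt interior K"
proof (cases "x \<in> interior K")
  case True
  then show ?thesis by (metis interior_interior interior_limit_point)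
next
  case False
  have "x \<in> closure (interior K)"
    using assms convex_closure_interior closure_subset by blast
  with False show ?thesis by (auto simp: closure_def)
qed

lemma cell_trace_eq:
  fixes K :: "(real^3) set" and f p :: "real^3 \<Rightarrow> 'b::real_normed_vector"
  assumes "convex K" "interior K \<noteq> {}" "x \<in> K" "continuous_on K p" "\<And>y. y \<in> interior K \<Longrightarrow> f y = p y"
  shows "cell_trace K f x = p x"
  unfolding cell_trace_def
proof (rule tendsto_Lim)
  show "at x within interior K \<noteq> bot"
    using islimpt_interior_convex[OF assms(1-3)] by (simp add: trivial_limit_within)
  have "(p \<longlongrightarrow> p x) (at x within interior K)"
    using assms(3,4) interior_subset tendsto_within_subset unfolding continuous_on_def by blast
  then show "(f \<longlongrightarrow> p x) (at x within interior K)"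
    by (rule Lim_transform_eventually) (auto simp: eventually_at_filter assms(5))
qed

section \<open>Integration by parts against test functions\<close>

lemma frechet_derivative_zero_outside:
  assumes "x \<notin> closure {x. f x \<noteq> 0}" shows "frechet_derivative f (at x) v = 0"
proof -
  have "((\<lambda>x. 0) has_derivative (\<lambda>v. 0)) (at x)" by simp
  then have "(f has_derivative (\<lambda>v. 0)) (at x)"
    by (rule has_derivative_transform_within_open[of _ _ _ _ "- closure {x. f x \<noteq> 0}"])
       (use assms closure_subset[of "{x. f x \<noteq> 0}"] in auto)
  then show ?thesis using frechet_derivative_at by metis
qed

lemma C_diff_0_vanishing_integrable:
  fixes f :: "real^3 \<Rightarrow> 'b::euclidean_space"
  assumes "continuous_on UNIV f" "bounded S" "\<And>x. x \<notin> S \<Longrightarrow> f x = 0"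
  shows "integrable lborel f"
proof -
  have "integrable lborel (\<lambda>x. indicator (closure S) x *\<^sub>R f x)"
    using assms by (intro borel_integrable_compact) (auto simp: compact_closure intro: continuous_on_subset)
  moreover have "(\<lambda>x. indicator (closure S) x *\<^sub>R f x) = f"
    using assms(3) closure_subset[of S] by (fastforce simp: indicator_def)
  ultimately show ?thesis by simp
qed

text \<open>The difference quotients of \<open>f\<close> have integral zero by translation invariance.\<close>

lemma integral_derivative_eq_0:
  fixes f :: "real^3 \<Rightarrow> real"
  assumes f: "C_diff 1 f" and supp: "bounded {x. f x \<noteq> 0}"
  shows "(LINT x|lborel. frechet_derivative f (at x) v) = 0"
proof -
  define d where "d x = frechet_derivative f (at x) v" for x
  have f1: "C_diff (Suc 0) f" using f by simp
  have cf: "continuous_on UNIV f" using C_diff_continuous[OF f1] .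
  have cd: "continuous_on UNIV d" unfolding d_def using f1 by auto
  obtain R where R: "R > 0" "\<forall>x\<in>closure {x. f x \<noteq> 0}. norm x \<le> R"
    using bounded_closure[OF supp] unfolding bounded_pos by blast
  have f0: "f x = 0" if "norm x > R" for x
    using that R(2) closure_subset[of "{x. f x \<noteq> 0}"] by fastforce
  have d0: "d x = 0" if "norm x > R" for x
    unfolding d_def by (rule frechet_derivative_zero_outside) (use that R(2) in fastforce)
  define R' where "R' = R + norm v"
  have "compact (d ` cball 0 R)"
    by (intro compact_continuous_image continuous_on_subset[OF cd]) auto
  then have "bounded (d ` cball 0 R)" by (rule compact_imp_bounded)
  then obtain C where C0: "C > 0" "\<forall>y\<in>d ` cball 0 R. norm y \<le> C"
    unfolding bounded_pos by blast
  then have C: "\<bar>d x\<bar> \<le> C" if "norm x \<le> R" for x using that by simp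
  then have C': "\<bar>d x\<bar> \<le> C" for x using d0[of x] C[of x] C0(1) by (cases "norm x \<le> R") auto
  define h where "h n = 1 / real (Suc n)" for n
  have h0: "h n > 0" "h n \<le> 1" for n by (auto simp: h_def)
  have hl: "h \<longlonglongrightarrow> 0" unfolding h_def by (rule LIMSEQ_Suc[OF lim_1_over_n])
  define q where "q n x = (f (h n *\<^sub>R v + x) - f x) / h n" for n x
  have der: "((\<lambda>s. f (x + s *\<^sub>R v)) has_field_derivative d (x + s *\<^sub>R v)) (at s)" for x s
    unfolding d_def by (rule C_diff_line_derivative[OF f1])
  have int_f: "integrable lborel f"
    using C_diff_0_vanishing_integrable[OF cf supp] by simp
  have shift: "(LINT x|lborel. f (c + x)) = (LINT x|lborel. f x)" "integrable lborel (\<lambda>x. f (c + x))" for c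
  proof -
    have "integrable (distr lborel borel ((+) c)) f" using int_f by (simp add: lborel_distr_plus)
    then show "integrable lborel (\<lambda>x. f (c + x))"
      by (subst (asm) integrable_distr_eq) (use int_f in auto)
    have "(LINT x|lborel. f x) = (LINT x|distr lborel borel ((+) c). f x)" by (simp add: lborel_distr_plus)
    also have "\<dots> = (LINT x|lborel. f (c + x))" by (rule integral_distr) (use int_f in auto)
    finally show "(LINT x|lborel. f (c + x)) = (LINT x|lborel. f x)" by simp
  qed
  have q0: "(LINT x|lborel. q n x) = 0" for n
    unfolding q_def using shift[of "h n *\<^sub>R v"] int_f by simp
  have "(\<lambda>n. LINT x|lborel. q n x) \<longlonglongrightarrow> (LINT x|lborel. d x)"
  proof (rule integral_dominated_convergence[where w = "\<lambda>x. indicator (cball 0 R') x *\<^sub>R C"])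
    show "d \<in> borel_measurable lborel" using cd by (simp add: borel_measurable_continuous_onI)
    show "q n \<in> borel_measurable lborel" for n
      unfolding q_def using shift[of "h n *\<^sub>R v"] int_f by (auto dest!: borel_measurable_integrable)
    show "integrable lborel (\<lambda>x. indicator (cball 0 R') x *\<^sub>R C)"
      by (intro borel_integrable_compact) auto
    show "AE x in lborel. (\<lambda>n. q n x) \<longlonglongrightarrow> d x"
    proof (intro AE_I2)
      fix x
      have "((\<lambda>s. (f (x + s *\<^sub>R v) - f x) / s) \<longlongrightarrow> d x) (at 0)"
        using der[of x 0] by (simp add: has_field_derivative_iff)
      moreover have "filterlim h (at 0) sequentially"
        using hl h0 by (auto simp: filterlim_at eventually_sequentially less_imp_neq[symmetric])
      ultimately show "(\<lambda>n. q n x) \<longlonglongrightarrow> d x"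
        unfolding q_def by (auto dest: filterlim_compose simp: add.commute)
    qed
    show "AE x in lborel. norm (q n x) \<le> indicator (cball 0 R') x *\<^sub>R C" for n
    proof (intro AE_I2)
      fix x
      obtain s where s: "f (x + h n *\<^sub>R v) - f x = h n * d (x + s *\<^sub>R v)"
      proof -
        have "\<exists>z. 0 < z \<and> z < h n \<and> f (x + h n *\<^sub>R v) - f (x + 0 *\<^sub>R v) = (h n - 0) * d (x + z *\<^sub>R v)"
          by (rule MVT2[OF h0(1)]) (rule der)
        then show ?thesis using that by auto
      qed
      show "norm (q n x) \<le> indicator (cball 0 R') x *\<^sub>R C"
      proof (cases "x \<in> cball 0 R'")
        case True
        then show ?thesis using s C' h0[of n] by (simp add: q_def add.commute)
      next
        case False
        then have "norm x > R + norm v" by (simp add: R'_def)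
        moreover have "norm (h n *\<^sub>R v) \<le> norm v" using h0[of n] by (simp add: mult_left_le_one_le)
        moreover have "norm x \<le> norm (h n *\<^sub>R v + x) + norm (h n *\<^sub>R v)"
          by (metis add.commute add_diff_cancel_right' norm_triangle_sub norm_triangle_ineq4)
        ultimately have "norm (h n *\<^sub>R v + x) > R" "norm x > R" using norm_ge_zero[of v] by linarith+
        then show ?thesis using f0 False by (simp add: q_def)
      qed
    qed
  qed
  then show ?thesis using q0 LIMSEQ_unique[OF tendsto_const] by (force simp: d_def)
qed


section \<open>Polynomials\<close>

definition monomial :: "(3 \<Rightarrow> nat) \<Rightarrow> real^3 \<Rightarrow> real" where
  "monomial \<alpha> x = (\<Prod>i\<in>UNIV. (x $ i) ^ \<alpha> i)"

text \<open>Needed because a sum over an infinite index set would be 0 by convention.\<close>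

lemma finite_multi_indices: "finite {\<alpha> :: 3 \<Rightarrow> nat. (\<Sum>i\<in>UNIV. \<alpha> i) \<le> k}"
proof (rule finite_subset)
  show "{\<alpha> :: 3 \<Rightarrow> nat. (\<Sum>i\<in>UNIV. \<alpha> i) \<le> k} \<subseteq> {\<alpha>. \<forall>i. (i \<in> UNIV \<longrightarrow> \<alpha> i \<in> {..k}) \<and> (i \<notin> UNIV \<longrightarrow> \<alpha> i = 0)}"
    by (auto intro: order_trans[OF member_le_sum[of _ UNIV]])
  show "finite {\<alpha> :: 3 \<Rightarrow> nat. \<forall>i. (i \<in> UNIV \<longrightarrow> \<alpha> i \<in> {..k}) \<and> (i \<notin> UNIV \<longrightarrow> \<alpha> i = 0)}"
    by (rule finite_set_of_finite_funs) auto
qed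

lemma polys_iff:
  "p \<in> polys k \<longleftrightarrow> (\<exists>a. p = (\<lambda>x. \<Sum>\<alpha> | (\<Sum>i\<in>UNIV. \<alpha> i) \<le> k. a \<alpha> * monomial \<alpha> x))"
  unfolding polys_def monomial_def by simp

lemma polys_add: "p \<in> polys k \<Longrightarrow> q \<in> polys k \<Longrightarrow> (\<lambda>x. p x + q x) \<in> polys k"
proof -
  assume "p \<in> polys k" "q \<in> polys k"
  then obtain a b where "p = (\<lambda>x. \<Sum>\<alpha> | (\<Sum>i\<in>UNIV. \<alpha> i) \<le> k. a \<alpha> * monomial \<alpha> x)"
    "q = (\<lambda>x. \<Sum>\<alpha> | (\<Sum>i\<in>UNIV. \<alpha> i) \<le> k. b \<alpha> * monomial \<alpha> x)"
    unfolding polys_iff by blast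
  then have "(\<lambda>x. p x + q x) = (\<lambda>x. \<Sum>\<alpha> | (\<Sum>i\<in>UNIV. \<alpha> i) \<le> k. (a \<alpha> + b \<alpha>) * monomial \<alpha> x)"
    by (simp add: sum.distrib algebra_simps)
  then show ?thesis unfolding polys_iff by (intro exI[of _ "\<lambda>\<alpha>. a \<alpha> + b \<alpha>"]) simp
qed

lemma polys_scale: "p \<in> polys k \<Longrightarrow> (\<lambda>x. c * p x) \<in> polys k"
proof -
  assume "p \<in> polys k"
  then obtain a where "p = (\<lambda>x. \<Sum>\<alpha> | (\<Sum>i\<in>UNIV. \<alpha> i) \<le> k. a \<alpha> * monomial \<alpha> x)"
    unfolding polys_iff by blast
  then have "(\<lambda>x. c * p x) = (\<lambda>x. \<Sum>\<alpha> | (\<Sum>i\<in>UNIV. \<alpha> i) \<le> k. (c * a \<alpha>) * monomial \<alpha> x)"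
    by (simp add: sum_distrib_left algebra_simps)
  then show ?thesis unfolding polys_iff by (intro exI[of _ "\<lambda>\<alpha>. c * a \<alpha>"]) simp
qed

lemma polys_monomial: "(\<Sum>i\<in>UNIV. \<alpha> i) \<le> k \<Longrightarrow> monomial \<alpha> \<in> polys k"
proof -
  assume \<alpha>: "(\<Sum>i\<in>UNIV. \<alpha> i) \<le> k"
  have eq: "monomial \<alpha> x = (\<Sum>\<beta> | (\<Sum>i\<in>UNIV. \<beta> i) \<le> k. (if \<beta> = \<alpha> then 1 else 0) * monomial \<beta> x)" for x
  proof -
    have "(\<Sum>\<beta> | (\<Sum>i\<in>UNIV. \<beta> i) \<le> k. (if \<beta> = \<alpha> then 1 else 0) * monomial \<beta> x)
        = (\<Sum>\<beta> | (\<Sum>i\<in>UNIV. \<beta> i) \<le> k. if \<beta> = \<alpha> then monomial \<beta> x else 0)"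
      by (rule sum.cong) auto
    then show ?thesis using \<alpha> finite_multi_indices[of k] by simp
  qed
  show ?thesis unfolding polys_iff
    by (intro exI[of _ "\<lambda>\<beta>. if \<beta> = \<alpha> then 1 else 0"] ext) (rule eq)
qed

lemma polys_zero: "(\<lambda>x. 0) \<in> polys k"
  using polys_scale[OF polys_monomial[of "\<lambda>_. 0" k], of 0] by simp

lemma polys_const: "(\<lambda>x. c) \<in> polys k"
  using polys_scale[OF polys_monomial[of "\<lambda>_. 0" k], of c] by (simp add: monomial_def)

lemma polys_sum: "(\<And>i. i \<in> I \<Longrightarrow> p i \<in> polys k) \<Longrightarrow> (\<lambda>x. \<Sum>i\<in>I. p i x) \<in> polys k"
  by (induction I rule: infinite_finite_induct) (auto intro: polys_zero polys_add)

text \<open>A linear operator on polynomials is controlled by what it does to monomials.\<close>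

lemma polys_linear_image:
  assumes "p \<in> polys k"
    and T: "\<And>a. T (\<lambda>x. \<Sum>\<alpha> | (\<Sum>i\<in>UNIV. \<alpha> i) \<le> k. a \<alpha> * monomial \<alpha> x)
              = (\<lambda>x. \<Sum>\<alpha> | (\<Sum>i\<in>UNIV. \<alpha> i) \<le> k. a \<alpha> * T (monomial \<alpha>) x)"
    and "\<And>\<alpha>. (\<Sum>i\<in>UNIV. \<alpha> i) \<le> k \<Longrightarrow> T (monomial \<alpha>) \<in> polys l"
  shows "T p \<in> polys l"
proof -
  obtain a where "p = (\<lambda>x. \<Sum>\<alpha> | (\<Sum>i\<in>UNIV. \<alpha> i) \<le> k. a \<alpha> * monomial \<alpha> x)"
    using assms(1) unfolding polys_iff by blast
  then have "T p = (\<lambda>x. \<Sum>\<alpha> | (\<Sum>i\<in>UNIV. \<alpha> i) \<le> k. a \<alpha> * T (monomial \<alpha>) x)" by (simp only: T)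
  then show ?thesis using assms(3) by (simp only:) (intro polys_sum polys_scale, blast)
qed

lemma polys_mono: "k \<le> l \<Longrightarrow> p \<in> polys k \<Longrightarrow> p \<in> polys l"
  by (rule polys_linear_image[where T = "\<lambda>p. p"]) (auto intro: polys_monomial)

lemma sum_fun_upd3:
  fixes \<alpha> :: "3 \<Rightarrow> nat"
  shows "(\<Sum>i\<in>UNIV. (\<alpha>(j := m)) i) + \<alpha> j = (\<Sum>i\<in>UNIV. \<alpha> i) + m"
  by (simp add: sum.remove[of UNIV j])

lemma monomial_fun_upd: "monomial (\<alpha>(j := m)) x = (x $ j) ^ m * (\<Prod>i\<in>UNIV-{j}. (x $ i) ^ \<alpha> i)"
proof -
  have "monomial (\<alpha>(j := m)) x = (x $ j) ^ m * (\<Prod>i\<in>UNIV-{j}. (x $ i) ^ (\<alpha>(j := m)) i)"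
    unfolding monomial_def by (subst prod.remove[of UNIV j]) auto
  also have "(\<Prod>i\<in>UNIV-{j}. (x $ i) ^ (\<alpha>(j := m)) i) = (\<Prod>i\<in>UNIV-{j}. (x $ i) ^ \<alpha> i)"
    by (rule prod.cong) auto
  finally show ?thesis .
qed

lemma polys_times_coordinate:
  assumes "p \<in> polys k" shows "(\<lambda>x. x $ j * p x) \<in> polys (Suc k)"
proof (rule polys_linear_image[OF assms, where T = "\<lambda>p x. x $ j * p x"])
  fix \<alpha> :: "3 \<Rightarrow> nat" assume \<alpha>: "(\<Sum>i\<in>UNIV. \<alpha> i) \<le> k"
  have "(\<lambda>x. x $ j * monomial \<alpha> x) = monomial (\<alpha>(j := Suc (\<alpha> j)))"
    using monomial_fun_upd[of \<alpha> j "Suc (\<alpha> j)"] monomial_fun_upd[of \<alpha> j "\<alpha> j"] by (simp add: fun_eq_iff)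
  moreover have "(\<Sum>i\<in>UNIV. (\<alpha>(j := Suc (\<alpha> j))) i) \<le> Suc k"
    using sum_fun_upd3[of \<alpha> j "Suc (\<alpha> j)"] \<alpha> by linarith
  ultimately show "(\<lambda>x. x $ j * monomial \<alpha> x) \<in> polys (Suc k)" using polys_monomial by simp
qed (simp add: sum_distrib_left algebra_simps)

lemma monomial_has_derivative:
  "(monomial \<alpha> has_derivative
     (\<lambda>v. \<Sum>i\<in>UNIV. v $ i * (\<alpha> i * monomial (\<alpha>(i := \<alpha> i - 1)) x))) (at x)"
proof -
  have "((\<lambda>x. \<Prod>i\<in>UNIV. (x $ i) ^ \<alpha> i) has_derivative
     (\<lambda>v. \<Sum>i\<in>UNIV. (of_nat (\<alpha> i) * v $ i * (x $ i) ^ (\<alpha> i - 1)) * (\<Prod>j\<in>UNIV-{i}. (x $ j) ^ \<alpha> j))) (at x)"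
    by (rule has_derivative_prod, rule has_derivative_power, rule bounded_linear_imp_has_derivative,
        rule bounded_linear_vec_nth)
  moreover have "(\<lambda>x. \<Prod>i\<in>UNIV. (x $ i) ^ \<alpha> i) = monomial \<alpha>" by (simp add: monomial_def fun_eq_iff)
  ultimately show ?thesis by (simp add: monomial_fun_upd algebra_simps)
qed

lemma poly_has_derivative:
  "((\<lambda>x. \<Sum>\<alpha> | (\<Sum>i\<in>UNIV. \<alpha> i) \<le> k. a \<alpha> * monomial \<alpha> x) has_derivative
    (\<lambda>v. \<Sum>\<alpha> | (\<Sum>i\<in>UNIV. \<alpha> i) \<le> k. a \<alpha> * frechet_derivative (monomial \<alpha>) (at x) v)) (at x)"
proof (intro has_derivative_sum has_derivative_mult_right)
  fix \<alpha> show "(monomial \<alpha> has_derivative frechet_derivative (monomial \<alpha>) (at x)) (at x)"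
    by (rule has_frechet_derivative[OF monomial_has_derivative])
qed

lemma polys_frechet_derivative:
  assumes "p \<in> polys (Suc k)" shows "(\<lambda>x. frechet_derivative p (at x) v) \<in> polys k"
proof (rule polys_linear_image[OF assms, where T = "\<lambda>p x. frechet_derivative p (at x) v"])
  fix \<alpha> :: "3 \<Rightarrow> nat" assume \<alpha>: "(\<Sum>i\<in>UNIV. \<alpha> i) \<le> Suc k"
  have "(\<lambda>x. frechet_derivative (monomial \<alpha>) (at x) v)
     = (\<lambda>x. \<Sum>i\<in>UNIV. (v $ i * \<alpha> i) * monomial (\<alpha>(i := \<alpha> i - 1)) x)"
    by (simp add: frechet_derivative_eqI[OF monomial_has_derivative] mult.assoc)
  moreover have "(\<lambda>x. (v $ i * \<alpha> i) * monomial (\<alpha>(i := \<alpha> i - 1)) x) \<in> polys k" for i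
  proof (cases "\<alpha> i = 0")
    case True then show ?thesis using polys_zero by simp
  next
    case False
    then have "(\<Sum>j\<in>UNIV. (\<alpha>(i := \<alpha> i - 1)) j) \<le> k"
      using sum_fun_upd3[of \<alpha> i "\<alpha> i - 1"] \<alpha> by linarith
    then show ?thesis by (intro polys_scale polys_monomial)
  qed
  ultimately show "(\<lambda>x. frechet_derivative (monomial \<alpha>) (at x) v) \<in> polys k"
    by (simp only:) (intro polys_sum)
next
  fix a :: "(3 \<Rightarrow> nat) \<Rightarrow> real"
  show "(\<lambda>x. frechet_derivative (\<lambda>x. \<Sum>\<alpha> | (\<Sum>i\<in>UNIV. \<alpha> i) \<le> Suc k. a \<alpha> * monomial \<alpha> x) (at x) v)
     = (\<lambda>x. \<Sum>\<alpha> | (\<Sum>i\<in>UNIV. \<alpha> i) \<le> Suc k. a \<alpha> * frechet_derivative (monomial \<alpha>) (at x) v)"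
    by (rule ext) (rule frechet_derivative_eqI[OF poly_has_derivative])
qed

lemma C_diff_polys: "p \<in> polys k \<Longrightarrow> C_diff r p"
proof (induction r arbitrary: p k)
  case (0 p k)
  then obtain a where p: "p = (\<lambda>x. \<Sum>\<alpha> | (\<Sum>i\<in>UNIV. \<alpha> i) \<le> k. a \<alpha> * monomial \<alpha> x)"
    unfolding polys_iff by blast
  show ?case using has_derivative_continuous[OF poly_has_derivative]
    by (simp add: p continuous_on_eq_continuous_at)
next
  case (Suc r p k)
  then obtain a where p: "p = (\<lambda>x. \<Sum>\<alpha> | (\<Sum>i\<in>UNIV. \<alpha> i) \<le> k. a \<alpha> * monomial \<alpha> x)"
    unfolding polys_iff by blast
  have d: "(p has_derivative frechet_derivative p (at x)) (at x)" for x
    unfolding p by (rule has_frechet_derivative[OF poly_has_derivative])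
  have "p \<in> polys (Suc k)" using Suc.prems polys_mono[of k "Suc k"] by simp
  from Suc.IH[OF polys_frechet_derivative[OF this]] show ?case
    by (rule C_diff_SucI[OF d])
qed

lemma vpolys_mono: "k \<le> l \<Longrightarrow> p \<in> vpolys k \<Longrightarrow> p \<in> vpolys l"
  unfolding vpolys_def using polys_mono by blast

lemma vpolys_add: "p \<in> vpolys k \<Longrightarrow> q \<in> vpolys k \<Longrightarrow> (\<lambda>x. p x + q x) \<in> vpolys k"
  by (simp add: vpolys_def polys_add)

lemma vpolys_scale: "p \<in> vpolys k \<Longrightarrow> (\<lambda>x. c *\<^sub>R p x) \<in> vpolys k"
  by (simp add: vpolys_def polys_scale)

lemma C_diff_vpolys: "p \<in> vpolys k \<Longrightarrow> C_diff r p"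
  unfolding vpolys_def by (intro C_diff_vec) (auto intro: C_diff_polys)

text \<open>The enrichment of the edge elements raises the degree by one, so that their curls have the
  components of degree at most \<open>k\<close> that the face elements allow.\<close>

lemma N_local_vpolys: "f \<in> N_local k \<Longrightarrow> f \<in> vpolys (Suc k)"
proof -
  assume "f \<in> N_local k"
  then obtain p q where f: "f = (\<lambda>x. p x + cross3 x (q x))" and p: "p \<in> vpolys k" and q: "q \<in> vpolys k"
    unfolding N_local_def by blast
  have xq: "(\<lambda>x. x $ i * q x $ j) \<in> polys (Suc k)" for i j
    using q polys_times_coordinate unfolding vpolys_def by simp
  then have xq': "(\<lambda>x. x $ i * q x $ j - x $ j * q x $ i) \<in> polys (Suc k)" for i j
    using polys_add[OF xq polys_scale[OF xq, of "-1"]] by simp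
  have "(\<lambda>x. cross3 x (q x)) \<in> vpolys (Suc k)"
    unfolding vpolys_def using xq' by (simp add: forall_3 cross3_def)
  then show ?thesis unfolding f using p vpolys_mono[of k "Suc k"] by (intro vpolys_add) auto
qed

lemma RT_local_vpolys: "f \<in> RT_local k \<Longrightarrow> f \<in> vpolys (Suc k)"
proof -
  assume "f \<in> RT_local k"
  then obtain p q where f: "f = (\<lambda>x. p x + q x *\<^sub>R x)" and p: "p \<in> vpolys k" and q: "q \<in> polys k"
    unfolding RT_local_def by blast
  have "(\<lambda>x. q x *\<^sub>R x) \<in> vpolys (Suc k)"
    unfolding vpolys_def using polys_times_coordinate[OF q] by (simp add: mult.commute)
  then show ?thesis unfolding f using p vpolys_mono[of k "Suc k"] by (intro vpolys_add) auto
qed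

lemma vpolys_N_local: "p \<in> vpolys k \<Longrightarrow> p \<in> N_local k"
  unfolding N_local_def by (intro CollectI exI[of _ p] exI[of _ "\<lambda>x. 0"]) (auto simp: vpolys_def polys_zero)

lemma vpolys_RT_local: "p \<in> vpolys k \<Longrightarrow> p \<in> RT_local k"
  unfolding RT_local_def by (intro CollectI exI[of _ p] exI[of _ "\<lambda>x. 0"]) (auto simp: polys_zero)

lemma N_local_add: "f \<in> N_local k \<Longrightarrow> g \<in> N_local k \<Longrightarrow> (\<lambda>x. f x + g x) \<in> N_local k"
proof -
  assume "f \<in> N_local k" "g \<in> N_local k"
  then obtain p q p' q' where "f = (\<lambda>x. p x + cross3 x (q x))" "p \<in> vpolys k" "q \<in> vpolys k"
     "g = (\<lambda>x. p' x + cross3 x (q' x))" "p' \<in> vpolys k" "q' \<in> vpolys k"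
    unfolding N_local_def by blast
  then show ?thesis unfolding N_local_def
    by (intro CollectI exI[of _ "\<lambda>x. p x + p' x"] exI[of _ "\<lambda>x. q x + q' x"])
       (auto simp: vpolys_add cross_add_right)
qed

lemma N_local_scale: "f \<in> N_local k \<Longrightarrow> (\<lambda>x. c *\<^sub>R f x) \<in> N_local k"
proof -
  assume "f \<in> N_local k"
  then obtain p q where "f = (\<lambda>x. p x + cross3 x (q x))" "p \<in> vpolys k" "q \<in> vpolys k"
    unfolding N_local_def by blast
  then show ?thesis unfolding N_local_def
    by (intro CollectI exI[of _ "\<lambda>x. c *\<^sub>R p x"] exI[of _ "\<lambda>x. c *\<^sub>R q x"])
       (auto simp: vpolys_scale cross_mult_right scaleR_add_right)
qed

lemma RT_local_add: "f \<in> RT_local k \<Longrightarrow> g \<in> RT_local k \<Longrightarrow> (\<lambda>x. f x + g x) \<in> RT_local k"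
proof -
  assume "f \<in> RT_local k" "g \<in> RT_local k"
  then obtain p q p' q' where "f = (\<lambda>x. p x + q x *\<^sub>R x)" "p \<in> vpolys k" "q \<in> polys k"
     "g = (\<lambda>x. p' x + q' x *\<^sub>R x)" "p' \<in> vpolys k" "q' \<in> polys k"
    unfolding RT_local_def by blast
  then show ?thesis unfolding RT_local_def
    by (intro CollectI exI[of _ "\<lambda>x. p x + p' x"] exI[of _ "\<lambda>x. q x + q' x"])
       (auto simp: vpolys_add polys_add scaleR_add_left)
qed

lemma RT_local_scale: "f \<in> RT_local k \<Longrightarrow> (\<lambda>x. c *\<^sub>R f x) \<in> RT_local k"
proof -
  assume "f \<in> RT_local k"
  then obtain p q where "f = (\<lambda>x. p x + q x *\<^sub>R x)" "p \<in> vpolys k" "q \<in> polys k"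
    unfolding RT_local_def by blast
  then show ?thesis unfolding RT_local_def
    by (intro CollectI exI[of _ "\<lambda>x. c *\<^sub>R p x"] exI[of _ "\<lambda>x. c * q x"])
       (auto simp: vpolys_scale polys_scale scaleR_add_right)
qed

section \<open>Vector calculus\<close>

lemma frechet_derivative_component:
  fixes f :: "real^3 \<Rightarrow> real^3"
  assumes "f differentiable (at x)"
  shows "frechet_derivative (\<lambda>y. f y $ i) (at x) v = frechet_derivative f (at x) v $ i"
proof -
  have "(f has_derivative frechet_derivative f (at x)) (at x)"
    using assms by (simp add: frechet_derivative_works)
  from bounded_linear.has_derivative[OF bounded_linear_vec_nth this]
  have "((\<lambda>y. f y $ i) has_derivative (\<lambda>v. frechet_derivative f (at x) v $ i)) (at x)" .
  then show ?thesis by (rule frechet_derivative_eqI)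
qed

lemma C_diff_differentiable: "C_diff (Suc r) f \<Longrightarrow> f differentiable (at x)"
  by (rule differentiableI[OF C_diff_has_derivative])

lemma C_diff_grad: "C_diff (Suc r) f \<Longrightarrow> C_diff r (grad f)"
  by (intro C_diff_vec) (simp add: grad_def)

lemma curl_eq_components:
  "curl f x $ 1 = pderiv_at 2 f x $ 3 - pderiv_at 3 f x $ 2"
  "curl f x $ 2 = pderiv_at 3 f x $ 1 - pderiv_at 1 f x $ 3"
  "curl f x $ 3 = pderiv_at 1 f x $ 2 - pderiv_at 2 f x $ 1"
  by (simp_all add: curl_def vector_3)

lemma C_diff_curl: "C_diff (Suc r) f \<Longrightarrow> C_diff r (curl f)"
proof (rule C_diff_vec)
  assume "C_diff (Suc r) f"
  then have c: "C_diff r (\<lambda>x. pderiv_at i f x $ j)" for i j by (simp add: C_diff_component)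
  have "\<forall>i. C_diff r (\<lambda>x. curl f x $ i)"
    unfolding forall_3 curl_eq_components by (intro conjI C_diff_diff c)
  then show "C_diff r (\<lambda>x. curl f x $ i)" for i by simp
qed

lemma curl_grad_eq_0: "C_diff 2 f \<Longrightarrow> curl (grad f) x = 0"
proof -
  assume f: "C_diff 2 f"
  then have "C_diff (Suc 0) (grad f)" by (intro C_diff_grad) (simp add: numeral_2_eq_2)
  note g = C_diff_differentiable[OF this]
  have "pderiv_at i (grad f) x $ j = pderiv_at i (\<lambda>y. pderiv_at j f y) x" for i j
    using frechet_derivative_component[OF g, of j x "axis i 1"] by (simp add: grad_def)
  then have "pderiv_at i (grad f) x $ j = pderiv_at j (grad f) x $ i" for i j
    using symmetric_second_derivatives[OF f] by metis
  then show ?thesis by (simp add: vec_eq_iff forall_3 curl_eq_components)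
qed

lemma frechet_derivative_diff:
  fixes f g :: "real^3 \<Rightarrow> real"
  assumes "f differentiable (at x)" "g differentiable (at x)"
  shows "frechet_derivative (\<lambda>y. f y - g y) (at x) v
     = frechet_derivative f (at x) v - frechet_derivative g (at x) v"
  by (rule frechet_derivative_eqI, rule has_derivative_diff)
     (use assms in \<open>simp_all add: frechet_derivative_works\<close>)

lemma div_curl_eq_0:
  assumes f: "C_diff 2 f"
  shows "(\<Sum>i\<in>UNIV. pderiv_at i (\<lambda>y. curl f y $ i) x) = 0"
proof -
  have f1: "C_diff (Suc (Suc 0)) f" using f by (simp add: numeral_2_eq_2)
  have comp: "pderiv_at i f y $ j = pderiv_at i (\<lambda>z. f z $ j) y" for i j y
    using frechet_derivative_component[OF C_diff_differentiable[OF f1]] by simp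
  have d: "(\<lambda>y. pderiv_at i (\<lambda>z. f z $ j) y) differentiable (at x)" for i j
    by (rule C_diff_differentiable[of 0]) (use C_diff_component[OF f1, of j] in simp)
  have s: "pderiv_at l (\<lambda>y. pderiv_at i (\<lambda>z. f z $ j) y) x = pderiv_at i (\<lambda>y. pderiv_at l (\<lambda>z. f z $ j) y) x" for i j l
    by (rule symmetric_second_derivatives) (rule C_diff_component[OF f])
  show ?thesis
    unfolding sum_3 curl_eq_components comp frechet_derivative_diff[OF d d]
    using s[of 3 2 1] s[of 2 3 1] s[of 1 2 3] by linarith
qed

lemma grad_mult:
  assumes "f differentiable (at x)" "g differentiable (at x)"
  shows "grad (\<lambda>y. f y * g y) x = f x *\<^sub>R grad g x + g x *\<^sub>R grad f x"
proof -
  have "((\<lambda>y. f y * g y) has_derivative (\<lambda>v. f x * frechet_derivative g (at x) v + frechet_derivative f (at x) v * g x)) (at x)"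
    using assms by (intro has_derivative_mult) (auto simp: frechet_derivative_works)
  then show ?thesis by (simp add: vec_eq_iff grad_def frechet_derivative_eqI)
qed

lemma div_cross_eq:
  assumes a: "a differentiable (at x)" and b: "b differentiable (at x)"
  shows "(\<Sum>i\<in>UNIV. pderiv_at i (\<lambda>y. cross3 (a y) (b y) $ i) x) = b x \<bullet> curl a x - a x \<bullet> curl b x"
proof -
  have d: "((\<lambda>y. cross3 (a y) (b y)) has_derivative
     (\<lambda>v. cross3 (a x) (frechet_derivative b (at x) v) + cross3 (frechet_derivative a (at x) v) (b x))) (at x)"
    using bounded_bilinear.FDERIV[OF bounded_bilinear_cross3] a b by (simp add: frechet_derivative_works)
  have "pderiv_at i (\<lambda>y. cross3 (a y) (b y) $ i) x
     = (cross3 (a x) (pderiv_at i b x) + cross3 (pderiv_at i a x) (b x)) $ i" for i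
    by (simp only: frechet_derivative_component[OF differentiableI[OF d]] frechet_derivative_eqI[OF d])
  then show ?thesis
    by (simp add: sum_3 curl_eq_components inner_vec_def cross3_def algebra_simps)
qed


section \<open>Weak derivatives of cellwise smooth fields\<close>

lemma test_functions_smooth: "\<psi> \<in> test_functions \<Omega> \<Longrightarrow> C_diff r \<psi>"
  by (simp add: test_functions_def)

lemma test_functions_dom: "\<psi> \<in> test_functions U \<Longrightarrow> U \<subseteq> \<Omega> \<Longrightarrow> \<psi> \<in> test_functions \<Omega>"
  unfolding test_functions_def by auto

lemma test_functions_support:
  assumes \<psi>: "\<psi> \<in> test_functions U" and g: "\<And>r. C_diff r g"
    and supp: "\<And>x. x \<notin> closure {x. \<psi> x \<noteq> 0} \<Longrightarrow> g x = 0"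
  shows "g \<in> test_functions U"
proof -
  have "{x. g x \<noteq> 0} \<subseteq> closure {x. \<psi> x \<noteq> 0}" using supp by blast
  then have s: "closure {x. g x \<noteq> 0} \<subseteq> closure {x. \<psi> x \<noteq> 0}" by (simp add: closure_minimal)
  have c: "compact (closure {x. \<psi> x \<noteq> 0})" and u: "closure {x. \<psi> x \<noteq> 0} \<subseteq> U"
    using \<psi> by (simp_all add: test_functions_def)
  have "compact (closure {x. g x \<noteq> 0})"
    using c s by (meson closed_closure compact_eq_bounded_closed bounded_subset)
  then show ?thesis using g s u by (simp add: test_functions_def)
qed

lemma test_functions_zero: "\<psi> \<in> test_functions U \<Longrightarrow> x \<notin> U \<Longrightarrow> \<psi> x = 0"
proof (rule ccontr)
  assume "\<psi> \<in> test_functions U" "x \<notin> U" "\<psi> x \<noteq> 0"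
  then show False using closure_subset[of "{x. \<psi> x \<noteq> 0}"] by (auto simp: test_functions_def)
qed

lemma test_functions_bounded_support: "\<psi> \<in> test_functions U \<Longrightarrow> bounded {x. \<psi> x \<noteq> 0}"
  by (rule bounded_subset[OF compact_imp_bounded closure_subset]) (simp add: test_functions_def)

lemma test_functions_bounded:
  assumes "\<psi> \<in> test_functions U" obtains C where "\<And>x. norm (\<psi> x) \<le> C"
proof -
  let ?S = "closure {x. \<psi> x \<noteq> 0}"
  have "compact (\<psi> ` ?S)"
    using assms C_diff_continuous[OF test_functions_smooth[OF assms, of 0]]
    by (intro compact_continuous_image) (auto simp: test_functions_def intro: continuous_on_subset)
  then have "bounded (\<psi> ` ?S)" by (rule compact_imp_bounded)
  then obtain C where C: "C > 0" "\<forall>y\<in>\<psi> ` ?S. norm y \<le> C" unfolding bounded_pos by blast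
  have "norm (\<psi> x) \<le> C" for x
  proof (cases "\<psi> x = 0")
    case False
    then have "x \<in> ?S" using closure_subset[of "{x. \<psi> x \<noteq> 0}"] by auto
    then show ?thesis using C by auto
  qed (use C in simp)
  then show ?thesis by (rule that)
qed

lemma zero_outside_support: "x \<notin> closure {x. f x \<noteq> 0} \<Longrightarrow> f x = 0"
  using closure_subset[of "{x. f x \<noteq> 0}"] by blast

lemma test_functions_scaleR:
  assumes "\<kappa> \<in> test_functions U" "\<psi> \<in> test_functions V"
  shows "(\<lambda>x. \<kappa> x *\<^sub>R \<psi> x) \<in> test_functions U"
proof (rule test_functions_support[OF assms(1)])
  show "C_diff r (\<lambda>x. \<kappa> x *\<^sub>R \<psi> x)" for r
    by (rule C_diff_scaleR[OF test_functions_smooth[OF assms(1)] test_functions_smooth[OF assms(2)]])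
  fix x assume "x \<notin> closure {x. \<kappa> x \<noteq> 0}"
  then have "\<kappa> x = 0" by (rule zero_outside_support)
  then show "\<kappa> x *\<^sub>R \<psi> x = 0" by simp
qed

lemma test_functions_grad: "\<psi> \<in> test_functions U \<Longrightarrow> grad \<psi> \<in> test_functions U"
  by (rule test_functions_support)
     (auto intro: C_diff_grad test_functions_smooth simp: grad_def vec_eq_iff frechet_derivative_zero_outside)

lemma test_functions_curl: "\<psi> \<in> test_functions U \<Longrightarrow> curl \<psi> \<in> test_functions U"
  by (rule test_functions_support)
     (auto intro: C_diff_curl test_functions_smooth
       simp: vec_eq_iff forall_3 curl_eq_components frechet_derivative_zero_outside)

lemma test_functions_component:
  fixes \<psi> :: "real^3 \<Rightarrow> real^3"
  assumes "\<psi> \<in> test_functions U" shows "(\<lambda>x. \<psi> x $ i) \<in> test_functions U"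
proof (rule test_functions_support[OF assms])
  show "C_diff r (\<lambda>x. \<psi> x $ i)" for r
    by (rule C_diff_component[OF test_functions_smooth[OF assms]])
  fix x assume "x \<notin> closure {x. \<psi> x \<noteq> 0}"
  then have "\<psi> x = 0" by (rule zero_outside_support)
  then show "\<psi> x $ i = 0" by simp
qed

lemma LINT_component:
  fixes f :: "'a \<Rightarrow> real^3"
  assumes "integrable M f" shows "(LINT x|M. f x $ i) = (LINT x|M. f x) $ i"
  using integral_inner_left[of "axis i 1" M f] assms by (simp add: cart_eq_inner_axis)

lemma integral_grad_eq_0:
  assumes "C_diff 1 f" "bounded {x. f x \<noteq> 0}"
  shows "(LINT x|lborel. grad f x) = 0"
proof -
  have c: "continuous_on UNIV (grad f)"
    using C_diff_grad[of 0 f] assms(1) by simp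
  have "integrable lborel (grad f)"
  proof (rule C_diff_0_vanishing_integrable[OF c])
    show "bounded (closure {x. f x \<noteq> 0})" using assms(2) by (rule bounded_closure)
    show "grad f x = 0" if "x \<notin> closure {x. f x \<noteq> 0}" for x
      using frechet_derivative_zero_outside[OF that] by (simp add: grad_def vec_eq_iff)
  qed
  then have "(LINT x|lborel. grad f x) $ i = (LINT x|lborel. grad f x $ i)" for i
    by (simp add: LINT_component)
  then show ?thesis using integral_derivative_eq_0[OF assms] by (simp add: grad_def vec_eq_iff)
qed

definition cellwise_smooth :: "(real^3) set set \<Rightarrow> (real^3 \<Rightarrow> 'b::real_normed_vector) \<Rightarrow> bool" where
  "cellwise_smooth \<T> f \<longleftrightarrow> cellwise \<T> {p. \<forall>r. C_diff r p} f"

lemma cellwise_smoothE: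
  assumes "cellwise_smooth \<T> f" "K \<in> \<T>"
  obtains p where "\<And>r. C_diff r p" "\<And>x. x \<in> interior K \<Longrightarrow> f x = p x"
proof -
  from assms obtain p where "\<forall>r. C_diff r p" "\<forall>x\<in>interior K. f x = p x"
    unfolding cellwise_smooth_def cellwise_def by blast
  then show thesis by (intro that[of p]) auto
qed

lemma cellwise_mono: "cellwise \<T> P f \<Longrightarrow> P \<subseteq> P' \<Longrightarrow> cellwise \<T> P' f"
  unfolding cellwise_def by blast

lemma cellwise_smooth_continuous: "cellwise_smooth \<T> f \<Longrightarrow> cellwise_continuous \<T> f"
  unfolding cellwise_continuous_def
proof
  fix K assume f: "cellwise_smooth \<T> f" and K: "K \<in> \<T>"
  obtain p where p: "\<And>r. C_diff r p" "\<And>x. x \<in> interior K \<Longrightarrow> f x = p x"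
    using cellwise_smoothE[OF f K] by metis
  then show "\<exists>p. continuous_on K p \<and> (\<forall>x\<in>interior K. f x = p x)"
    using C_diff_continuous[OF p(1)[of 0]] continuous_on_subset by blast
qed

lemma frechet_derivative_cell:
  assumes "\<And>x. x \<in> interior K \<Longrightarrow> f x = p x" "x \<in> interior K" "p differentiable (at x)"
  shows "frechet_derivative f (at x) = frechet_derivative p (at x)"
proof -
  have "(p has_derivative frechet_derivative p (at x)) (at x)"
    using assms(3) by (simp add: frechet_derivative_works)
  then have "(f has_derivative frechet_derivative p (at x)) (at x)"
    by (rule has_derivative_transform_within_open[of _ _ _ _ "interior K"]) (use assms in auto)
  then show ?thesis by (simp add: frechet_derivative_eqI fun_eq_iff)
qed

lemma grad_cell:
  assumes "\<And>x. x \<in> interior K \<Longrightarrow> f x = p x" "x \<in> interior K" "p differentiable (at x)"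
  shows "grad f x = grad p x"
  using frechet_derivative_cell[OF assms] by (simp add: grad_def)

lemma curl_cell:
  assumes "\<And>x. x \<in> interior K \<Longrightarrow> f x = p x" "x \<in> interior K" "p differentiable (at x)"
  shows "curl f x = curl p x"
  using frechet_derivative_cell[OF assms] by (simp add: curl_def)

lemma cellwise_smooth_grad: "cellwise_smooth \<T> f \<Longrightarrow> cellwise_smooth \<T> (grad f)"
  unfolding cellwise_smooth_def[of _ "grad f"] cellwise_def
proof
  fix K assume f: "cellwise_smooth \<T> f" and K: "K \<in> \<T>"
  obtain p where p: "\<And>r. C_diff r p" "\<And>x. x \<in> interior K \<Longrightarrow> f x = p x"
    using cellwise_smoothE[OF f K] by metis
  have "grad f x = grad p x" if "x \<in> interior K" for x
    using grad_cell[OF p(2) that C_diff_differentiable[OF p(1)[of 1, simplified One_nat_def]]] .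
  moreover have "\<forall>r. C_diff r (grad p)" using C_diff_grad[OF p(1)] by blast
  ultimately show "\<exists>p\<in>{p. \<forall>r. C_diff r p}. \<forall>x\<in>interior K. grad f x = p x" by blast
qed

lemma cellwise_smooth_curl: "cellwise_smooth \<T> f \<Longrightarrow> cellwise_smooth \<T> (curl f)"
  unfolding cellwise_smooth_def[of _ "curl f"] cellwise_def
proof
  fix K assume f: "cellwise_smooth \<T> f" and K: "K \<in> \<T>"
  obtain p where p: "\<And>r. C_diff r p" "\<And>x. x \<in> interior K \<Longrightarrow> f x = p x"
    using cellwise_smoothE[OF f K] by metis
  have "curl f x = curl p x" if "x \<in> interior K" for x
    using curl_cell[OF p(2) that C_diff_differentiable[OF p(1)[of 1, simplified One_nat_def]]] .
  moreover have "\<forall>r. C_diff r (curl p)" using C_diff_curl[OF p(1)] by blast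
  ultimately show "\<exists>p\<in>{p. \<forall>r. C_diff r p}. \<forall>x\<in>interior K. curl f x = p x" by blast
qed

context fe_mesh
begin

lemma LINT_vanishing_outside:
  fixes g :: "real^3 \<Rightarrow> 'b::euclidean_space"
  assumes "continuous_on UNIV g" "\<And>x. x \<notin> \<Omega> \<Longrightarrow> g x = 0"
  shows "(LINT x|lebesgue_on \<Omega>. g x) = (LINT x|lborel. g x)"
proof -
  have "(LINT x|lebesgue_on \<Omega>. g x) = (LINT x|lebesgue. indicator \<Omega> x *\<^sub>R g x)"
    by (simp add: integral_restrict_space)
  also have "(\<lambda>x. indicator \<Omega> x *\<^sub>R g x) = g" using assms(2) by (fastforce simp: indicator_def)
  also have "(LINT x|lebesgue. g x) = (LINT x|lborel. g x)"
    using assms(1) by (intro integral_completion) (simp add: borel_measurable_continuous_onI)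
  finally show ?thesis .
qed

lemma test_functions_cellwise: "\<psi> \<in> test_functions U \<Longrightarrow> cellwise_smooth \<T> \<psi>"
  unfolding cellwise_smooth_def cellwise_def using test_functions_smooth by blast

lemma test_functions_cellwise_continuous: "\<psi> \<in> test_functions U \<Longrightarrow> cellwise_continuous \<T> \<psi>"
  by (rule cellwise_smooth_continuous[OF test_functions_cellwise])

lemma L2_integrable:
  fixes g :: "real^3 \<Rightarrow> 'b::euclidean_space"
  assumes "g \<in> L2 \<Omega>" shows "integrable (lebesgue_on \<Omega>) g"
proof -
  interpret finite_measure "lebesgue_on \<Omega>"
    using finite_measure_lebesgue_on[OF dom_lmeasurable] .
  have "integrable (lebesgue_on \<Omega>) (\<lambda>x. 1 + (norm (g x))\<^sup>2)" using assms by (simp add: L2_def)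
  then show ?thesis
  proof (rule Bochner_Integration.integrable_bound)
    show "g \<in> borel_measurable (lebesgue_on \<Omega>)" using assms by (simp add: L2_def)
    have "y \<le> 1 + y\<^sup>2" for y :: real
    proof -
      have "0 \<le> (y - 1/2)\<^sup>2" by simp
      then show ?thesis by (simp add: power2_eq_square algebra_simps)
    qed
    then show "AE x in lebesgue_on \<Omega>. norm (g x) \<le> norm (1 + (norm (g x))\<^sup>2)"
      by (intro AE_I2) auto
  qed
qed

lemma integrable_bilinear_bounded:
  fixes b :: "'b::euclidean_space \<Rightarrow> 'c::euclidean_space \<Rightarrow> 'd::euclidean_space"
  assumes b: "bounded_bilinear b" and g: "integrable (lebesgue_on \<Omega>) g"
    and \<psi>: "cellwise_continuous \<T> \<psi>" and C: "\<And>x. norm (\<psi> x) \<le> C"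
  shows "integrable (lebesgue_on \<Omega>) (\<lambda>x. b (g x) (\<psi> x))"
proof -
  obtain L where L: "L > 0" "\<And>u v. norm (b u v) \<le> norm u * norm v * L"
    using bounded_bilinear.pos_bounded[OF b] by metis
  show ?thesis
  proof (rule Bochner_Integration.integrable_bound)
    show "integrable (lebesgue_on \<Omega>) (\<lambda>x. (C * L) *\<^sub>R g x)" using g by simp
    have "continuous_on UNIV (\<lambda>z. b (fst z) (snd z))"
      by (intro bounded_bilinear.continuous_on[OF b] continuous_intros)
    then show "(\<lambda>x. b (g x) (\<psi> x)) \<in> borel_measurable (lebesgue_on \<Omega>)"
      by (rule borel_measurable_continuous_Pair[OF borel_measurable_integrable[OF g]
            borel_measurable_integrable[OF cellwise_continuous_integrable[OF \<psi>]]])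
    have C0: "C \<ge> 0" using C[of 0] norm_ge_zero order_trans by blast
    show "AE x in lebesgue_on \<Omega>. norm (b (g x) (\<psi> x)) \<le> norm ((C * L) *\<^sub>R g x)"
    proof (intro AE_I2)
      fix x
      have "norm (b (g x) (\<psi> x)) \<le> norm (g x) * norm (\<psi> x) * L" by (rule L(2))
      also have "\<dots> \<le> norm (g x) * C * L" using L(1) by (intro mult_left_mono mult_right_mono C) auto
      finally show "norm (b (g x) (\<psi> x)) \<le> norm ((C * L) *\<^sub>R g x)" using C0 L(1) by (simp add: ac_simps abs_mult)
    qed
  qed
qed

lemma integrable_bilinear_test:
  fixes b :: "'b::euclidean_space \<Rightarrow> 'c::euclidean_space \<Rightarrow> 'd::euclidean_space"
  assumes "bounded_bilinear b" "integrable (lebesgue_on \<Omega>) g" and \<psi>: "\<psi> \<in> test_functions U"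
  shows "integrable (lebesgue_on \<Omega>) (\<lambda>x. b (g x) (\<psi> x))"
proof -
  obtain C where "\<And>x. norm (\<psi> x) \<le> C" using test_functions_bounded[OF \<psi>] by metis
  then show ?thesis
    by (rule integrable_bilinear_bounded[OF assms(1,2) test_functions_cellwise_continuous[OF \<psi>]])
qed

text \<open>The sum of the cutoffs of the cells tends to 1 almost everywhere, since the faces are null
  sets.\<close>

lemma integral_eq_0_by_cutoffs:
  fixes F :: "real^3 \<Rightarrow> 'b::euclidean_space"
  assumes F: "integrable (lebesgue_on \<Omega>) F"
    and cut: "\<And>K \<kappa>. K \<in> \<T> \<Longrightarrow> \<kappa> \<in> test_functions (interior K) \<Longrightarrow> (LINT x|lebesgue_on \<Omega>. \<kappa> x *\<^sub>R F x) = 0"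
  shows "(LINT x|lebesgue_on \<Omega>. F x) = 0"
proof -
  have "\<forall>K. K \<in> \<T> \<longrightarrow> (\<exists>\<kappa>. (\<forall>n. \<kappa> n \<in> test_functions (interior K) \<and> (\<forall>x. 0 \<le> \<kappa> n x \<and> \<kappa> n x \<le> 1)) \<and>
     (\<forall>x\<in>interior K. (\<lambda>n. \<kappa> n x) \<longlonglongrightarrow> (1::real)))"
  proof (intro allI impI)
    fix K assume "K \<in> \<T>"
    from polytope_cutoffs[OF cell_polytope[OF this]] obtain \<kappa> :: "nat \<Rightarrow> real^3 \<Rightarrow> real" where \<kappa>:
      "\<And>n r. C_diff r (\<kappa> n)" "\<And>n x. 0 \<le> \<kappa> n x" "\<And>n x. \<kappa> n x \<le> 1"
      "\<And>n. compact (closure {x. \<kappa> n x \<noteq> 0})" "\<And>n. closure {x. \<kappa> n x \<noteq> 0} \<subseteq> interior K"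
      "\<And>x. x \<in> interior K \<Longrightarrow> (\<lambda>n. \<kappa> n x) \<longlonglongrightarrow> 1" by blast
    show "\<exists>\<kappa>. (\<forall>n. \<kappa> n \<in> test_functions (interior K) \<and> (\<forall>x. 0 \<le> \<kappa> n x \<and> \<kappa> n x \<le> 1)) \<and>
     (\<forall>x\<in>interior K. (\<lambda>n. \<kappa> n x) \<longlonglongrightarrow> (1::real))"
      by (rule exI[of _ \<kappa>]) (use \<kappa> in \<open>simp add: test_functions_def\<close>)
  qed
  then obtain \<kappa> :: "(real^3) set \<Rightarrow> nat \<Rightarrow> real^3 \<Rightarrow> real" where \<kappa>:
     "\<And>K n. K \<in> \<T> \<Longrightarrow> \<kappa> K n \<in> test_functions (interior K)"
     "\<And>K n x. K \<in> \<T> \<Longrightarrow> 0 \<le> \<kappa> K n x" "\<And>K n x. K \<in> \<T> \<Longrightarrow> \<kappa> K n x \<le> 1"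
     "\<And>K x. K \<in> \<T> \<Longrightarrow> x \<in> interior K \<Longrightarrow> (\<lambda>n. \<kappa> K n x) \<longlonglongrightarrow> 1"
    by metis
  define s where "s n x = (\<Sum>K\<in>\<T>. \<kappa> K n x *\<^sub>R F x)" for n x
  have int: "integrable (lebesgue_on \<Omega>) (\<lambda>x. \<kappa> K n x *\<^sub>R F x)" if "K \<in> \<T>" for K n
    by (rule integrable_bilinear_test[OF bounded_bilinear.flip[OF bounded_bilinear_scaleR] F \<kappa>(1)[OF that]])
  have "(\<lambda>n. LINT x|lebesgue_on \<Omega>. s n x) \<longlonglongrightarrow> (LINT x|lebesgue_on \<Omega>. F x)"
  proof (rule integral_dominated_convergence[where w = "\<lambda>x. real (card \<T>) * norm (F x)"])
    show "F \<in> borel_measurable (lebesgue_on \<Omega>)" using F by (rule borel_measurable_integrable)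
    show "s n \<in> borel_measurable (lebesgue_on \<Omega>)" for n
      unfolding s_def by (intro borel_measurable_sum borel_measurable_integrable[OF int])
    show "integrable (lebesgue_on \<Omega>) (\<lambda>x. real (card \<T>) * norm (F x))" using F by simp
    show "AE x in lebesgue_on \<Omega>. (\<lambda>n. s n x) \<longlonglongrightarrow> F x"
      using AE_in_cell
    proof eventually_elim
      case (elim x)
      then obtain K where K: "K \<in> \<T>" "x \<in> interior K" by blast
      have "s n x = \<kappa> K n x *\<^sub>R F x" for n
      proof -
        have "\<kappa> L n x *\<^sub>R F x = (if L = K then \<kappa> K n x *\<^sub>R F x else 0)" if "L \<in> \<T>" for L
        proof (cases "L = K")
          case False
          then have "x \<notin> interior L" using cells_disjoint[OF that K(1)] K(2) by blast
          then show ?thesis using test_functions_zero[OF \<kappa>(1)[OF that]] False by simp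
        qed simp
        then have "s n x = (\<Sum>L\<in>\<T>. if L = K then \<kappa> K n x *\<^sub>R F x else 0)"
          unfolding s_def by (rule sum.cong[OF refl])
        then show ?thesis using K finite_cells by simp
      qed
      moreover have "(\<lambda>n. \<kappa> K n x *\<^sub>R F x) \<longlonglongrightarrow> 1 *\<^sub>R F x"
        by (intro tendsto_intros \<kappa>(4) K)
      ultimately show ?case by simp
    qed
    show "AE x in lebesgue_on \<Omega>. norm (s n x) \<le> real (card \<T>) * norm (F x)" for n
    proof (intro AE_I2)
      fix x
      show "norm (s n x) \<le> real (card \<T>) * norm (F x)"
        unfolding s_def
        by (rule sum_norm_bound) (use \<kappa>(2,3) in \<open>simp add: mult_left_le_one_le\<close>)
    qed
  qed
  moreover have "(LINT x|lebesgue_on \<Omega>. s n x) = 0" for n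
    unfolding s_def using int cut \<kappa>(1) by (simp add: Bochner_Integration.integral_sum)
  ultimately show ?thesis by (simp add: LIMSEQ_const_iff)
qed

lemma cellwise_grad_by_parts_in_cell:
  assumes f: "cellwise_smooth \<T> f" and K: "K \<in> \<T>" and \<eta>: "\<eta> \<in> test_functions (interior K)"
  shows "(LINT x|lebesgue_on \<Omega>. f x *\<^sub>R grad \<eta> x) = - (LINT x|lebesgue_on \<Omega>. \<eta> x *\<^sub>R grad f x)"
proof -
  obtain p where p: "\<And>r. C_diff r p" "\<And>x. x \<in> interior K \<Longrightarrow> f x = p x"
    using cellwise_smoothE[OF f K] by metis
  have dp: "p differentiable (at x)" and d\<eta>: "\<eta> differentiable (at x)" for x
    using C_diff_differentiable p(1)[of "Suc 0"] test_functions_smooth[OF \<eta>, of "Suc 0"] by blast+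
  have sm: "C_diff r (\<lambda>x. p x * \<eta> x)" for r
    by (intro C_diff_mult p(1) test_functions_smooth[OF \<eta>])
  have eq: "f x *\<^sub>R grad \<eta> x + \<eta> x *\<^sub>R grad f x = grad (\<lambda>x. p x * \<eta> x) x" for x
  proof (cases "x \<in> interior K")
    case True
    then show ?thesis using p(2) grad_cell[OF p(2) True dp] by (simp add: grad_mult[OF dp d\<eta>])
  next
    case False
    then show ?thesis
      using test_functions_zero[OF \<eta>] test_functions_zero[OF test_functions_grad[OF \<eta>]]
      by (simp add: grad_mult[OF dp d\<eta>])
  qed
  have "(LINT x|lebesgue_on \<Omega>. f x *\<^sub>R grad \<eta> x + \<eta> x *\<^sub>R grad f x) = (LINT x|lborel. grad (\<lambda>x. p x * \<eta> x) x)"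
    unfolding eq
  proof (rule LINT_vanishing_outside)
    show "continuous_on UNIV (grad (\<lambda>x. p x * \<eta> x))" by (rule C_diff_continuous[OF C_diff_grad[OF sm]])
    fix x assume "x \<notin> \<Omega>"
    then have "x \<notin> interior K" using interior_cell_subset[OF K] by blast
    then show "grad (\<lambda>x. p x * \<eta> x) x = 0"
      using test_functions_zero[OF \<eta>] test_functions_zero[OF test_functions_grad[OF \<eta>]]
      by (simp add: grad_mult[OF dp d\<eta>])
  qed
  also have "\<dots> = 0"
    by (rule integral_grad_eq_0[OF sm bounded_subset[OF test_functions_bounded_support[OF \<eta>]]]) auto
  finally have "(LINT x|lebesgue_on \<Omega>. f x *\<^sub>R grad \<eta> x + \<eta> x *\<^sub>R grad f x) = 0" .
  moreover have "integrable (lebesgue_on \<Omega>) (\<lambda>x. f x *\<^sub>R grad \<eta> x)" "integrable (lebesgue_on \<Omega>) (\<lambda>x. \<eta> x *\<^sub>R grad f x)"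
    by (intro cellwise_continuous_integrable cellwise_continuous_intros
        cellwise_smooth_continuous[OF f] cellwise_smooth_continuous[OF cellwise_smooth_grad[OF f]]
        test_functions_cellwise_continuous[OF \<eta>] test_functions_cellwise_continuous[OF test_functions_grad[OF \<eta>]])+
  ultimately show ?thesis by (simp add: eq_neg_iff_add_eq_0)
qed

lemma cellwise_curl_by_parts_in_cell:
  assumes f: "cellwise_smooth \<T> f" and K: "K \<in> \<T>" and \<eta>: "\<eta> \<in> test_functions (interior K)"
  shows "(LINT x|lebesgue_on \<Omega>. f x \<bullet> curl \<eta> x) = (LINT x|lebesgue_on \<Omega>. curl f x \<bullet> \<eta> x)"
proof -
  obtain p where p: "\<And>r. C_diff r p" "\<And>x. x \<in> interior K \<Longrightarrow> f x = p x"
    using cellwise_smoothE[OF f K] by metis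
  have dp: "p differentiable (at x)" and d\<eta>: "\<eta> differentiable (at x)" for x
    using C_diff_differentiable p(1)[of "Suc 0"] test_functions_smooth[OF \<eta>, of "Suc 0"] by blast+
  define h where "h = (\<lambda>i x. cross3 (\<eta> x) (p x) $ i)"
  have sm: "C_diff r (h i)" for r i
    unfolding h_def
    by (intro C_diff_component C_diff_bilinear[OF bounded_bilinear_cross3] p(1) test_functions_smooth[OF \<eta>])
  have curl\<eta>: "curl \<eta> x = 0" if "x \<notin> interior K" for x
    using test_functions_zero[OF test_functions_curl[OF \<eta>] that] by simp
  have eq: "f x \<bullet> curl \<eta> x - curl f x \<bullet> \<eta> x = (\<Sum>i\<in>UNIV. pderiv_at i (h i) x)" for x
  proof (cases "x \<in> interior K")
    case True
    then show ?thesis using p(2) curl_cell[OF p(2) True dp] div_cross_eq[OF d\<eta> dp]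
      by (simp add: h_def inner_commute)
  next
    case False
    then show ?thesis
      using test_functions_zero[OF \<eta>] curl\<eta> div_cross_eq[OF d\<eta> dp] by (simp add: h_def)
  qed
  have bh: "bounded {x. h i x \<noteq> 0}" for i
    by (rule bounded_subset[OF test_functions_bounded_support[OF \<eta>]]) (auto simp: h_def)
  have cont: "continuous_on UNIV (pderiv_at i (h i))" for i
    by (rule C_diff_continuous[OF C_diff_derivative[OF sm]])
  have zero: "pderiv_at i (h i) x = 0" if "x \<notin> closure {x. h i x \<noteq> 0}" for i x
    by (rule frechet_derivative_zero_outside[OF that])
  have int: "integrable lborel (pderiv_at i (h i))" for i
    by (rule C_diff_0_vanishing_integrable[OF cont bounded_closure[OF bh] zero])
  have "(LINT x|lebesgue_on \<Omega>. f x \<bullet> curl \<eta> x - curl f x \<bullet> \<eta> x) = (LINT x|lborel. (\<Sum>i\<in>UNIV. pderiv_at i (h i) x))"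
    unfolding eq
  proof (rule LINT_vanishing_outside)
    show "continuous_on UNIV (\<lambda>x. \<Sum>i\<in>UNIV. pderiv_at i (h i) x)" by (intro continuous_on_sum cont)
    fix x assume "x \<notin> \<Omega>"
    then have "x \<notin> interior K" using interior_cell_subset[OF K] by blast
    then have "f x \<bullet> curl \<eta> x - curl f x \<bullet> \<eta> x = 0" using test_functions_zero[OF \<eta>] curl\<eta> by simp
    then show "(\<Sum>i\<in>UNIV. pderiv_at i (h i) x) = 0" unfolding eq .
  qed
  also have "\<dots> = 0"
    using int integral_derivative_eq_0[OF sm bh] by (simp add: Bochner_Integration.integral_sum)
  finally have "(LINT x|lebesgue_on \<Omega>. f x \<bullet> curl \<eta> x - curl f x \<bullet> \<eta> x) = 0" .
  moreover have "integrable (lebesgue_on \<Omega>) (\<lambda>x. f x \<bullet> curl \<eta> x)" "integrable (lebesgue_on \<Omega>) (\<lambda>x. curl f x \<bullet> \<eta> x)"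
    by (intro cellwise_continuous_integrable cellwise_continuous_intros
        cellwise_smooth_continuous[OF f] cellwise_smooth_continuous[OF cellwise_smooth_curl[OF f]]
        test_functions_cellwise_continuous[OF \<eta>] test_functions_cellwise_continuous[OF test_functions_curl[OF \<eta>]])+
  ultimately show ?thesis by simp
qed

text \<open>Two fields that pair alike with test functions supported in single cells pair alike with all
  test functions. Applied to a weak derivative and the cellwise derivative, this takes the place of
  the fundamental lemma of the calculus of variations.\<close>

lemma pairing_determined_in_cells:
  fixes b :: "'b::euclidean_space \<Rightarrow> 'c::euclidean_space \<Rightarrow> 'd::euclidean_space"
  assumes b: "bounded_bilinear b" and g: "g \<in> L2 \<Omega>" and h: "cellwise_continuous \<T> h"
    and cell: "\<And>K \<eta>. K \<in> \<T> \<Longrightarrow> \<eta> \<in> test_functions (interior K) \<Longrightarrow> \<eta> \<in> test_functions \<Omega> \<Longrightarrow>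
       (LINT x|lebesgue_on \<Omega>. b (g x) (\<eta> x)) = (LINT x|lebesgue_on \<Omega>. b (h x) (\<eta> x))"
    and \<psi>: "\<psi> \<in> test_functions \<Omega>"
  shows "(LINT x|lebesgue_on \<Omega>. b (g x) (\<psi> x)) = (LINT x|lebesgue_on \<Omega>. b (h x) (\<psi> x))"
proof -
  have int: "integrable (lebesgue_on \<Omega>) (\<lambda>x. b (g x) (\<eta> x))" "integrable (lebesgue_on \<Omega>) (\<lambda>x. b (h x) (\<eta> x))"
    if "\<eta> \<in> test_functions \<Omega>" for \<eta>
    by (rule integrable_bilinear_test[OF b L2_integrable[OF g] that],
        rule integrable_bilinear_test[OF b cellwise_continuous_integrable[OF h] that])
  have "(LINT x|lebesgue_on \<Omega>. b (g x) (\<psi> x) - b (h x) (\<psi> x)) = 0"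
  proof (rule integral_eq_0_by_cutoffs)
    show "integrable (lebesgue_on \<Omega>) (\<lambda>x. b (g x) (\<psi> x) - b (h x) (\<psi> x))" using int[OF \<psi>] by simp
    fix K and \<kappa> :: "real^3 \<Rightarrow> real" assume K: "K \<in> \<T>" and \<kappa>: "\<kappa> \<in> test_functions (interior K)"
    have t: "(\<lambda>x. \<kappa> x *\<^sub>R \<psi> x) \<in> test_functions (interior K)" by (rule test_functions_scaleR[OF \<kappa> \<psi>])
    then have t': "(\<lambda>x. \<kappa> x *\<^sub>R \<psi> x) \<in> test_functions \<Omega>"
      using test_functions_dom interior_cell_subset[OF K] by blast
    have "\<kappa> x *\<^sub>R (b (g x) (\<psi> x) - b (h x) (\<psi> x)) = b (g x) (\<kappa> x *\<^sub>R \<psi> x) - b (h x) (\<kappa> x *\<^sub>R \<psi> x)" for x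
      by (simp add: bounded_bilinear.scaleR_right[OF b] scaleR_diff_right)
    then show "(LINT x|lebesgue_on \<Omega>. \<kappa> x *\<^sub>R (b (g x) (\<psi> x) - b (h x) (\<psi> x))) = 0"
      using int[OF t'] cell[OF K t t'] by simp
  qed
  then show ?thesis using int[OF \<psi>] by simp
qed

lemma H1_cellwise_grad:
  assumes H1: "f \<in> H1 \<Omega>" and f: "cellwise_smooth \<T> f" and \<psi>: "\<psi> \<in> test_functions \<Omega>"
  shows "(LINT x|lebesgue_on \<Omega>. f x *\<^sub>R grad \<psi> x) = - (LINT x|lebesgue_on \<Omega>. \<psi> x *\<^sub>R grad f x)"
proof -
  obtain g where g: "g \<in> L2 \<Omega>" and w: "\<And>\<psi>. \<psi> \<in> test_functions \<Omega> \<Longrightarrow>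
     (LINT x|lebesgue_on \<Omega>. f x *\<^sub>R grad \<psi> x) = - (LINT x|lebesgue_on \<Omega>. \<psi> x *\<^sub>R g x)"
    using H1 by (auto simp: H1_def has_weak_grad_def)
  have "(LINT x|lebesgue_on \<Omega>. \<psi> x *\<^sub>R g x) = (LINT x|lebesgue_on \<Omega>. \<psi> x *\<^sub>R grad f x)"
  proof (rule pairing_determined_in_cells[OF bounded_bilinear.flip[OF bounded_bilinear_scaleR] g])
    show "cellwise_continuous \<T> (grad f)" by (intro cellwise_smooth_continuous cellwise_smooth_grad f)
    show "(LINT x|lebesgue_on \<Omega>. \<eta> x *\<^sub>R g x) = (LINT x|lebesgue_on \<Omega>. \<eta> x *\<^sub>R grad f x)"
      if "K \<in> \<T>" "\<eta> \<in> test_functions (interior K)" "\<eta> \<in> test_functions \<Omega>" for K \<eta>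
      using w[OF that(3)] cellwise_grad_by_parts_in_cell[OF f that(1,2)] by simp
  qed (rule \<psi>)
  then show ?thesis using w[OF \<psi>] by simp
qed

lemma Hcurl_cellwise_curl:
  assumes Hc: "f \<in> Hcurl \<Omega>" and f: "cellwise_smooth \<T> f" and \<psi>: "\<psi> \<in> test_functions \<Omega>"
  shows "(LINT x|lebesgue_on \<Omega>. f x \<bullet> curl \<psi> x) = (LINT x|lebesgue_on \<Omega>. curl f x \<bullet> \<psi> x)"
proof -
  obtain g where g: "g \<in> L2 \<Omega>" and w: "\<And>\<psi>. \<psi> \<in> test_functions \<Omega> \<Longrightarrow>
     (LINT x|lebesgue_on \<Omega>. f x \<bullet> curl \<psi> x) = (LINT x|lebesgue_on \<Omega>. g x \<bullet> \<psi> x)"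
    using Hc by (auto simp: Hcurl_def has_weak_curl_def)
  have "(LINT x|lebesgue_on \<Omega>. g x \<bullet> \<psi> x) = (LINT x|lebesgue_on \<Omega>. curl f x \<bullet> \<psi> x)"
  proof (rule pairing_determined_in_cells[OF bounded_bilinear_inner g])
    show "cellwise_continuous \<T> (curl f)" by (intro cellwise_smooth_continuous cellwise_smooth_curl f)
    show "(LINT x|lebesgue_on \<Omega>. g x \<bullet> \<eta> x) = (LINT x|lebesgue_on \<Omega>. curl f x \<bullet> \<eta> x)"
      if "K \<in> \<T>" "\<eta> \<in> test_functions (interior K)" "\<eta> \<in> test_functions \<Omega>" for K \<eta>
      using w[OF that(3)] cellwise_curl_by_parts_in_cell[OF f that(1,2)] by simp
  qed (rule \<psi>)
  then show ?thesis using w[OF \<psi>] by simp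
qed

text \<open>The components of the curl of a test field are scalar test functions, and their derivatives
  sum to its divergence, which is 0.\<close>

lemma grad_has_weak_curl_0:
  assumes H1: "f \<in> H1 \<Omega>" and f: "cellwise_smooth \<T> f"
  shows "has_weak_curl \<Omega> (grad f) (\<lambda>x. 0)"
  unfolding has_weak_curl_def
proof (intro conjI ballI)
  show "(\<lambda>x. 0) \<in> L2 \<Omega>" by (intro cellwise_continuous_L2 cellwise_continuous_const)
  fix \<psi> :: "real^3 \<Rightarrow> real^3" assume \<psi>: "\<psi> \<in> test_functions \<Omega>"
  define c where "c = (\<lambda>i x. curl \<psi> x $ i)"
  have c: "c i \<in> test_functions \<Omega>" for i
    unfolding c_def by (intro test_functions_component test_functions_curl \<psi>)
  have cc: "cellwise_continuous \<T> (c i)" "cellwise_continuous \<T> (grad (c i))" for i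
    by (rule test_functions_cellwise_continuous[OF c])
       (rule test_functions_cellwise_continuous[OF test_functions_grad[OF c]])
  have cf: "cellwise_continuous \<T> f" "cellwise_continuous \<T> (grad f)"
    by (rule cellwise_smooth_continuous[OF f])
       (rule cellwise_smooth_continuous[OF cellwise_smooth_grad[OF f]])
  have int: "integrable (lebesgue_on \<Omega>) (\<lambda>x. f x *\<^sub>R grad (c i) x)" "integrable (lebesgue_on \<Omega>) (\<lambda>x. c i x *\<^sub>R grad f x)" for i
    by (intro cellwise_continuous_integrable cellwise_continuous_intros cc cf)
       (intro cellwise_continuous_integrable cellwise_continuous_intros cc cf)
  have int': "integrable (lebesgue_on \<Omega>) (\<lambda>x. f x * grad (c i) x $ i)" "integrable (lebesgue_on \<Omega>) (\<lambda>x. c i x * grad f x $ i)" for i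
    using integrable_inner_left[OF int(1), of i "axis i 1"] integrable_inner_left[OF int(2), of i "axis i 1"]
    by (simp_all add: cart_eq_inner_axis)
  have comp: "(LINT x|lebesgue_on \<Omega>. f x * grad (c i) x $ i) = - (LINT x|lebesgue_on \<Omega>. c i x * grad f x $ i)" for i
    using H1_cellwise_grad[OF H1 f c[of i]] LINT_component[OF int(1)[of i], of i] LINT_component[OF int(2)[of i], of i]
    by simp
  have "(LINT x|lebesgue_on \<Omega>. grad f x \<bullet> curl \<psi> x) = (LINT x|lebesgue_on \<Omega>. (\<Sum>i\<in>UNIV. c i x * grad f x $ i))"
    by (simp add: inner_vec_def c_def mult.commute)
  also have "\<dots> = - (LINT x|lebesgue_on \<Omega>. (\<Sum>i\<in>UNIV. f x * grad (c i) x $ i))"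
    using int' comp by (simp add: Bochner_Integration.integral_sum sum_negf)
  also have "(\<lambda>x. \<Sum>i\<in>UNIV. f x * grad (c i) x $ i) = (\<lambda>x. 0)"
    using div_curl_eq_0[OF test_functions_smooth[OF \<psi>]]
    by (simp add: sum_distrib_left[symmetric] grad_def c_def fun_eq_iff)
  finally show "(LINT x|lebesgue_on \<Omega>. grad f x \<bullet> curl \<psi> x) = (LINT x|lebesgue_on \<Omega>. 0 \<bullet> \<psi> x)" by simp
qed

text \<open>The gradient of a test function is a test field without curl.\<close>

lemma curl_has_weak_div_0:
  assumes Hc: "f \<in> Hcurl \<Omega>" and f: "cellwise_smooth \<T> f"
  shows "has_weak_div \<Omega> (curl f) (\<lambda>x. 0)"
  unfolding has_weak_div_def
proof (intro conjI ballI)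
  show "(\<lambda>x. 0) \<in> L2 \<Omega>" by (intro cellwise_continuous_L2 cellwise_continuous_const)
  fix \<psi> :: "real^3 \<Rightarrow> real" assume \<psi>: "\<psi> \<in> test_functions \<Omega>"
  show "(LINT x|lebesgue_on \<Omega>. curl f x \<bullet> grad \<psi> x) = - (LINT x|lebesgue_on \<Omega>. 0 * \<psi> x)"
    using Hcurl_cellwise_curl[OF Hc f test_functions_grad[OF \<psi>]]
      curl_grad_eq_0[OF test_functions_smooth[OF \<psi>]] by simp
qed

end


section \<open>Continuity across the faces\<close>

lemma grad_inner: "f differentiable (at x) \<Longrightarrow> grad f x \<bullet> v = frechet_derivative f (at x) v"
proof -
  assume "f differentiable (at x)"
  then have lin: "linear (frechet_derivative f (at x))" by (rule linear_frechet_derivative)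
  have "v = (\<Sum>i\<in>UNIV. v $ i *\<^sub>R axis i 1)"
    using basis_expansion[of v] by (simp add: scalar_mult_eq_scaleR)
  then have "frechet_derivative f (at x) v = (\<Sum>i\<in>UNIV. v $ i *\<^sub>R frechet_derivative f (at x) (axis i 1))"
    using linear_sum[OF lin] linear_scale[OF lin] by (metis (no_types, lifting) sum.cong)
  then show ?thesis by (simp add: inner_vec_def grad_def mult.commute)
qed

lemma bump_exists:
  fixes y :: "real^3"
  assumes "open U" "y \<in> U"
  obtains \<eta> :: "real^3 \<Rightarrow> real" where "\<eta> \<in> test_functions U" "\<And>x. 0 \<le> \<eta> x" "\<eta> y > 0"
proof -
  obtain a b where ab: "cbox a b \<subseteq> U" "y \<in> box a b" using open_contains_cbox[OF assms] by metis
  from polytope_cutoffs[OF polytope_interval[of a b]] obtain \<kappa> :: "nat \<Rightarrow> real^3 \<Rightarrow> real" where \<kappa>: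
      "\<And>n r. C_diff r (\<kappa> n)" "\<And>n x. 0 \<le> \<kappa> n x" "\<And>n x. \<kappa> n x \<le> 1"
      "\<And>n. compact (closure {x. \<kappa> n x \<noteq> 0})" "\<And>n. closure {x. \<kappa> n x \<noteq> 0} \<subseteq> interior (cbox a b)"
      "\<And>x. x \<in> interior (cbox a b) \<Longrightarrow> (\<lambda>n. \<kappa> n x) \<longlonglongrightarrow> 1" by metis
  have "(\<lambda>n. \<kappa> n y) \<longlonglongrightarrow> 1" using \<kappa>(6) ab(2) by (simp add: interior_cbox)
  then have "\<forall>\<^sub>F n in sequentially. \<kappa> n y > 0" by (rule order_tendstoD) simp
  then obtain n where n: "\<kappa> n y > 0" unfolding eventually_sequentially by blast
  have "closure {x. \<kappa> n x \<noteq> 0} \<subseteq> U" using \<kappa>(5)[of n] interior_subset[of "cbox a b"] ab(1) by (meson order_trans)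
  then have "\<kappa> n \<in> test_functions U" using \<kappa>(1,4) by (simp add: test_functions_def)
  then show ?thesis using that[of "\<kappa> n"] \<kappa>(2) n by simp
qed

lemma bump_integral_pos:
  assumes \<eta>: "\<eta> \<in> test_functions U" "\<And>x. 0 \<le> \<eta> x" "\<eta> y > (0::real)"
  shows "(LINT x|lborel. \<eta> x) > 0"
proof -
  have cont: "continuous_on UNIV \<eta>" using C_diff_continuous[OF test_functions_smooth[OF \<eta>(1), of 0]] .
  have int: "integrable lborel \<eta>"
    by (rule C_diff_0_vanishing_integrable[OF cont test_functions_bounded_support[OF \<eta>(1)]]) simp
  have "(LINT x|lborel. \<eta> x) \<noteq> 0"
  proof
    assume "(LINT x|lborel. \<eta> x) = 0"
    then have "AE x in lborel. \<eta> x = 0" using integral_nonneg_eq_0_iff_AE[OF int] \<eta>(2) by simp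
    then have "AE x in lebesgue. \<not> \<eta> x > 0" by (intro AE_completion) auto
    then have "negligible {x. \<eta> x > 0}" by (simp add: negligible_iff_null_sets AE_iff_null_sets[symmetric] completion.AE_iff_null_sets)
    moreover have "open {x. \<eta> x > 0}" using cont by (intro open_Collect_less) auto
    ultimately show False using \<eta>(3) open_not_negligible by blast
  qed
  moreover have "(LINT x|lborel. \<eta> x) \<ge> 0" using \<eta>(2) by simp
  ultimately show ?thesis by simp
qed

lemma LINT_lborel_shift:
  fixes f :: "real^3 \<Rightarrow> real"
  assumes "f \<in> borel_measurable borel"
  shows "(LINT x|lborel. f (x - c)) = (LINT x|lborel. f x)"
proof -
  have "(LINT x|lborel. f x) = (LINT x|distr lborel borel ((+) (- c)). f x)" by (simp add: lborel_distr_plus)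
  also have "\<dots> = (LINT x|lborel. f (- c + x))" by (rule integral_distr) (use assms in auto)
  finally show ?thesis by simp
qed

lemma test_functions_shift:
  assumes "\<psi> \<in> test_functions U" "\<And>y. y \<in> U \<Longrightarrow> y + a \<in> V"
  shows "(\<lambda>x. \<psi> (x - a)) \<in> test_functions V"
proof -
  let ?S = "closure {x. \<psi> x \<noteq> 0}"
  have S: "compact ?S" "?S \<subseteq> U" using assms(1) by (simp_all add: test_functions_def)
  have "compact ((+) a ` ?S)" using S(1) by (rule compact_translation)
  moreover have "{x. \<psi> (x - a) \<noteq> 0} \<subseteq> (+) a ` ?S"
  proof
    fix x assume "x \<in> {x. \<psi> (x - a) \<noteq> 0}"
    then have "x - a \<in> ?S" using closure_subset[of "{x. \<psi> x \<noteq> 0}"] by auto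
    then show "x \<in> (+) a ` ?S" by (rule rev_image_eqI) simp
  qed
  ultimately have "closure {x. \<psi> (x - a) \<noteq> 0} \<subseteq> (+) a ` ?S"
    by (intro closure_minimal) (auto intro: compact_imp_closed)
  moreover have "(+) a ` ?S \<subseteq> V" using S(2) assms(2) by (auto simp: add.commute)
  moreover have "compact (closure {x. \<psi> (x - a) \<noteq> 0})"
    using \<open>compact ((+) a ` ?S)\<close> calculation(1) by (meson closed_closure compact_eq_bounded_closed bounded_subset)
  ultimately show ?thesis
    using C_diff_shift[OF test_functions_smooth[OF assms(1)]] by (simp add: test_functions_def)
qed

context fe_mesh
begin

lemma cellwise_continuous_bounded:
  fixes f :: "real^3 \<Rightarrow> 'b::euclidean_space"
  assumes "cellwise_continuous \<T> f"
  obtains M where "M \<ge> 0" "\<And>K x. K \<in> \<T> \<Longrightarrow> x \<in> interior K \<Longrightarrow> norm (f x) \<le> M"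
proof -
  have "\<exists>M. \<forall>x\<in>interior K. norm (f x) \<le> M" if K: "K \<in> \<T>" for K
  proof -
    obtain p where p: "continuous_on K p" "\<forall>x\<in>interior K. f x = p x"
      using assms K unfolding cellwise_continuous_def by blast
    have "bounded (p ` K)" by (rule compact_imp_bounded[OF compact_continuous_image[OF p(1) cell_compact[OF K]]])
    then obtain M where "\<forall>y\<in>p ` K. norm y \<le> M" unfolding bounded_iff by blast
    then show ?thesis using p(2) interior_subset by (metis image_eqI subsetD)
  qed
  then obtain M where M: "\<And>K x. K \<in> \<T> \<Longrightarrow> x \<in> interior K \<Longrightarrow> norm (f x) \<le> M K" by metis
  define N where "N = (\<Sum>K\<in>\<T>. \<bar>M K\<bar>)"
  have "norm (f x) \<le> N" if "K \<in> \<T>" "x \<in> interior K" for K x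
  proof -
    have "norm (f x) \<le> \<bar>M K\<bar>" using M[OF that] by linarith
    also have "\<bar>M K\<bar> \<le> N" unfolding N_def using that finite_cells by (intro member_le_sum) auto
    finally show ?thesis .
  qed
  moreover have "N \<ge> 0" unfolding N_def by (simp add: sum_nonneg)
  ultimately show ?thesis using that by blast
qed

lemma weighted_integral_bound:
  fixes g \<psi> :: "real^3 \<Rightarrow> real"
  assumes \<psi>: "\<psi> \<in> test_functions \<Omega>" "\<And>x. 0 \<le> \<psi> x" and g: "cellwise_continuous \<T> g"
    and b: "\<And>K x. K \<in> \<T> \<Longrightarrow> x \<in> interior K \<Longrightarrow> \<psi> x \<noteq> 0 \<Longrightarrow> \<bar>g x\<bar> \<le> C"
  shows "\<bar>LINT x|lebesgue_on \<Omega>. g x * \<psi> x\<bar> \<le> C * (LINT x|lebesgue_on \<Omega>. \<psi> x)"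
proof -
  note c = test_functions_cellwise_continuous[OF \<psi>(1)]
  have int: "integrable (lebesgue_on \<Omega>) (\<lambda>x. g x * \<psi> x)" "integrable (lebesgue_on \<Omega>) (\<lambda>x. C * \<psi> x)"
    by (intro cellwise_continuous_integrable cellwise_continuous_intros c g)+
  have "\<bar>LINT x|lebesgue_on \<Omega>. g x * \<psi> x\<bar> \<le> (LINT x|lebesgue_on \<Omega>. \<bar>g x * \<psi> x\<bar>)"
    by (rule integral_abs_bound)
  also have "\<dots> \<le> (LINT x|lebesgue_on \<Omega>. C * \<psi> x)"
  proof (rule integral_mono_AE)
    show "integrable (lebesgue_on \<Omega>) (\<lambda>x. \<bar>g x * \<psi> x\<bar>)" using int(1) by (rule integrable_abs)
    show "AE x in lebesgue_on \<Omega>. \<bar>g x * \<psi> x\<bar> \<le> C * \<psi> x"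
      using AE_in_cell
    proof eventually_elim
      case (elim x)
      then obtain K where K: "K \<in> \<T>" "x \<in> interior K" by blast
      show ?case
      proof (cases "\<psi> x = 0")
        case False
        then have "\<bar>g x\<bar> * \<psi> x \<le> C * \<psi> x" using b[OF K] \<psi>(2)[of x] by (intro mult_right_mono) auto
        then show ?thesis using \<psi>(2)[of x] by (simp add: abs_mult)
      qed simp
    qed
  qed (rule int)
  finally show ?thesis by simp
qed

text \<open>Differentiation under the integral sign: the mean value inequality bounds the difference
  quotients of the test function, so a multiple of \<open>f\<close> dominates.\<close>

lemma shifted_pairing_has_derivative:
  fixes f \<eta> :: "real^3 \<Rightarrow> real"
  assumes f: "cellwise_continuous \<T> f" and \<eta>: "\<eta> \<in> test_functions U"
  shows "((\<lambda>t. LINT x|lebesgue_on \<Omega>. f x * \<eta> (x - t *\<^sub>R v)) has_field_derivative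
      (LINT x|lebesgue_on \<Omega>. f x * frechet_derivative \<eta> (at (x - t *\<^sub>R v)) (- v))) (at t)"
proof -
  define d where "d x = frechet_derivative \<eta> (at x) (- v)" for x
  have sm: "C_diff r \<eta>" for r by (rule test_functions_smooth[OF \<eta>])
  have d: "d \<in> test_functions U"
  proof (rule test_functions_support[OF \<eta>])
    show "C_diff r d" for r unfolding d_def by (rule C_diff_derivative[OF sm])
    fix x assume "x \<notin> closure {x. \<eta> x \<noteq> 0}"
    then show "d x = 0" unfolding d_def by (rule frechet_derivative_zero_outside)
  qed
  obtain C where C: "\<And>x. norm (d x) \<le> C" using test_functions_bounded[OF d] by metis
  have line: "((\<lambda>s. \<eta> (x - (t + s) *\<^sub>R v)) has_field_derivative d (x - (t + s) *\<^sub>R v)) (at s)" for x s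
    using C_diff_line_derivative[OF sm, of "x - t *\<^sub>R v" "- v" s] by (simp add: d_def algebra_simps)
  have lip: "\<bar>\<eta> (x - (t + s) *\<^sub>R v) - \<eta> (x - t *\<^sub>R v)\<bar> \<le> C * \<bar>s\<bar>" for x s
  proof -
    have "norm ((\<lambda>s. \<eta> (x - (t + s) *\<^sub>R v)) s - (\<lambda>s. \<eta> (x - (t + s) *\<^sub>R v)) 0) \<le> C * norm (s - 0)"
      by (rule field_differentiable_bound[OF convex_UNIV, where f' = "\<lambda>s. d (x - (t + s) *\<^sub>R v)"])
         (use line C in auto)
    then show ?thesis by simp
  qed
  have cs: "cellwise_continuous \<T> (\<lambda>x. \<eta> (x - a))" "cellwise_continuous \<T> (\<lambda>x. d (x - a))" for a
    by (rule cellwise_continuousI, rule C_diff_continuous[OF C_diff_shift], rule sm)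
       (rule cellwise_continuousI, rule C_diff_continuous[OF C_diff_shift], rule test_functions_smooth[OF d])
  have int: "integrable (lebesgue_on \<Omega>) (\<lambda>x. f x * \<eta> (x - a))" "integrable (lebesgue_on \<Omega>) (\<lambda>x. f x * d (x - a))" for a
    by (intro cellwise_continuous_integrable cellwise_continuous_intros f cs)
       (intro cellwise_continuous_integrable cellwise_continuous_intros f cs)
  let ?h = "\<lambda>t. LINT x|lebesgue_on \<Omega>. f x * \<eta> (x - t *\<^sub>R v)"
  have "((\<lambda>s. (?h (t + s) - ?h t) / s) \<longlongrightarrow> (LINT x|lebesgue_on \<Omega>. f x * d (x - t *\<^sub>R v))) (at 0)"
    unfolding tendsto_at_iff_sequentially
  proof (intro allI impI)
    fix X :: "nat \<Rightarrow> real" assume X0: "\<forall>i. X i \<in> UNIV - {0}" and X: "X \<longlonglongrightarrow> 0"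
    define s where "s i x = (f x * \<eta> (x - (t + X i) *\<^sub>R v) - f x * \<eta> (x - t *\<^sub>R v)) / X i" for i x
    have "(\<lambda>i. LINT x|lebesgue_on \<Omega>. s i x) \<longlonglongrightarrow> (LINT x|lebesgue_on \<Omega>. f x * d (x - t *\<^sub>R v))"
    proof (rule integral_dominated_convergence[where w = "\<lambda>x. C * norm (f x)"])
      show "(\<lambda>x. f x * d (x - t *\<^sub>R v)) \<in> borel_measurable (lebesgue_on \<Omega>)"
        by (rule borel_measurable_integrable[OF int(2)])
      show "s i \<in> borel_measurable (lebesgue_on \<Omega>)" for i
        unfolding s_def using int(1) by (intro borel_measurable_integrable) simp
      show "integrable (lebesgue_on \<Omega>) (\<lambda>x. C * norm (f x))"
        using cellwise_continuous_integrable[OF f] by simp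
      show "AE x in lebesgue_on \<Omega>. (\<lambda>i. s i x) \<longlonglongrightarrow> f x * d (x - t *\<^sub>R v)"
      proof (intro AE_I2)
        fix x
        have "((\<lambda>s. (\<eta> (x - (t + s) *\<^sub>R v) - \<eta> (x - t *\<^sub>R v)) / s) \<longlongrightarrow> d (x - t *\<^sub>R v)) (at 0)"
          using line[of x 0] by (simp add: has_field_derivative_iff)
        then have "(\<lambda>i. (\<eta> (x - (t + X i) *\<^sub>R v) - \<eta> (x - t *\<^sub>R v)) / X i) \<longlonglongrightarrow> d (x - t *\<^sub>R v)"
          using X0 X unfolding tendsto_at_iff_sequentially by (simp add: o_def)
        then have "(\<lambda>i. f x * ((\<eta> (x - (t + X i) *\<^sub>R v) - \<eta> (x - t *\<^sub>R v)) / X i)) \<longlonglongrightarrow> f x * d (x - t *\<^sub>R v)"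
          by (rule tendsto_mult_left)
        then show "(\<lambda>i. s i x) \<longlonglongrightarrow> f x * d (x - t *\<^sub>R v)"
          by (simp add: s_def Rings.right_diff_distrib)
      qed
      show "AE x in lebesgue_on \<Omega>. norm (s i x) \<le> C * norm (f x)" for i
      proof (intro AE_I2)
        fix x
        have "norm (s i x) = \<bar>f x\<bar> * \<bar>\<eta> (x - (t + X i) *\<^sub>R v) - \<eta> (x - t *\<^sub>R v)\<bar> / \<bar>X i\<bar>"
          by (simp add: s_def abs_mult Rings.right_diff_distrib[symmetric])
        also have "\<dots> \<le> \<bar>f x\<bar> * (C * \<bar>X i\<bar>) / \<bar>X i\<bar>"
          by (intro divide_right_mono mult_left_mono lip) auto
        also have "\<dots> = C * norm (f x)" using X0 by simp
        finally show "norm (s i x) \<le> C * norm (f x)" .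
      qed
    qed
    moreover have "(LINT x|lebesgue_on \<Omega>. s i x) = (?h (t + X i) - ?h t) / X i" for i
      unfolding s_def using int(1) by simp
    ultimately show "((\<lambda>s. (?h (t + s) - ?h t) / s) \<circ> X) \<longlonglongrightarrow> (LINT x|lebesgue_on \<Omega>. f x * d (x - t *\<^sub>R v))"
      by (simp add: o_def)
  qed
  then show ?thesis unfolding d_def DERIV_def .
qed

text \<open>Translating a bump along \<open>v\<close> changes its pairing with \<open>f\<close> at a rate given by the weak
  gradient, hence bounded. The bump may start in one cell and end in another, so \<open>f\<close> is Lipschitz
  from cell to cell, also across edges and vertices.\<close>

lemma H1_Lipschitz_between_cells:
  assumes H1: "f \<in> H1 \<Omega>" and f: "cellwise_smooth \<T> f"
    and M: "\<And>K x. K \<in> \<T> \<Longrightarrow> x \<in> interior K \<Longrightarrow> norm (grad f x) \<le> M"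
    and B: "convex B" "open B" "B \<subseteq> \<Omega>"
    and y: "K \<in> \<T>" "y \<in> interior K \<inter> B" and z: "L \<in> \<T>" "z \<in> interior L \<inter> B"
  shows "\<bar>f z - f y\<bar> \<le> M * norm (z - y)"
proof (rule field_le_epsilon)
  fix \<epsilon> :: real assume "\<epsilon> > 0"
  define v where "v = z - y"
  \<comment> \<open>Near each of the two points \<open>f\<close> is almost constant, and the bump will fit into both
    neighbourhoods.\<close>
  note cf = cellwise_smooth_continuous[OF f] and cg = cellwise_smooth_continuous[OF cellwise_smooth_grad[OF f]]
  have near: "\<exists>\<delta>>0. ball w \<delta> \<subseteq> B \<and> (\<forall>x\<in>ball w \<delta>. \<bar>f x - f w\<bar> \<le> \<epsilon> / 2)"
    if J: "J \<in> \<T>" and w: "w \<in> interior J \<inter> B" for J w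
  proof -
    obtain p where p: "\<And>r. C_diff r p" "\<And>x. x \<in> interior J \<Longrightarrow> f x = p x"
      using cellwise_smoothE[OF f J] by metis
    have "isCont p w" using C_diff_continuous[OF p(1)] by (simp add: continuous_on_eq_continuous_at)
    then obtain \<delta>1 where \<delta>1: "\<delta>1 > 0" "\<And>x. dist x w < \<delta>1 \<Longrightarrow> dist (p x) (p w) < \<epsilon> / 2"
      using \<open>\<epsilon> > 0\<close> unfolding continuous_at_eps_delta by (metis half_gt_zero)
    have "open (interior J \<inter> B)" using B(2) open_interior by (intro open_Int)
    then obtain \<delta>2 where \<delta>2: "\<delta>2 > 0" "ball w \<delta>2 \<subseteq> interior J \<inter> B"
      using w open_contains_ball by metis
    have "\<bar>f x - f w\<bar> \<le> \<epsilon> / 2" if "x \<in> ball w (min \<delta>1 \<delta>2)" for x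
    proof -
      have "x \<in> interior J" "w \<in> interior J" "dist x w < \<delta>1"
        using that \<delta>2 by (auto simp: dist_commute)
      then show ?thesis using \<delta>1(2)[of x] p(2) by (simp add: dist_real_def less_imp_le)
    qed
    then show ?thesis using \<delta>1(1) \<delta>2 by (intro exI[of _ "min \<delta>1 \<delta>2"]) auto
  qed
  obtain \<delta>1 \<delta>2 where \<delta>1: "\<delta>1 > 0" "ball y \<delta>1 \<subseteq> B" "\<forall>x\<in>ball y \<delta>1. \<bar>f x - f y\<bar> \<le> \<epsilon> / 2"
    and \<delta>2: "\<delta>2 > 0" "ball z \<delta>2 \<subseteq> B" "\<forall>x\<in>ball z \<delta>2. \<bar>f x - f z\<bar> \<le> \<epsilon> / 2"
    using near[OF y] near[OF z] by blast
  define \<delta> where "\<delta> = min \<delta>1 \<delta>2"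
  have \<delta>: "\<delta> > 0" using \<delta>1 \<delta>2 by (simp add: \<delta>_def)
  obtain \<eta> :: "real^3 \<Rightarrow> real" where \<eta>: "\<eta> \<in> test_functions (ball y \<delta>)" "\<And>x. 0 \<le> \<eta> x" "\<eta> y > 0"
    using bump_exists[of "ball y \<delta>" y] \<delta> by (metis centre_in_ball open_ball)
  have shiftB: "x + t *\<^sub>R v \<in> B" if "x \<in> ball y \<delta>" "t \<in> {0..1}" for x t
  proof -
    have "x \<in> B" using that(1) \<delta>1(2) by (auto simp: \<delta>_def)
    moreover have "x + v \<in> B"
    proof -
      have "dist z (x + v) = dist y x" by (simp add: v_def dist_norm)
      then show ?thesis using that(1) \<delta>2(2) by (auto simp: \<delta>_def)
    qed
    ultimately have "(1 - t) *\<^sub>R x + t *\<^sub>R (x + v) \<in> B"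
      using B(1) that(2) by (intro convexD) auto
    then show ?thesis by (simp add: algebra_simps)
  qed
  have \<eta>t: "(\<lambda>x. \<eta> (x - t *\<^sub>R v)) \<in> test_functions \<Omega>" if "t \<in> {0..1}" for t
    using test_functions_shift[OF \<eta>(1)] shiftB[OF _ that] B(3) by blast
  define I where "I = (LINT x|lborel. \<eta> x)"
  have I: "I > 0" unfolding I_def by (rule bump_integral_pos[OF \<eta>])
  have It: "(LINT x|lebesgue_on \<Omega>. \<eta> (x - t *\<^sub>R v)) = I" if "t \<in> {0..1}" for t
  proof -
    have "(LINT x|lebesgue_on \<Omega>. \<eta> (x - t *\<^sub>R v)) = (LINT x|lborel. \<eta> (x - t *\<^sub>R v))"
      by (rule LINT_vanishing_outside[OF C_diff_continuous[OF test_functions_smooth[OF \<eta>t[OF that], of 0]] test_functions_zero[OF \<eta>t[OF that]]])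
    also have "\<dots> = I" unfolding I_def
      by (rule LINT_lborel_shift) (rule borel_measurable_continuous_onI[OF C_diff_continuous[OF test_functions_smooth[OF \<eta>(1), of 0]]])
    finally show ?thesis .
  qed
  \<comment> \<open>The pairing of \<open>f\<close> with the bump that travels from \<open>y\<close> to \<open>z\<close>.\<close>
  define h where "h t = (LINT x|lebesgue_on \<Omega>. f x * \<eta> (x - t *\<^sub>R v))" for t
  define h' where "h' t = (LINT x|lebesgue_on \<Omega>. f x * frechet_derivative \<eta> (at (x - t *\<^sub>R v)) (- v))" for t
  have h: "(h has_field_derivative h' t) (at t)" for t
    unfolding h_def h'_def by (rule shifted_pairing_has_derivative[OF cf \<eta>(1)])
  have h'b: "\<bar>h' t\<bar> \<le> M * norm v * I" if t: "t \<in> {0..1}" for t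
  proof -
    define \<psi> where "\<psi> = (\<lambda>x. \<eta> (x - t *\<^sub>R v))"
    have \<psi>: "\<psi> \<in> test_functions \<Omega>" using \<eta>t[OF t] by (simp add: \<psi>_def)
    have d\<psi>: "\<psi> differentiable (at x)" for x by (rule C_diff_differentiable[OF test_functions_smooth[OF \<psi>, of "Suc 0"]])
    note c\<psi> = test_functions_cellwise_continuous[OF \<psi>] test_functions_cellwise_continuous[OF test_functions_grad[OF \<psi>]]
    have "frechet_derivative \<psi> (at x) = frechet_derivative \<eta> (at (x - t *\<^sub>R v))" for x
    proof -
      have "((\<lambda>x. x - t *\<^sub>R v) has_derivative (\<lambda>u. u)) (at x)" by (auto intro!: derivative_eq_intros)
      from diff_chain_at[OF this C_diff_has_derivative[OF test_functions_smooth[OF \<eta>(1), of "Suc 0"]]]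
      have "(\<psi> has_derivative frechet_derivative \<eta> (at (x - t *\<^sub>R v))) (at x)" by (simp add: o_def \<psi>_def)
      then show ?thesis by (simp add: frechet_derivative_eqI fun_eq_iff)
    qed
    then have eq: "f x * frechet_derivative \<eta> (at (x - t *\<^sub>R v)) (- v) = (f x *\<^sub>R grad \<psi> x) \<bullet> (- v)" for x
      using grad_inner[OF d\<psi>, of x "- v"] by (simp only: inner_scaleR_left)
    have int: "integrable (lebesgue_on \<Omega>) (\<lambda>x. f x *\<^sub>R grad \<psi> x)" "integrable (lebesgue_on \<Omega>) (\<lambda>x. \<psi> x *\<^sub>R grad f x)"
      by (intro cellwise_continuous_integrable cellwise_continuous_intros cf cg c\<psi>)
         (intro cellwise_continuous_integrable cellwise_continuous_intros cf cg c\<psi>)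
    have "h' t = (LINT x|lebesgue_on \<Omega>. f x *\<^sub>R grad \<psi> x) \<bullet> (- v)"
      unfolding h'_def eq by (rule integral_inner_left) (use int in simp)
    also have "\<dots> = (LINT x|lebesgue_on \<Omega>. \<psi> x *\<^sub>R grad f x) \<bullet> v"
      using H1_cellwise_grad[OF H1 f \<psi>] by simp
    also have "\<dots> = (LINT x|lebesgue_on \<Omega>. (\<psi> x *\<^sub>R grad f x) \<bullet> v)"
      by (rule integral_inner_left[symmetric]) (use int in simp)
    also have "\<dots> = (LINT x|lebesgue_on \<Omega>. (grad f x \<bullet> v) * \<psi> x)" by (simp add: mult.commute)
    finally have "h' t = (LINT x|lebesgue_on \<Omega>. (grad f x \<bullet> v) * \<psi> x)" .
    moreover have "\<bar>LINT x|lebesgue_on \<Omega>. (grad f x \<bullet> v) * \<psi> x\<bar> \<le> M * norm v * (LINT x|lebesgue_on \<Omega>. \<psi> x)"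
    proof (rule weighted_integral_bound[OF \<psi>])
      show "0 \<le> \<psi> x" for x using \<eta>(2) by (simp add: \<psi>_def)
      show "cellwise_continuous \<T> (\<lambda>x. grad f x \<bullet> v)" by (intro cellwise_continuous_intros cg)
      fix K x assume "K \<in> \<T>" "x \<in> interior K"
      from M[OF this] have "norm (grad f x) * norm v \<le> M * norm v" by (rule mult_right_mono) simp
      then show "\<bar>grad f x \<bullet> v\<bar> \<le> M * norm v" using Cauchy_Schwarz_ineq2 order_trans by blast
    qed
    ultimately show ?thesis using It[OF t] by (simp add: \<psi>_def)
  qed
  have "\<exists>t. 0 < t \<and> t < 1 \<and> h 1 - h 0 = (1 - 0) * h' t"
    by (rule MVT2) (auto intro: h)
  then obtain t where "0 < t" "t < 1" "h 1 - h 0 = h' t" by auto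
  then have hdiff: "\<bar>h 1 - h 0\<bar> \<le> M * norm v * I" using h'b[of t] by simp
  have end_bound: "\<bar>h t - f w * I\<bar> \<le> \<epsilon> / 2 * I"
    if t: "t \<in> {0..1}" and w: "\<forall>x\<in>ball w \<delta>. \<bar>f x - f w\<bar> \<le> \<epsilon> / 2" "w = y + t *\<^sub>R v" for t w
  proof -
    note c = test_functions_cellwise_continuous[OF \<eta>t[OF t]]
    have int: "integrable (lebesgue_on \<Omega>) (\<lambda>x. f x * \<eta> (x - t *\<^sub>R v))" "integrable (lebesgue_on \<Omega>) (\<lambda>x. f w * \<eta> (x - t *\<^sub>R v))"
      by (intro cellwise_continuous_integrable cellwise_continuous_intros cf c)
         (intro cellwise_continuous_integrable cellwise_continuous_intros cf c)
    have "h t - f w * I = (LINT x|lebesgue_on \<Omega>. (f x - f w) * \<eta> (x - t *\<^sub>R v))"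
      using int It[OF t] by (simp add: h_def Rings.left_diff_distrib)
    moreover have "\<bar>LINT x|lebesgue_on \<Omega>. (f x - f w) * \<eta> (x - t *\<^sub>R v)\<bar> \<le> \<epsilon> / 2 * (LINT x|lebesgue_on \<Omega>. \<eta> (x - t *\<^sub>R v))"
    proof (rule weighted_integral_bound[OF \<eta>t[OF t]])
      show "0 \<le> \<eta> (x - t *\<^sub>R v)" for x by (rule \<eta>(2))
      show "cellwise_continuous \<T> (\<lambda>x. f x - f w)" by (intro cellwise_continuous_intros cf)
      fix x assume "\<eta> (x - t *\<^sub>R v) \<noteq> 0"
      then have "x - t *\<^sub>R v \<in> ball y \<delta>" using test_functions_zero[OF \<eta>(1)] by blast
      then have "x \<in> ball w \<delta>" by (simp add: w(2) dist_norm algebra_simps)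
      then show "\<bar>f x - f w\<bar> \<le> \<epsilon> / 2" using w(1) by blast
    qed
    ultimately show ?thesis using It[OF t] by simp
  qed
  have "\<bar>h 0 - f y * I\<bar> \<le> \<epsilon> / 2 * I" by (rule end_bound) (use \<delta>1 in \<open>auto simp: \<delta>_def\<close>)
  moreover have "\<bar>h 1 - f z * I\<bar> \<le> \<epsilon> / 2 * I" by (rule end_bound) (use \<delta>2 in \<open>auto simp: \<delta>_def v_def\<close>)
  ultimately have "\<bar>f z * I - f y * I\<bar> \<le> M * norm v * I + \<epsilon> * I" using hdiff by linarith
  then have "\<bar>f z - f y\<bar> * I \<le> (M * norm v + \<epsilon>) * I"
    using I by (simp add: Rings.left_diff_distrib[symmetric] abs_mult distrib_right)
  then show "\<bar>f z - f y\<bar> \<le> M * norm (z - y) + \<epsilon>" using I by (simp add: v_def)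
qed

lemma cell_trace_smooth:
  assumes "K \<in> \<T>" "x \<in> K" "C_diff 0 p" "\<And>y. y \<in> interior K \<Longrightarrow> f y = p y"
  shows "cell_trace K f x = p x"
  by (rule cell_trace_eq[OF cell_convex[OF assms(1)] cell_interior[OF assms(1)] assms(2) _ assms(4)])
     (use assms(3) in \<open>auto intro: continuous_on_subset\<close>)

lemma H1_traces_agree:
  assumes H1: "f \<in> H1 \<Omega>" and f: "cellwise_smooth \<T> f"
    and K: "K \<in> \<T>" "x \<in> K" and L: "L \<in> \<T>" "x \<in> L" and x: "x \<in> \<Omega>"
  shows "cell_trace K f x = cell_trace L f x"
proof -
  obtain M where M: "\<And>K x. K \<in> \<T> \<Longrightarrow> x \<in> interior K \<Longrightarrow> norm (grad f x) \<le> M"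
    using cellwise_continuous_bounded[OF cellwise_smooth_continuous[OF cellwise_smooth_grad[OF f]]] by metis
  obtain r where r: "r > 0" "ball x r \<subseteq> \<Omega>" using open_dom x open_contains_ball by metis
  have seq: "\<exists>y. (\<forall>n::nat. y n \<in> interior J \<inter> ball x r) \<and> y \<longlonglongrightarrow> x" if J: "J \<in> \<T>" "x \<in> J" for J
  proof -
    have "x \<in> closure (interior J)"
      using J convex_closure_interior[OF cell_convex[OF J(1)] cell_interior[OF J(1)]] closure_subset by blast
    then obtain y where y: "\<And>n. y n \<in> interior J" "y \<longlonglongrightarrow> x" unfolding closure_sequential by metis
    have "\<forall>\<^sub>F n in sequentially. y n \<in> ball x r"
      using y(2) r(1) by (intro topological_tendstoD) auto
    then obtain N where N: "\<And>n. n \<ge> N \<Longrightarrow> y n \<in> ball x r" unfolding eventually_sequentially by blast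
    show ?thesis
      by (rule exI[of _ "\<lambda>n. y (n + N)"]) (use y N LIMSEQ_ignore_initial_segment[OF y(2)] in auto)
  qed
  obtain y z where y: "\<And>n::nat. y n \<in> interior K \<inter> ball x r" "y \<longlonglongrightarrow> x"
    and z: "\<And>n::nat. z n \<in> interior L \<inter> ball x r" "z \<longlonglongrightarrow> x"
    using seq[OF K] seq[OF L] by metis
  obtain p where p: "\<And>r. C_diff r p" "\<And>x. x \<in> interior K \<Longrightarrow> f x = p x" using cellwise_smoothE[OF f K(1)] by metis
  obtain q where q: "\<And>r. C_diff r q" "\<And>x. x \<in> interior L \<Longrightarrow> f x = q x" using cellwise_smoothE[OF f L(1)] by metis
  have lim: "(\<lambda>n. p (y n)) \<longlonglongrightarrow> p x" "(\<lambda>n. q (z n)) \<longlonglongrightarrow> q x"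
    using y(2) z(2) C_diff_continuous[OF p(1)] C_diff_continuous[OF q(1)]
    by (auto simp: continuous_on_eq_continuous_at intro: isCont_tendsto_compose)
  have "\<bar>q (z n) - p (y n)\<bar> \<le> M * norm (z n - y n)" for n
  proof -
    have "\<bar>f (z n) - f (y n)\<bar> \<le> M * norm (z n - y n)"
      by (rule H1_Lipschitz_between_cells[OF H1 f _ convex_ball open_ball r(2) K(1) y(1) L(1) z(1)]) (rule M)
    then show ?thesis using p(2)[of "y n"] q(2)[of "z n"] y(1)[of n] z(1)[of n] by simp
  qed
  moreover have "(\<lambda>n. \<bar>q (z n) - p (y n)\<bar>) \<longlonglongrightarrow> \<bar>q x - p x\<bar>" by (intro tendsto_intros lim)
  moreover have "(\<lambda>n. M * norm (z n - y n)) \<longlonglongrightarrow> M * norm (x - x)" by (intro tendsto_intros y z)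
  ultimately have "\<bar>q x - p x\<bar> \<le> M * norm (x - x)" using LIMSEQ_le by blast
  then have "q x = p x" by simp
  then show ?thesis
    using cell_trace_smooth[OF K p(1) p(2)] cell_trace_smooth[OF L q(1) q(2)] by simp
qed

end


section \<open>Facets and boundary conditions\<close>

lemma cross3_eq_0_imp_parallel:
  fixes n c :: "real^3"
  assumes "cross3 n c = 0" "c \<noteq> 0"
  obtains \<alpha> where "n = \<alpha> *\<^sub>R c"
proof -
  have "cross3 c (cross3 n c) = (c \<bullet> c) *\<^sub>R n - (c \<bullet> n) *\<^sub>R c"
    by (simp add: cross3_simps forall_3)
  then have "(c \<bullet> c) *\<^sub>R n = (c \<bullet> n) *\<^sub>R c" using assms(1) by simp
  then have "inverse (c \<bullet> c) *\<^sub>R ((c \<bullet> c) *\<^sub>R n) = inverse (c \<bullet> c) *\<^sub>R ((c \<bullet> n) *\<^sub>R c)" by simp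
  then have "n = ((c \<bullet> n) / (c \<bullet> c)) *\<^sub>R c" using assms(2) by (simp add: divide_inverse mult.commute)
  then show ?thesis by (rule that)
qed

lemma orthogonal_imp_cross3_eq_0:
  fixes n a b :: "real^3"
  assumes "n \<bullet> a = 0" "n \<bullet> b = 0"
  shows "cross3 n (cross3 a b) = 0"
proof -
  have "cross3 n (cross3 a b) = (n \<bullet> b) *\<^sub>R a - (n \<bullet> a) *\<^sub>R b"
    by (simp add: cross3_simps forall_3)
  then show ?thesis using assms by simp
qed

lemma planar_spanning_points:
  fixes F :: "(real^3) set"
  assumes "aff_dim F = 2" "x \<in> F"
  obtains y z where "y \<in> F" "z \<in> F" "cross3 (y - x) (z - x) \<noteq> 0"
proof -
  have nc: "\<not> collinear F" using assms(1) by (simp add: collinear_aff_dim)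
  have "F \<noteq> {x}" using nc by auto
  then obtain y where y: "y \<in> F" "y \<noteq> x" using assms(2) by blast
  have "\<exists>z\<in>F. cross3 (y - x) (z - x) \<noteq> 0"
  proof (rule ccontr)
    assume "\<not> ?thesis"
    then have par: "\<exists>\<alpha>. z - x = \<alpha> *\<^sub>R (y - x)" if "z \<in> F" for z
      using that y(2) cross3_eq_0_imp_parallel[of "z - x" "y - x"] cross_skew[of "z - x" "y - x"]
      by (metis eq_iff_diff_eq_0 neg_0_equal_iff_equal)
    have "collinear F" unfolding collinear_def
    proof (rule exI[of _ "y - x"], intro ballI)
      fix z w assume "z \<in> F" "w \<in> F"
      then obtain \<alpha> \<beta> where "z - x = \<alpha> *\<^sub>R (y - x)" "w - x = \<beta> *\<^sub>R (y - x)" using par by metis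
      then have "(z - x) - (w - x) = (\<alpha> - \<beta>) *\<^sub>R (y - x)" by (simp only: scaleR_diff_left)
      then have "z - w = (\<alpha> - \<beta>) *\<^sub>R (y - x)" by simp
      then show "\<exists>c. z - w = c *\<^sub>R (y - x)" by blast
    qed
    then show False using nc by blast
  qed
  then show ?thesis using that y(1) by blast
qed

lemma aff_dim_facet:
  fixes K :: "(real^3) set"
  assumes "interior K \<noteq> {}" "F facet_of K" shows "aff_dim F = 2"
  using assms aff_dim_nonempty_interior[of K] by (simp add: facet_of_def)

text \<open>The definite description in the definition is meaningful: a supporting hyperplane that exposes
  the facet gives existence; three points of the facet determine the direction up to sign, and an
  interior point of the cell determines the sign.\<close>

lemma outward_normal_facet:
  fixes K F :: "(real^3) set"
  assumes K: "polytope K" "interior K \<noteq> {}" and F: "F facet_of K"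
  shows "norm (outward_normal K F) = 1"
    and "\<And>x y. x \<in> F \<Longrightarrow> y \<in> F \<Longrightarrow> outward_normal K F \<bullet> (x - y) = 0"
proof -
  define P where "P n \<longleftrightarrow> norm n = 1 \<and> (\<forall>x\<in>K. \<forall>y\<in>F. n \<bullet> (x - y) \<le> 0)" for n :: "real^3"
  have FK: "F face_of K" "F \<subseteq> K" "F \<noteq> {}" using F facet_of_imp_subset by (auto simp: facet_of_def)
  have dimF: "aff_dim F = 2" by (rule aff_dim_facet[OF K(2) F])
  have "F \<noteq> K" using F facet_of_irrefl by metis
  have "F exposed_face_of K"
    using FK(1) exposed_face_of_polyhedron[OF polytope_imp_polyhedron[OF K(1)]] by simp
  then obtain a b where ab: "K \<subseteq> {x. a \<bullet> x \<le> b}" "F = K \<inter> {x. a \<bullet> x = b}"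
    unfolding exposed_face_of_def by blast
  have "a \<noteq> 0" using ab FK(3) \<open>F \<noteq> K\<close> by auto
  have ex: "P (inverse (norm a) *\<^sub>R a)"
    unfolding P_def
  proof (intro conjI ballI)
    show "norm (inverse (norm a) *\<^sub>R a) = 1" using \<open>a \<noteq> 0\<close> by simp
    fix x y assume "x \<in> K" "y \<in> F"
    then have "a \<bullet> (x - y) \<le> 0" using ab by (auto simp: inner_diff_right)
    then show "inverse (norm a) *\<^sub>R a \<bullet> (x - y) \<le> 0" by (simp add: mult_nonneg_nonpos)
  qed
  obtain y0 where y0: "y0 \<in> F" using FK(3) by blast
  obtain y1 y2 where y12: "y1 \<in> F" "y2 \<in> F" "cross3 (y1 - y0) (y2 - y0) \<noteq> 0"
    using planar_spanning_points[OF dimF y0] .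
  define c where "c = cross3 (y1 - y0) (y2 - y0)"
  obtain x0 where x0: "x0 \<in> interior K" using K(2) by blast
  have orth: "n \<bullet> (x - y) = 0" if "P n" "x \<in> F" "y \<in> F" for n x y
  proof -
    have "n \<bullet> (x - y) \<le> 0" "n \<bullet> (y - x) \<le> 0" using that FK(2) unfolding P_def by blast+
    then show ?thesis by (simp add: inner_diff_right)
  qed
  have par: "\<exists>\<alpha>. n = \<alpha> *\<^sub>R c" if "P n" for n
  proof -
    have "cross3 n c = 0"
      unfolding c_def by (rule orthogonal_imp_cross3_eq_0) (use orth[OF that] y0 y12 in auto)
    then show ?thesis using cross3_eq_0_imp_parallel[of n c] y12(3) unfolding c_def by metis
  qed
  have neg: "n \<bullet> (x0 - y0) < 0" if Pn: "P n" for n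
  proof -
    have n1: "n \<bullet> n = 1" using Pn by (simp add: P_def norm_eq_1)
    obtain r where r: "r > 0" "ball x0 r \<subseteq> K" using x0 mem_interior by blast
    have "norm n = 1" using Pn by (simp add: P_def)
    then have "x0 + (r/2) *\<^sub>R n \<in> ball x0 r" using r(1) by (simp add: dist_norm)
    then have "n \<bullet> (x0 + (r/2) *\<^sub>R n - y0) \<le> 0" using Pn r(2) y0 unfolding P_def by blast
    then have "n \<bullet> (x0 - y0) + r/2 \<le> 0" using n1 by (simp add: inner_diff_right inner_add_right)
    then show ?thesis using r(1) by simp
  qed
  have unique: "n = m" if Pn: "P n" and Pm: "P m" for n m
  proof -
    obtain \<alpha> \<beta> where \<alpha>: "n = \<alpha> *\<^sub>R c" and \<beta>: "m = \<beta> *\<^sub>R c" using par[OF Pn] par[OF Pm] by blast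
    have "\<bar>\<alpha>\<bar> * norm c = 1" "\<bar>\<beta>\<bar> * norm c = 1" using Pn Pm \<alpha> \<beta> by (simp_all add: P_def)
    then have "\<bar>\<alpha>\<bar> * norm c = \<bar>\<beta>\<bar> * norm c" "norm c \<noteq> 0" by auto
    then have abs: "\<bar>\<alpha>\<bar> = \<bar>\<beta>\<bar>" by simp
    have "\<alpha> * (c \<bullet> (x0 - y0)) < 0" "\<beta> * (c \<bullet> (x0 - y0)) < 0"
      using neg[OF Pn] neg[OF Pm] \<alpha> \<beta> by simp_all
    then have "\<alpha> = \<beta>" using abs by (auto simp: abs_if mult_less_0_iff split: if_splits)
    then show ?thesis using \<alpha> \<beta> by simp
  qed
  have "P (THE n. P n)" by (rule theI[of P]) (use ex unique in blast)+
  moreover have "outward_normal K F = (THE n. P n)"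
    unfolding outward_normal_def P_def ..
  ultimately have "P (outward_normal K F)" by simp
  then show "norm (outward_normal K F) = 1" "\<And>x y. x \<in> F \<Longrightarrow> y \<in> F \<Longrightarrow> outward_normal K F \<bullet> (x - y) = 0"
    using orth unfolding P_def by blast+
qed

text \<open>The segment towards \<open>y\<close> stays in \<open>F\<close>, so the one-sided difference quotients vanish; this
  covers points on the relative boundary of \<open>F\<close>.\<close>

lemma tangential_derivative_eq_0:
  fixes f :: "real^3 \<Rightarrow> real"
  assumes F: "convex F" "x \<in> F" "y \<in> F" "\<And>z. z \<in> F \<Longrightarrow> f z = 0" and f: "C_diff (Suc 0) f"
  shows "frechet_derivative f (at x) (y - x) = 0"
proof -
  define X where "X n = 1 / real (Suc n)" for n
  have X: "X \<longlonglongrightarrow> 0" "\<And>n. X n > 0" "\<And>n. X n \<le> 1"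
    unfolding X_def by (rule LIMSEQ_Suc[OF lim_1_over_n]) auto
  have "((\<lambda>s. (f (x + s *\<^sub>R (y - x)) - f x) / s) \<longlongrightarrow> frechet_derivative f (at x) (y - x)) (at 0)"
    using C_diff_line_derivative[OF f, of x "y - x" 0] by (simp add: has_field_derivative_iff)
  then have "(\<lambda>n. (f (x + X n *\<^sub>R (y - x)) - f x) / X n) \<longlonglongrightarrow> frechet_derivative f (at x) (y - x)"
    using X(1) X(2) unfolding tendsto_at_iff_sequentially by (simp add: o_def less_imp_neq[symmetric])
  moreover have "f (x + X n *\<^sub>R (y - x)) = 0" for n
  proof -
    have "(1 - X n) *\<^sub>R x + X n *\<^sub>R y \<in> F"
      using F(1-3) X(2)[of n] X(3)[of n] by (intro convexD) auto
    then show ?thesis using F(4) by (simp add: algebra_simps)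
  qed
  ultimately show ?thesis using F(2,4) by (simp add: LIMSEQ_const_iff)
qed

lemma curl_inner_cross:
  assumes "f differentiable (at x)"
  shows "curl f x \<bullet> cross3 a b = frechet_derivative f (at x) a \<bullet> b - frechet_derivative f (at x) b \<bullet> a"
proof -
  have lin: "linear (frechet_derivative f (at x))" using assms by (rule linear_frechet_derivative)
  have D: "frechet_derivative f (at x) v = (\<Sum>i\<in>UNIV. v $ i *\<^sub>R pderiv_at i f x)" for v
  proof -
    have v: "v = (\<Sum>i\<in>UNIV. v $ i *\<^sub>R axis i 1)"
      using basis_expansion[of v] by (simp add: scalar_mult_eq_scaleR)
    have "frechet_derivative f (at x) (\<Sum>i\<in>UNIV. v $ i *\<^sub>R axis i 1) = (\<Sum>i\<in>UNIV. v $ i *\<^sub>R pderiv_at i f x)"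
      by (simp add: linear_sum[OF lin] linear_scale[OF lin])
    then show ?thesis using v by simp
  qed
  show ?thesis
    by (simp add: D[of a] D[of b] sum_3 inner_vec_def cross3_def curl_eq_components algebra_simps)
qed

section \<open>The discrete spaces\<close>

lemma cellwise_smooth_polys: "cellwise \<T> (polys k) f \<Longrightarrow> cellwise_smooth \<T> f"
  unfolding cellwise_smooth_def by (erule cellwise_mono) (auto intro: C_diff_polys)

lemma cellwise_smooth_N_local: "cellwise \<T> (N_local k) f \<Longrightarrow> cellwise_smooth \<T> f"
  unfolding cellwise_smooth_def by (erule cellwise_mono) (auto intro: C_diff_vpolys N_local_vpolys)

lemma cellwise_smooth_RT_local: "cellwise \<T> (RT_local k) f \<Longrightarrow> cellwise_smooth \<T> f"
  unfolding cellwise_smooth_def by (erule cellwise_mono) (auto intro: C_diff_vpolys RT_local_vpolys)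

lemma smooth_Q: "f \<in> Q_space \<Omega> \<T> k \<Longrightarrow> cellwise_smooth \<T> f"
  and smooth_N: "v \<in> N_space \<Omega> \<T> k \<Longrightarrow> cellwise_smooth \<T> v"
  and smooth_RT: "v \<in> RT_space \<Omega> \<T> k \<Longrightarrow> cellwise_smooth \<T> v"
  and smooth_DG: "f \<in> DG_space \<Omega> \<T> k \<Longrightarrow> cellwise_smooth \<T> f"
  by (auto simp: Q_space_def N_space_def RT_space_def DG_space_def
      intro: cellwise_smooth_polys cellwise_smooth_N_local cellwise_smooth_RT_local)

lemma cellwise_combine:
  assumes "cellwise \<T> P f" "cellwise \<T> P g" "\<And>p q. p \<in> P \<Longrightarrow> q \<in> P \<Longrightarrow> (\<lambda>x. h (p x) (q x)) \<in> P"
  shows "cellwise \<T> P (\<lambda>x. h (f x) (g x))"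
  unfolding cellwise_def
proof
  fix K assume "K \<in> \<T>"
  then obtain p q where "p \<in> P" "\<forall>x\<in>interior K. f x = p x" "q \<in> P" "\<forall>x\<in>interior K. g x = q x"
    using assms(1,2) unfolding cellwise_def by meson
  then show "\<exists>p\<in>P. \<forall>x\<in>interior K. h (f x) (g x) = p x"
    using assms(3)[of p q] by (intro bexI[of _ "\<lambda>x. h (p x) (q x)"]) auto
qed

lemma L2_linear:
  fixes f g :: "real^3 \<Rightarrow> 'b::euclidean_space"
  assumes "f \<in> L2 \<Omega>" "g \<in> L2 \<Omega>" shows "(\<lambda>x. a *\<^sub>R f x + b *\<^sub>R g x) \<in> L2 \<Omega>"
proof -
  have m: "f \<in> borel_measurable (lebesgue_on \<Omega>)" "g \<in> borel_measurable (lebesgue_on \<Omega>)"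
    and i: "integrable (lebesgue_on \<Omega>) (\<lambda>x. (norm (f x))\<^sup>2)" "integrable (lebesgue_on \<Omega>) (\<lambda>x. (norm (g x))\<^sup>2)"
    using assms by (auto simp: L2_def)
  have "integrable (lebesgue_on \<Omega>) (\<lambda>x. (norm (a *\<^sub>R f x + b *\<^sub>R g x))\<^sup>2)"
  proof (rule Bochner_Integration.integrable_bound)
    show "integrable (lebesgue_on \<Omega>) (\<lambda>x. 2 * a\<^sup>2 * (norm (f x))\<^sup>2 + 2 * b\<^sup>2 * (norm (g x))\<^sup>2)"
      using i by simp
    show "(\<lambda>x. (norm (a *\<^sub>R f x + b *\<^sub>R g x))\<^sup>2) \<in> borel_measurable (lebesgue_on \<Omega>)" using m by simp
    show "AE x in lebesgue_on \<Omega>. norm ((norm (a *\<^sub>R f x + b *\<^sub>R g x))\<^sup>2)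
            \<le> norm (2 * a\<^sup>2 * (norm (f x))\<^sup>2 + 2 * b\<^sup>2 * (norm (g x))\<^sup>2)"
    proof (intro AE_I2)
      fix x
      have "(norm (u + w))\<^sup>2 \<le> 2 * (norm u)\<^sup>2 + 2 * (norm w)\<^sup>2" for u w :: 'b
      proof -
        have "0 \<le> (norm (u - w))\<^sup>2" by simp
        then show ?thesis unfolding power2_norm_eq_inner by (simp add: algebra_simps inner_commute)
      qed
      from this[of "a *\<^sub>R f x" "b *\<^sub>R g x"]
      show "norm ((norm (a *\<^sub>R f x + b *\<^sub>R g x))\<^sup>2) \<le> norm (2 * a\<^sup>2 * (norm (f x))\<^sup>2 + 2 * b\<^sup>2 * (norm (g x))\<^sup>2)"
        by (simp add: power_mult_distrib)
    qed
  qed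
  then show ?thesis using m by (simp add: L2_def)
qed

context fe_mesh
begin

lemma has_weak_curl_linear:
  assumes "f \<in> L2 \<Omega>" "g \<in> L2 \<Omega>" "has_weak_curl \<Omega> f f'" "has_weak_curl \<Omega> g g'"
  shows "has_weak_curl \<Omega> (\<lambda>x. a *\<^sub>R f x + b *\<^sub>R g x) (\<lambda>x. a *\<^sub>R f' x + b *\<^sub>R g' x)"
  unfolding has_weak_curl_def
proof (intro conjI ballI)
  have L: "f' \<in> L2 \<Omega>" "g' \<in> L2 \<Omega>" using assms(3,4) by (simp_all add: has_weak_curl_def)
  then show "(\<lambda>x. a *\<^sub>R f' x + b *\<^sub>R g' x) \<in> L2 \<Omega>" by (rule L2_linear)
  fix \<psi> :: "real^3 \<Rightarrow> real^3" assume \<psi>: "\<psi> \<in> test_functions \<Omega>"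
  show "(LINT x|lebesgue_on \<Omega>. (a *\<^sub>R f x + b *\<^sub>R g x) \<bullet> curl \<psi> x)
      = (LINT x|lebesgue_on \<Omega>. (a *\<^sub>R f' x + b *\<^sub>R g' x) \<bullet> \<psi> x)"
    using integrable_bilinear_test[OF bounded_bilinear_inner L2_integrable[OF assms(1)] test_functions_curl[OF \<psi>]]
      integrable_bilinear_test[OF bounded_bilinear_inner L2_integrable[OF assms(2)] test_functions_curl[OF \<psi>]]
      integrable_bilinear_test[OF bounded_bilinear_inner L2_integrable[OF L(1)] \<psi>] integrable_bilinear_test[OF bounded_bilinear_inner L2_integrable[OF L(2)] \<psi>]
      assms(3,4) \<psi> by (simp add: inner_add_left has_weak_curl_def)
qed

lemma has_weak_div_linear:
  assumes "f \<in> L2 \<Omega>" "g \<in> L2 \<Omega>" "has_weak_div \<Omega> f f'" "has_weak_div \<Omega> g g'"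
  shows "has_weak_div \<Omega> (\<lambda>x. a *\<^sub>R f x + b *\<^sub>R g x) (\<lambda>x. a *\<^sub>R f' x + b *\<^sub>R g' x)"
  unfolding has_weak_div_def
proof (intro conjI ballI)
  have L: "f' \<in> L2 \<Omega>" "g' \<in> L2 \<Omega>" using assms(3,4) by (simp_all add: has_weak_div_def)
  then show "(\<lambda>x. a *\<^sub>R f' x + b *\<^sub>R g' x) \<in> L2 \<Omega>" by (rule L2_linear)
  fix \<psi> :: "real^3 \<Rightarrow> real" assume \<psi>: "\<psi> \<in> test_functions \<Omega>"
  have i: "integrable (lebesgue_on \<Omega>) (\<lambda>x. f' x * \<psi> x)" "integrable (lebesgue_on \<Omega>) (\<lambda>x. g' x * \<psi> x)"
    using integrable_bilinear_test[OF bounded_bilinear_inner L2_integrable[OF L(1)] \<psi>] integrable_bilinear_test[OF bounded_bilinear_inner L2_integrable[OF L(2)] \<psi>] by (simp_all add: inner_real_def)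
  show "(LINT x|lebesgue_on \<Omega>. (a *\<^sub>R f x + b *\<^sub>R g x) \<bullet> grad \<psi> x)
      = - (LINT x|lebesgue_on \<Omega>. (a *\<^sub>R f' x + b *\<^sub>R g' x) * \<psi> x)"
    using integrable_bilinear_test[OF bounded_bilinear_inner L2_integrable[OF assms(1)] test_functions_grad[OF \<psi>]]
      integrable_bilinear_test[OF bounded_bilinear_inner L2_integrable[OF assms(2)] test_functions_grad[OF \<psi>]]
      i assms(3,4) \<psi> by (simp add: inner_add_left has_weak_div_def distrib_right mult.assoc)
qed

lemma cell_trace_linear:
  fixes f g :: "real^3 \<Rightarrow> 'b::real_normed_vector"
  assumes "cellwise_smooth \<T> f" "cellwise_smooth \<T> g" "K \<in> \<T>" "x \<in> K"
  shows "cell_trace K (\<lambda>x. a *\<^sub>R f x + b *\<^sub>R g x) x = a *\<^sub>R cell_trace K f x + b *\<^sub>R cell_trace K g x"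
proof -
  obtain p where p: "\<And>r. C_diff r p" "\<And>x. x \<in> interior K \<Longrightarrow> f x = p x"
    using cellwise_smoothE[OF assms(1,3)] by metis
  obtain q where q: "\<And>r. C_diff r q" "\<And>x. x \<in> interior K \<Longrightarrow> g x = q x"
    using cellwise_smoothE[OF assms(2,3)] by metis
  have "cell_trace K (\<lambda>x. a *\<^sub>R f x + b *\<^sub>R g x) x = a *\<^sub>R p x + b *\<^sub>R q x"
    by (rule cell_trace_smooth[OF assms(3,4), where p = "\<lambda>x. a *\<^sub>R p x + b *\<^sub>R q x"])
       (intro C_diff_add C_diff_scaleR C_diff_const p(1) q(1), simp add: p(2) q(2))
  then show ?thesis
    using cell_trace_smooth[OF assms(3,4) p(1) p(2)] cell_trace_smooth[OF assms(3,4) q(1) q(2)] by simp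
qed

lemma N0_linear:
  assumes f: "f \<in> N0_space \<Omega> \<T> k" and g: "g \<in> N0_space \<Omega> \<T> k"
  shows "(\<lambda>x. a *\<^sub>R f x + b *\<^sub>R g x) \<in> N0_space \<Omega> \<T> k"
proof -
  have fN: "f \<in> N_space \<Omega> \<T> k" and gN: "g \<in> N_space \<Omega> \<T> k" using f g by (auto simp: N0_space_def)
  note s = smooth_N[OF fN] smooth_N[OF gN]
  obtain f' g' where w: "f \<in> L2 \<Omega>" "g \<in> L2 \<Omega>" "has_weak_curl \<Omega> f f'" "has_weak_curl \<Omega> g g'"
    using fN gN by (auto simp: N_space_def Hcurl_def)
  have "(\<lambda>x. a *\<^sub>R f x + b *\<^sub>R g x) \<in> Hcurl \<Omega>"
    using L2_linear[OF w(1,2)] has_weak_curl_linear[OF w] unfolding Hcurl_def by blast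
  moreover have "cellwise \<T> (N_local k) (\<lambda>x. a *\<^sub>R f x + b *\<^sub>R g x)"
    using fN gN by (intro cellwise_combine[where h = "\<lambda>u v. a *\<^sub>R u + b *\<^sub>R v"])
      (auto simp: N_space_def intro: N_local_add N_local_scale)
  moreover have "cross3 (outward_normal K F) (cell_trace K (\<lambda>x. a *\<^sub>R f x + b *\<^sub>R g x) x) = 0"
    if "K \<in> \<T>" "F facet_of K" "F \<subseteq> frontier \<Omega>" "x \<in> F" for K F x
  proof -
    have "x \<in> K" using that facet_of_imp_subset by blast
    from cell_trace_linear[OF s that(1) this] show ?thesis
      using f g that by (simp add: N0_space_def cross_add_right cross_mult_right)
  qed
  ultimately show ?thesis by (auto simp: N0_space_def N_space_def)
qed

lemma RT_linear:
  assumes f: "f \<in> RT_space \<Omega> \<T> k" and g: "g \<in> RT_space \<Omega> \<T> k"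
  shows "(\<lambda>x. a *\<^sub>R f x + b *\<^sub>R g x) \<in> RT_space \<Omega> \<T> k"
proof -
  obtain f' g' where w: "f \<in> L2 \<Omega>" "g \<in> L2 \<Omega>" "has_weak_div \<Omega> f f'" "has_weak_div \<Omega> g g'"
    using f g by (auto simp: RT_space_def Hdiv_def)
  have "(\<lambda>x. a *\<^sub>R f x + b *\<^sub>R g x) \<in> Hdiv \<Omega>"
    using L2_linear[OF w(1,2)] has_weak_div_linear[OF w] unfolding Hdiv_def by blast
  moreover have "cellwise \<T> (RT_local k) (\<lambda>x. a *\<^sub>R f x + b *\<^sub>R g x)"
    using f g by (intro cellwise_combine[where h = "\<lambda>u v. a *\<^sub>R u + b *\<^sub>R v"])
      (auto simp: RT_space_def intro: RT_local_add RT_local_scale)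
  ultimately show ?thesis by (simp add: RT_space_def)
qed

lemma RT0_linear:
  assumes f: "f \<in> RT0_space \<Omega> \<T> k" and g: "g \<in> RT0_space \<Omega> \<T> k"
  shows "(\<lambda>x. a *\<^sub>R f x + b *\<^sub>R g x) \<in> RT0_space \<Omega> \<T> k"
proof -
  have RT: "f \<in> RT_space \<Omega> \<T> k" "g \<in> RT_space \<Omega> \<T> k" using f g by (auto simp: RT0_space_def)
  have "outward_normal K F \<bullet> cell_trace K (\<lambda>x. a *\<^sub>R f x + b *\<^sub>R g x) x = 0"
    if "K \<in> \<T>" "F facet_of K" "F \<subseteq> frontier \<Omega>" "x \<in> F" for K F x
  proof -
    have "x \<in> K" using that facet_of_imp_subset by blast
    from cell_trace_linear[OF smooth_RT[OF RT(1)] smooth_RT[OF RT(2)] that(1) this] show ?thesis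
      using f g that by (simp add: RT0_space_def inner_add_right)
  qed
  then show ?thesis using RT_linear[OF RT] by (auto simp: RT0_space_def)
qed

lemma DG_linear:
  assumes f: "f \<in> DG_space \<Omega> \<T> k" and g: "g \<in> DG_space \<Omega> \<T> k"
  shows "(\<lambda>x. a * f x + b * g x) \<in> DG_space \<Omega> \<T> k"
proof -
  have "cellwise \<T> (polys k) (\<lambda>x. a * f x + b * g x)"
    using f g by (intro cellwise_combine[where h = "\<lambda>u v. a * u + b * v"])
      (auto simp: DG_space_def intro: polys_add polys_scale)
  moreover have "(\<lambda>x. a * f x + b * g x) \<in> L2 \<Omega>"
    using L2_linear[of f \<Omega> g a b] f g by (simp add: DG_space_def)
  ultimately show ?thesis by (simp add: DG_space_def)
qed

text \<open>Cells that share only an edge or a vertex are included, because a particle may pass from one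
  to the other there. On the boundary of the domain both traces are 0.\<close>

lemma Q0_traces_agree:
  assumes f: "f \<in> Q0_space \<Omega> \<T> k" and K: "K \<in> \<T>" "x \<in> K" and L: "L \<in> \<T>" "x \<in> L"
  shows "cell_trace K f x = cell_trace L f x"
proof (cases "x \<in> \<Omega>")
  case True
  have "f \<in> Q_space \<Omega> \<T> k" using f by (simp add: Q0_space_def)
  then show ?thesis using H1_traces_agree[OF _ smooth_Q K L True] by (simp add: Q_space_def)
next
  case False
  have "x \<in> closure \<Omega>" using K cells_cover by blast
  then have "x \<in> frontier \<Omega>" using False open_dom by (simp add: frontier_def interior_open)
  then show ?thesis using f K L by (simp add: Q0_space_def)
qed

text \<open>A function that vanishes on a boundary facet has no tangential derivatives there, so its
  gradient is normal to the facet.\<close>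

lemma grad_in_N0:
  assumes f: "f \<in> Q0_space \<Omega> \<T> (Suc k)" shows "grad f \<in> N0_space \<Omega> \<T> k"
proof -
  have Q: "f \<in> H1 \<Omega>" "cellwise \<T> (polys (Suc k)) f" using f by (simp_all add: Q0_space_def Q_space_def)
  have s: "cellwise_smooth \<T> f" using cellwise_smooth_polys[OF Q(2)] .
  have "grad f \<in> L2 \<Omega>"
    by (intro cellwise_continuous_L2 cellwise_smooth_continuous cellwise_smooth_grad s)
  then have "grad f \<in> Hcurl \<Omega>" using grad_has_weak_curl_0[OF Q(1) s] unfolding Hcurl_def by blast
  moreover have "cellwise \<T> (N_local k) (grad f)"
    unfolding cellwise_def
  proof
    fix K assume K: "K \<in> \<T>"
    obtain p where p: "p \<in> polys (Suc k)" "\<forall>x\<in>interior K. f x = p x" using Q(2) K unfolding cellwise_def by blast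
    have "grad p \<in> N_local k"
      by (rule vpolys_N_local) (simp add: vpolys_def grad_def polys_frechet_derivative[OF p(1)])
    moreover have "\<forall>x\<in>interior K. grad f x = grad p x"
      using p(2) grad_cell[of K f p] C_diff_differentiable[OF C_diff_polys[OF p(1), of "Suc 0"]] by blast
    ultimately show "\<exists>p\<in>N_local k. \<forall>x\<in>interior K. grad f x = p x" by blast
  qed
  moreover have "cross3 (outward_normal K F) (cell_trace K (grad f) x) = 0"
    if K: "K \<in> \<T>" and F: "F facet_of K" "F \<subseteq> frontier \<Omega>" and x: "x \<in> F" for K F x
  proof -
    obtain p where p: "\<And>r. C_diff r p" "\<And>x. x \<in> interior K \<Longrightarrow> f x = p x"
      using cellwise_smoothE[OF s K] by metis
    have dp: "p differentiable (at y)" for y by (rule C_diff_differentiable[OF p(1)[of "Suc 0"]])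
    have FK: "F \<subseteq> K" using F(1) by (rule facet_of_imp_subset)
    have "convex F" using F(1) facet_of_imp_face_of face_of_imp_convex by blast
    have p0: "p y = 0" if "y \<in> F" for y
    proof -
      have "p y = cell_trace K f y" using cell_trace_smooth[OF K _ p(1) p(2)] FK that by force
      also have "\<dots> = 0" using f K FK F(2) that by (auto simp: Q0_space_def)
      finally show ?thesis .
    qed
    have tr: "cell_trace K (grad f) x = grad p x"
      by (rule cell_trace_smooth[OF K _ C_diff_grad[OF p(1)]])
         (use FK x grad_cell[OF p(2) _ dp] in auto)
    obtain y z where yz: "y \<in> F" "z \<in> F" "cross3 (y - x) (z - x) \<noteq> 0"
      using planar_spanning_points[OF aff_dim_facet[OF cell_interior[OF K] F(1)] x] .
    have "grad p x \<bullet> (w - x) = 0" if "w \<in> F" for w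
      using grad_inner[OF dp] tangential_derivative_eq_0[OF \<open>convex F\<close> x that p0 p(1)] by simp
    then have 1: "cross3 (grad p x) (cross3 (y - x) (z - x)) = 0" using yz by (intro orthogonal_imp_cross3_eq_0) auto
    have 2: "cross3 (outward_normal K F) (cross3 (y - x) (z - x)) = 0"
      using outward_normal_facet(2)[OF cell_polytope[OF K] cell_interior[OF K] F(1)] yz x
      by (intro orthogonal_imp_cross3_eq_0) auto
    obtain \<alpha> \<beta> where "grad p x = \<alpha> *\<^sub>R cross3 (y - x) (z - x)" "outward_normal K F = \<beta> *\<^sub>R cross3 (y - x) (z - x)"
      using cross3_eq_0_imp_parallel[OF 1 yz(3)] cross3_eq_0_imp_parallel[OF 2 yz(3)] by metis
    then show ?thesis unfolding tr by (simp add: cross_mult_left cross_mult_right)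
  qed
  ultimately show ?thesis by (auto simp: N0_space_def N_space_def)
qed

text \<open>The normal component of a curl on a facet is made of tangential derivatives of tangential
  components, and the tangential components vanish on the boundary facets.\<close>

lemma curl_in_RT0:
  assumes f: "f \<in> N0_space \<Omega> \<T> k" shows "curl f \<in> RT0_space \<Omega> \<T> k"
proof -
  have N: "f \<in> Hcurl \<Omega>" "cellwise \<T> (N_local k) f" using f by (simp_all add: N0_space_def N_space_def)
  have s: "cellwise_smooth \<T> f" using cellwise_smooth_N_local[OF N(2)] .
  have "curl f \<in> L2 \<Omega>"
    by (intro cellwise_continuous_L2 cellwise_smooth_continuous cellwise_smooth_curl s)
  then have "curl f \<in> Hdiv \<Omega>" using curl_has_weak_div_0[OF N(1) s] unfolding Hdiv_def by blast
  moreover have "cellwise \<T> (RT_local k) (curl f)"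
    unfolding cellwise_def
  proof
    fix K assume K: "K \<in> \<T>"
    obtain p where p: "p \<in> N_local k" "\<forall>x\<in>interior K. f x = p x" using N(2) K unfolding cellwise_def by blast
    have pv: "p \<in> vpolys (Suc k)" by (rule N_local_vpolys[OF p(1)])
    have dp: "p differentiable (at x)" for x
      by (rule C_diff_differentiable[OF C_diff_vpolys[OF pv, of "Suc 0"]])
    have d: "(\<lambda>x. pderiv_at i p x $ j) \<in> polys k" for i j
    proof -
      have "(\<lambda>x. p x $ j) \<in> polys (Suc k)" using pv by (simp add: vpolys_def)
      from polys_frechet_derivative[OF this, of "axis i 1"]
      show ?thesis by (simp add: frechet_derivative_component[OF dp])
    qed
    have dd: "(\<lambda>x. pderiv_at i p x $ j - pderiv_at i' p x $ j') \<in> polys k" for i j i' j'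
      using polys_add[OF d polys_scale[OF d, of "-1"]] by simp
    have "curl p \<in> RT_local k"
      by (rule vpolys_RT_local) (simp add: vpolys_def forall_3 curl_eq_components dd)
    moreover have "\<forall>x\<in>interior K. curl f x = curl p x"
      using p(2) curl_cell[of K f p] dp by blast
    ultimately show "\<exists>p\<in>RT_local k. \<forall>x\<in>interior K. curl f x = p x" by blast
  qed
  moreover have "outward_normal K F \<bullet> cell_trace K (curl f) x = 0"
    if K: "K \<in> \<T>" and F: "F facet_of K" "F \<subseteq> frontier \<Omega>" and x: "x \<in> F" for K F x
  proof -
    define n where "n = outward_normal K F"
    obtain p where p: "\<And>r. C_diff r p" "\<And>x. x \<in> interior K \<Longrightarrow> f x = p x"
      using cellwise_smoothE[OF s K] by metis
    have dp: "p differentiable (at y)" for y by (rule C_diff_differentiable[OF p(1)[of "Suc 0"]])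
    have FK: "F \<subseteq> K" using F(1) by (rule facet_of_imp_subset)
    have "convex F" using F(1) facet_of_imp_face_of face_of_imp_convex by blast
    have n1: "n \<noteq> 0" and n2: "\<And>x y. x \<in> F \<Longrightarrow> y \<in> F \<Longrightarrow> n \<bullet> (x - y) = 0"
      using outward_normal_facet[OF cell_polytope[OF K] cell_interior[OF K] F(1)] by (auto simp: n_def)
    have pn: "p y \<bullet> (w - x) = 0" if "y \<in> F" "w \<in> F" for y w
    proof -
      have "p y = cell_trace K f y" using cell_trace_smooth[OF K _ p(1) p(2)] FK that by force
      then have "cross3 n (p y) = 0" using f K F that by (auto simp: N0_space_def n_def)
      then have "cross3 (p y) n = 0" using cross_skew[of "p y" n] by simp
      then obtain \<alpha> where "p y = \<alpha> *\<^sub>R n" using cross3_eq_0_imp_parallel[OF _ n1] by metis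
      then show ?thesis using n2[OF that(2) x] by simp
    qed
    have tr: "cell_trace K (curl f) x = curl p x"
      by (rule cell_trace_smooth[OF K _ C_diff_curl[OF p(1)]])
         (use FK x curl_cell[OF p(2) _ dp] in auto)
    obtain y z where yz: "y \<in> F" "z \<in> F" "cross3 (y - x) (z - x) \<noteq> 0"
      using planar_spanning_points[OF aff_dim_facet[OF cell_interior[OF K] F(1)] x] .
    have D: "frechet_derivative p (at x) (v - x) \<bullet> (w - x) = 0" if "v \<in> F" "w \<in> F" for v w
    proof -
      have "((\<lambda>y. p y \<bullet> (w - x)) has_derivative (\<lambda>u. frechet_derivative p (at x) u \<bullet> (w - x))) (at x)"
        using C_diff_has_derivative[OF p(1)] by (intro has_derivative_inner_left)
      then have "frechet_derivative p (at x) (v - x) \<bullet> (w - x) = frechet_derivative (\<lambda>y. p y \<bullet> (w - x)) (at x) (v - x)"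
        by (simp add: frechet_derivative_eqI)
      also have "\<dots> = 0"
        by (rule tangential_derivative_eq_0[OF \<open>convex F\<close> x that(1)])
           (use pn that(2) C_diff_inner[OF p(1) C_diff_const] in auto)
      finally show ?thesis .
    qed
    have "curl p x \<bullet> cross3 (y - x) (z - x) = 0"
      unfolding curl_inner_cross[OF dp] using D yz by simp
    moreover have "cross3 n (cross3 (y - x) (z - x)) = 0"
      using n2 yz x by (intro orthogonal_imp_cross3_eq_0) auto
    then obtain \<beta> where "n = \<beta> *\<^sub>R cross3 (y - x) (z - x)"
      using cross3_eq_0_imp_parallel[OF _ yz(3)] by metis
    ultimately show ?thesis unfolding tr n_def[symmetric] by (simp add: inner_commute)
  qed
  ultimately show ?thesis by (auto simp: RT0_space_def RT_space_def)
qed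

end


section \<open>The discrete weak divergence\<close>

text \<open>Representation of a linear functional on a space of functions that is finite-dimensional up
  to functions vanishing on \<open>D\<close>. The induction removes one function of the spanning family; it
  splits off the orthogonal projection of a single element of \<open>V\<close> that uses this function.\<close>

lemma finite_dimensional_representation:
  fixes ip :: "('a \<Rightarrow> real) \<Rightarrow> ('a \<Rightarrow> real) \<Rightarrow> real" and b :: "'i \<Rightarrow> 'a \<Rightarrow> real"
  assumes I: "finite I"
    and W: "\<And>f g a c. f \<in> W \<Longrightarrow> g \<in> W \<Longrightarrow> (\<lambda>x. a * f x + c * g x) \<in> W"
    and sym: "\<And>f g. f \<in> W \<Longrightarrow> g \<in> W \<Longrightarrow> ip f g = ip g f"
    and lin: "\<And>f g h a c. f \<in> W \<Longrightarrow> g \<in> W \<Longrightarrow> h \<in> W \<Longrightarrow>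
                 ip h (\<lambda>x. a * f x + c * g x) = a * ip h f + c * ip h g"
    and definite: "\<And>f x. f \<in> W \<Longrightarrow> ip f f = 0 \<Longrightarrow> x \<in> D \<Longrightarrow> f x = 0"
    and null: "\<And>f g. f \<in> W \<Longrightarrow> g \<in> W \<Longrightarrow> (\<And>x. x \<in> D \<Longrightarrow> f x = 0) \<Longrightarrow> ip g f = 0"
    and V: "V \<subseteq> W" "V \<noteq> {}" "\<And>f g a c. f \<in> V \<Longrightarrow> g \<in> V \<Longrightarrow> (\<lambda>x. a * f x + c * g x) \<in> V"
    and span: "\<And>f. f \<in> V \<Longrightarrow> \<exists>c. \<forall>x\<in>D. f x = (\<Sum>i\<in>I. c i * b i x)"
    and \<Lambda>lin: "\<And>f g a c. f \<in> V \<Longrightarrow> g \<in> V \<Longrightarrow> \<Lambda> (\<lambda>x. a * f x + c * g x) = a * \<Lambda> f + c * \<Lambda> g"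
    and \<Lambda>null: "\<And>f. f \<in> V \<Longrightarrow> (\<And>x. x \<in> D \<Longrightarrow> f x = 0) \<Longrightarrow> \<Lambda> f = (0::real)"
  shows "\<exists>d\<in>V. \<forall>f\<in>V. ip d f = \<Lambda> f"
  using I V span \<Lambda>lin \<Lambda>null
proof (induction I arbitrary: V \<Lambda> rule: finite_induct)
  case empty
  obtain d where d: "d \<in> V" using empty.prems(2) by blast
  have "ip d f = \<Lambda> f" if f: "f \<in> V" for f
  proof -
    have z: "f x = 0" if "x \<in> D" for x using empty.prems(4)[OF f] that by auto
    have "ip d f = 0" by (rule null) (use f d z empty.prems(1) in auto)
    moreover have "\<Lambda> f = 0" by (rule empty.prems(6)[OF f]) (rule z)
    ultimately show ?thesis by simp
  qed
  then show ?case using d by blast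
next
  case (insert j I)
  note VW = insert.prems(1) and Vlin = insert.prems(3) and Vspan = insert.prems(4)
    and Llin = insert.prems(5) and Lnull = insert.prems(6)
  define V' where "V' = {f\<in>V. \<exists>c. \<forall>x\<in>D. f x = (\<Sum>i\<in>I. c i * b i x)}"
  have V'V: "V' \<subseteq> V" and V'W: "V' \<subseteq> W" using VW by (auto simp: V'_def)
  obtain f1 where f1: "f1 \<in> V" using insert.prems(2) by blast
  have "(\<lambda>x. 0 * f1 x + 0 * f1 x) \<in> V" using Vlin[OF f1 f1] .
  then have "(\<lambda>x. 0) \<in> V'" unfolding V'_def by (auto intro: exI[of _ "\<lambda>_. 0"])
  then have V'ne: "V' \<noteq> {}" by blast
  have V'lin: "(\<lambda>x. a * f x + c * g x) \<in> V'" if fg: "f \<in> V'" "g \<in> V'" for f g a c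
  proof -
    obtain p q where pq: "\<forall>x\<in>D. f x = (\<Sum>i\<in>I. p i * b i x)" "\<forall>x\<in>D. g x = (\<Sum>i\<in>I. q i * b i x)"
      using fg unfolding V'_def by blast
    then have "\<forall>x\<in>D. a * f x + c * g x = (\<Sum>i\<in>I. (a * p i + c * q i) * b i x)"
      by (simp add: sum.distrib sum_distrib_left algebra_simps)
    moreover have "f \<in> V" "g \<in> V" using fg V'V by blast+
    then have "(\<lambda>x. a * f x + c * g x) \<in> V" by (rule Vlin)
    ultimately show ?thesis
      unfolding V'_def by (intro CollectI conjI exI[of _ "\<lambda>i. a * p i + c * q i"])
  qed
  have rep: "\<exists>d\<in>V'. \<forall>f\<in>V'. ip d f = \<Lambda>' f"
    if "\<And>f g a c. f \<in> V' \<Longrightarrow> g \<in> V' \<Longrightarrow> \<Lambda>' (\<lambda>x. a * f x + c * g x) = a * \<Lambda>' f + c * \<Lambda>' g"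
      and "\<And>f. f \<in> V' \<Longrightarrow> (\<And>x. x \<in> D \<Longrightarrow> f x = 0) \<Longrightarrow> \<Lambda>' f = 0" for \<Lambda>'
    by (rule insert.IH[OF V'W V'ne V'lin _ that]) (auto simp: V'_def)
  have "\<exists>d\<in>V'. \<forall>f\<in>V'. ip d f = \<Lambda> f"
  proof (rule rep)
    show "\<Lambda> (\<lambda>x. a * f x + c * g x) = a * \<Lambda> f + c * \<Lambda> g" if "f \<in> V'" "g \<in> V'" for f g a c
      by (rule Llin) (use that V'V in auto)
    show "\<Lambda> f = 0" if "f \<in> V'" "\<And>x. x \<in> D \<Longrightarrow> f x = 0" for f
      by (rule Lnull) (use that V'V in auto)
  qed
  then obtain d0 where d0: "d0 \<in> V'" "\<And>f. f \<in> V' \<Longrightarrow> ip d0 f = \<Lambda> f" by blast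
  show ?case
  proof (cases "V' = V")
    case True
    then show ?thesis using d0 by blast
  next
    case False
    then obtain f0 where f0: "f0 \<in> V" "f0 \<notin> V'" using V'V by blast
    obtain c0 where c0: "\<forall>x\<in>D. f0 x = (\<Sum>i\<in>insert j I. c0 i * b i x)" using Vspan[OF f0(1)] by blast
    have c0j: "c0 j \<noteq> 0"
    proof
      assume "c0 j = 0"
      then have "\<forall>x\<in>D. f0 x = (\<Sum>i\<in>I. c0 i * b i x)" using c0 insert.hyps by simp
      then show False using f0 unfolding V'_def by blast
    qed
    \<comment> \<open>Subtracting a multiple of \<open>f0\<close> removes the coefficient of \<open>b j\<close>.\<close>
    have split: "\<exists>t. \<exists>f'\<in>V'. f = (\<lambda>x. 1 * f' x + t * f0 x)" if f: "f \<in> V" for f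
    proof -
      obtain c where c: "\<forall>x\<in>D. f x = (\<Sum>i\<in>insert j I. c i * b i x)" using Vspan[OF f] by blast
      define t where "t = c j / c0 j"
      have "f x - t * f0 x = (\<Sum>i\<in>I. (c i - t * c0 i) * b i x)" if "x \<in> D" for x
      proof -
        have "f x - t * f0 x = (\<Sum>i\<in>insert j I. c i * b i x) - t * (\<Sum>i\<in>insert j I. c0 i * b i x)"
          using c c0 that by simp
        also have "\<dots> = (\<Sum>i\<in>insert j I. (c i - t * c0 i) * b i x)"
          by (simp only: sum_distrib_left sum_subtractf[symmetric] algebra_simps)
        also have "\<dots> = (\<Sum>i\<in>I. (c i - t * c0 i) * b i x)"
          using insert.hyps c0j by (simp add: t_def)
        finally show ?thesis .
      qed
      moreover have "(\<lambda>x. 1 * f x + (- t) * f0 x) \<in> V" using Vlin[OF f f0(1)] .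
      ultimately have "(\<lambda>x. 1 * f x + (- t) * f0 x) \<in> V'"
        unfolding V'_def by (intro CollectI conjI exI[of _ "\<lambda>i. c i - t * c0 i"]) auto
      then show ?thesis
        by (intro exI[of _ t] bexI[of _ "\<lambda>x. 1 * f x + (- t) * f0 x"]) auto
    qed
    have f0W: "f0 \<in> W" using f0(1) VW by blast
    have "\<exists>d\<in>V'. \<forall>f\<in>V'. ip d f = ip f0 f"
    proof (rule rep)
      show "ip f0 (\<lambda>x. a * f x + c * g x) = a * ip f0 f + c * ip f0 g" if "f \<in> V'" "g \<in> V'" for f g a c
        by (rule lin) (use that V'W f0W in auto)
      show "ip f0 f = 0" if "f \<in> V'" "\<And>x. x \<in> D \<Longrightarrow> f x = 0" for f
        by (rule null) (use that V'W f0W in auto)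
    qed
    then obtain q where q: "q \<in> V'" "\<And>f. f \<in> V' \<Longrightarrow> ip q f = ip f0 f" by blast
    \<comment> \<open>The part of \<open>f0\<close> orthogonal to \<open>V'\<close>.\<close>
    define r where "r = (\<lambda>x. 1 * f0 x + (-1) * q x)"
    have rV: "r \<in> V" unfolding r_def by (rule Vlin[OF f0(1)]) (use q V'V in blast)
    have rW: "r \<in> W" using rV VW by blast
    have lin': "ip (\<lambda>x. a * f x + c * g x) h = a * ip f h + c * ip g h" if "f \<in> W" "g \<in> W" "h \<in> W" for f g h a c
      using lin[OF that, of a c] sym[OF W[OF that(1,2)] that(3)] sym[OF that(1,3)] sym[OF that(2,3)] by simp
    have r0: "ip r f = 0" if "f \<in> V'" for f
    proof -
      have "ip r f = 1 * ip f0 f + (-1) * ip q f"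
        unfolding r_def by (rule lin') (use that q(1) V'W f0W in auto)
      then show ?thesis using q(2)[OF that] by simp
    qed
    have f0r: "f0 = (\<lambda>x. 1 * q x + 1 * r x)" by (simp add: r_def)
    have q': "q \<in> W" "q \<in> V" "d0 \<in> W" "d0 \<in> V" using q(1) d0(1) V'W V'V by blast+
    have \<Lambda>f0: "\<Lambda> f0 = \<Lambda> q + \<Lambda> r" using Llin[OF q'(2) rV, of 1 1] unfolding f0r[symmetric] by simp
    have ipf0: "ip h f0 = ip h q + ip h r" if "h \<in> W" for h
      using lin[OF q'(1) rW that, of 1 1] unfolding f0r[symmetric] by simp
    have combine: "\<exists>d\<in>V. \<forall>f\<in>V. ip d f = \<Lambda> f"
      if d: "d \<in> V" "\<And>f. f \<in> V' \<Longrightarrow> ip d f = \<Lambda> f" "ip d r = \<Lambda> r" for d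
    proof (rule bexI[OF _ d(1)], rule ballI)
      fix f assume "f \<in> V"
      then obtain t f' where f': "f' \<in> V'" "f = (\<lambda>x. 1 * f' x + t * f0 x)" using split by blast
      have w: "d \<in> W" "f' \<in> W" "f' \<in> V" using d(1) f'(1) VW V'V by blast+
      have "ip d f = ip d f' + t * ip d f0" unfolding f'(2) using lin[OF w(2) f0W w(1), of 1 t] by simp
      also have "\<dots> = \<Lambda> f' + t * (\<Lambda> q + \<Lambda> r)" using ipf0[OF w(1)] d(2)[OF f'(1)] d(2)[OF q(1)] d(3) by simp
      also have "\<dots> = \<Lambda> f" unfolding f'(2) using Llin[OF w(3) f0(1), of 1 t] \<Lambda>f0 by simp
      finally show "ip d f = \<Lambda> f" .
    qed
    show ?thesis
    proof (cases "ip r r = 0")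
      case True
      have z: "r x = 0" if "x \<in> D" for x using definite[OF rW True that] .
      have "ip d0 r = 0" by (rule null[OF rW q'(3)]) (rule z)
      moreover have "\<Lambda> r = 0" by (rule Lnull[OF rV]) (rule z)
      ultimately show ?thesis using combine[OF q'(4) d0(2)] by simp
    next
      case False
      define s where "s = (\<Lambda> r - ip d0 r) / ip r r"
      have e: "ip (\<lambda>x. 1 * d0 x + s * r x) h = ip d0 h + s * ip r h" if "h \<in> W" for h
        using lin'[OF q'(3) rW that, of 1 s] by simp
      show ?thesis
      proof (rule combine)
        show "(\<lambda>x. 1 * d0 x + s * r x) \<in> V" by (rule Vlin[OF q'(4) rV])
        show "ip (\<lambda>x. 1 * d0 x + s * r x) f = \<Lambda> f" if "f \<in> V'" for f
          using e[of f] that V'W d0(2) r0 by auto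
        show "ip (\<lambda>x. 1 * d0 x + s * r x) r = \<Lambda> r" using e[OF rW] False by (simp add: s_def)
      qed
    qed
  qed
qed

context fe_mesh
begin

lemma cellwise_smooth_square_integral_0:
  fixes f :: "real^3 \<Rightarrow> 'b::euclidean_space"
  assumes f: "cellwise_smooth \<T> f" and 0: "(LINT x|lebesgue_on \<Omega>. (norm (f x))\<^sup>2) = 0"
    and K: "K \<in> \<T>" "x \<in> interior K"
  shows "f x = 0"
proof -
  obtain p where p: "\<And>r. C_diff r p" "\<And>x. x \<in> interior K \<Longrightarrow> f x = p x" using cellwise_smoothE[OF f K(1)] by metis
  have int: "integrable (lebesgue_on \<Omega>) (\<lambda>x. (norm (f x))\<^sup>2)"
    by (intro cellwise_continuous_integrable cellwise_continuous_norm cellwise_smooth_continuous f)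
  define A where "A = interior K \<inter> {x. norm (p x) > 0}"
  have "AE x in lebesgue_on \<Omega>. (norm (f x))\<^sup>2 = 0"
    using 0 integral_nonneg_eq_0_iff_AE[OF int] by simp
  then have "AE x in lebesgue. x \<in> \<Omega> \<longrightarrow> f x = 0" by (simp add: AE_restrict_space_iff)
  then have "AE x in lebesgue. x \<notin> A"
    by eventually_elim (use p(2) interior_cell_subset[OF K(1)] in \<open>auto simp: A_def\<close>)
  moreover have "open A"
    unfolding A_def using C_diff_continuous[OF p(1)[of 0]]
    by (intro open_Int open_interior open_Collect_less continuous_intros)
  ultimately have "negligible A"
    by (simp add: negligible_iff_null_sets completion.AE_iff_null_sets[symmetric] AE_iff_null_sets)
  then have "A = {}" using \<open>open A\<close> open_not_negligible by blast
  then show ?thesis using K(2) p(2) by (auto simp: A_def)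
qed

lemma Q0_linear:
  assumes f: "f \<in> Q0_space \<Omega> \<T> k" and g: "g \<in> Q0_space \<Omega> \<T> k"
  shows "(\<lambda>x. a * f x + b * g x) \<in> Q0_space \<Omega> \<T> k"
proof -
  have fQ: "f \<in> Q_space \<Omega> \<T> k" and gQ: "g \<in> Q_space \<Omega> \<T> k" using f g by (auto simp: Q0_space_def)
  note s = smooth_Q[OF fQ] smooth_Q[OF gQ]
  note c = cellwise_smooth_continuous[OF s(1)] cellwise_smooth_continuous[OF s(2)]
    cellwise_smooth_continuous[OF cellwise_smooth_grad[OF s(1)]] cellwise_smooth_continuous[OF cellwise_smooth_grad[OF s(2)]]
  have H: "f \<in> H1 \<Omega>" "g \<in> H1 \<Omega>" using fQ gQ by (auto simp: Q_space_def)
  have "has_weak_grad \<Omega> (\<lambda>x. a * f x + b * g x) (\<lambda>x. a *\<^sub>R grad f x + b *\<^sub>R grad g x)"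
    unfolding has_weak_grad_def
  proof (intro conjI ballI)
    show "(\<lambda>x. a *\<^sub>R grad f x + b *\<^sub>R grad g x) \<in> L2 \<Omega>"
      by (intro cellwise_continuous_L2 cellwise_continuous_intros c)
    fix \<psi> :: "real^3 \<Rightarrow> real" assume \<psi>: "\<psi> \<in> test_functions \<Omega>"
    note t = test_functions_cellwise_continuous[OF \<psi>] test_functions_cellwise_continuous[OF test_functions_grad[OF \<psi>]]
    have i: "integrable (lebesgue_on \<Omega>) (\<lambda>x. a *\<^sub>R (f x *\<^sub>R grad \<psi> x))" "integrable (lebesgue_on \<Omega>) (\<lambda>x. b *\<^sub>R (g x *\<^sub>R grad \<psi> x))"
      "integrable (lebesgue_on \<Omega>) (\<lambda>x. a *\<^sub>R (\<psi> x *\<^sub>R grad f x))" "integrable (lebesgue_on \<Omega>) (\<lambda>x. b *\<^sub>R (\<psi> x *\<^sub>R grad g x))"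
      by (rule cellwise_continuous_integrable, intro cellwise_continuous_intros c t)+
    have "(LINT x|lebesgue_on \<Omega>. (a * f x + b * g x) *\<^sub>R grad \<psi> x)
        = (LINT x|lebesgue_on \<Omega>. a *\<^sub>R (f x *\<^sub>R grad \<psi> x)) + (LINT x|lebesgue_on \<Omega>. b *\<^sub>R (g x *\<^sub>R grad \<psi> x))"
      by (simp only: Bochner_Integration.integral_add[OF i(1,2), symmetric]) (simp add: scaleR_add_left)
    also have "\<dots> = - ((LINT x|lebesgue_on \<Omega>. a *\<^sub>R (\<psi> x *\<^sub>R grad f x)) + (LINT x|lebesgue_on \<Omega>. b *\<^sub>R (\<psi> x *\<^sub>R grad g x)))"
      using H1_cellwise_grad[OF H(1) s(1) \<psi>] H1_cellwise_grad[OF H(2) s(2) \<psi>] by (simp del: scaleR_scaleR)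
    also have "\<dots> = - (LINT x|lebesgue_on \<Omega>. \<psi> x *\<^sub>R (a *\<^sub>R grad f x + b *\<^sub>R grad g x))"
      by (simp only: Bochner_Integration.integral_add[OF i(3,4), symmetric]) (simp add: scaleR_add_right mult.commute)
    finally show "(LINT x|lebesgue_on \<Omega>. (a * f x + b * g x) *\<^sub>R grad \<psi> x)
      = - (LINT x|lebesgue_on \<Omega>. \<psi> x *\<^sub>R (a *\<^sub>R grad f x + b *\<^sub>R grad g x))" .
  qed
  moreover have "(\<lambda>x. a * f x + b * g x) \<in> L2 \<Omega>"
    by (intro cellwise_continuous_L2 cellwise_continuous_intros c)
  ultimately have "(\<lambda>x. a * f x + b * g x) \<in> H1 \<Omega>" unfolding H1_def by blast
  moreover have "cellwise \<T> (polys k) (\<lambda>x. a * f x + b * g x)"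
    using fQ gQ by (intro cellwise_combine[where h = "\<lambda>u v. a * u + b * v"])
      (auto simp: Q_space_def intro: polys_add polys_scale)
  moreover have "cell_trace K (\<lambda>x. a * f x + b * g x) x = 0" if "K \<in> \<T>" "x \<in> K" "x \<in> frontier \<Omega>" for K x
    using cell_trace_linear[OF s that(1,2), of a b] f g that by (simp add: Q0_space_def)
  ultimately show ?thesis by (auto simp: Q0_space_def Q_space_def)
qed

lemma zero_in_Q0: "(\<lambda>x. 0) \<in> Q0_space \<Omega> \<T> k"
proof -
  have "has_weak_grad \<Omega> (\<lambda>x. 0) (\<lambda>x. 0)"
    using cellwise_continuous_L2[OF cellwise_continuous_const[of _ "0 :: real^3"]] by (simp add: has_weak_grad_def)
  then have "(\<lambda>x. 0) \<in> H1 \<Omega>"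
    using cellwise_continuous_L2[OF cellwise_continuous_const[of _ "0 :: real"]] unfolding H1_def by blast
  moreover have "cellwise \<T> (polys k) (\<lambda>x. 0)" unfolding cellwise_def
    by (intro ballI bexI[of _ "\<lambda>x. 0"]) (auto intro: polys_zero)
  moreover have "cell_trace K (\<lambda>x. 0 :: real) x = 0" if "K \<in> \<T>" "x \<in> K" for K x
    by (rule cell_trace_smooth[OF that C_diff_const]) simp
  ultimately show ?thesis by (auto simp: Q0_space_def Q_space_def)
qed

text \<open>A functional of the gradient respects equality in the open cells, and there the space is
  spanned by the finitely many monomials of the cells.\<close>

lemma discrete_div_exists:
  assumes E: "cellwise_continuous \<T> E"
  shows "\<exists>d\<in>Q0_space \<Omega> \<T> k. \<forall>\<phi>\<in>Q0_space \<Omega> \<T> k.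
     (LINT x|lebesgue_on \<Omega>. d x * \<phi> x) = - (LINT x|lebesgue_on \<Omega>. E x \<bullet> grad \<phi> x)"
proof -
  define D where "D = (\<Union>K\<in>\<T>. interior K)"
  define I where "I = \<T> \<times> {\<alpha> :: 3 \<Rightarrow> nat. (\<Sum>i\<in>UNIV. \<alpha> i) \<le> k}"
  define b where "b j x = indicator (interior (fst j)) x * monomial (snd j) x" for j :: "(real^3) set \<times> (3 \<Rightarrow> nat)" and x
  let ?V = "Q0_space \<Omega> \<T> k"
  have s: "cellwise_smooth \<T> f" if "f \<in> ?V" for f using that smooth_Q by (auto simp: Q0_space_def)
  have c: "cellwise_continuous \<T> f" "cellwise_continuous \<T> (grad f)" if "f \<in> ?V" for f
    using cellwise_smooth_continuous[OF s[OF that]] cellwise_smooth_continuous[OF cellwise_smooth_grad[OF s[OF that]]] by simp_all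
  have "\<exists>d\<in>?V. \<forall>f\<in>?V. (LINT x|lebesgue_on \<Omega>. d x * f x) = - (LINT x|lebesgue_on \<Omega>. E x \<bullet> grad f x)"
  proof (rule finite_dimensional_representation[where W = ?V and D = D and I = I and b = b])
    show "finite I" unfolding I_def by (intro finite_cartesian_product finite_cells finite_multi_indices)
    show "(\<lambda>x. a * f x + c * g x) \<in> ?V" if "f \<in> ?V" "g \<in> ?V" for f g a c by (rule Q0_linear[OF that])
    then show "(\<lambda>x. a * f x + c * g x) \<in> ?V" if "f \<in> ?V" "g \<in> ?V" for f g a c using that by blast
    show "?V \<subseteq> ?V" "?V \<noteq> {}" using zero_in_Q0 by blast+
    show "(LINT x|lebesgue_on \<Omega>. f x * g x) = (LINT x|lebesgue_on \<Omega>. g x * f x)" for f g :: "real^3 \<Rightarrow> real"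
      by (simp add: mult.commute)
    show "(LINT x|lebesgue_on \<Omega>. h x * (a * f x + c * g x)) = a * (LINT x|lebesgue_on \<Omega>. h x * f x) + c * (LINT x|lebesgue_on \<Omega>. h x * g x)"
      if "f \<in> ?V" "g \<in> ?V" "h \<in> ?V" for f g h a c
    proof -
      have "integrable (lebesgue_on \<Omega>) (\<lambda>x. h x * f x)" "integrable (lebesgue_on \<Omega>) (\<lambda>x. h x * g x)"
        by (rule cellwise_continuous_integrable, intro cellwise_continuous_intros c that)+
      then show ?thesis by (simp add: distrib_left mult.left_commute[of "h _"])
    qed
    show "f x = 0" if f: "f \<in> ?V" and 0: "(LINT x|lebesgue_on \<Omega>. f x * f x) = 0" and x: "x \<in> D" for f x
      using cellwise_smooth_square_integral_0[OF s[OF f]] 0 x by (auto simp: D_def power2_eq_square)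
    show "(LINT x|lebesgue_on \<Omega>. g x * f x) = 0" if "f \<in> ?V" "g \<in> ?V" "\<And>x. x \<in> D \<Longrightarrow> f x = 0" for f g
      using cellwise_continuous_LINT_cong[of "\<lambda>x. g x * f x" "\<lambda>x. 0"] that(3)
        cellwise_continuous_intros(5)[OF c(1)[OF that(2)] c(1)[OF that(1)]] by (auto simp: D_def)
    show "\<exists>a. \<forall>x\<in>D. f x = (\<Sum>j\<in>I. a j * b j x)" if f: "f \<in> ?V" for f
    proof -
      have "\<exists>a. \<forall>x\<in>interior K. f x = (\<Sum>\<alpha> | (\<Sum>i\<in>UNIV. \<alpha> i) \<le> k. a \<alpha> * monomial \<alpha> x)" if "K \<in> \<T>" for K
      proof -
        obtain p where p: "p \<in> polys k" "\<forall>x\<in>interior K. f x = p x"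
          using f \<open>K \<in> \<T>\<close> by (auto simp: Q0_space_def Q_space_def cellwise_def)
        obtain a where "p = (\<lambda>x. \<Sum>\<alpha> | (\<Sum>i\<in>UNIV. \<alpha> i) \<le> k. a \<alpha> * monomial \<alpha> x)"
          using p(1) unfolding polys_iff by blast
        then show ?thesis using p(2) by (intro exI[of _ a]) simp
      qed
      then have "\<exists>a. \<forall>K\<in>\<T>. \<forall>x\<in>interior K. f x = (\<Sum>\<alpha> | (\<Sum>i\<in>UNIV. \<alpha> i) \<le> k. a K \<alpha> * monomial \<alpha> x)"
        by (intro bchoice ballI)
      then obtain a where a: "\<And>K x. K \<in> \<T> \<Longrightarrow> x \<in> interior K \<Longrightarrow> f x = (\<Sum>\<alpha> | (\<Sum>i\<in>UNIV. \<alpha> i) \<le> k. a K \<alpha> * monomial \<alpha> x)"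
        by blast
      have "f x = (\<Sum>j\<in>I. a (fst j) (snd j) * b j x)" if x: "x \<in> D" for x
      proof -
        obtain K where K: "K \<in> \<T>" "x \<in> interior K" using x by (auto simp: D_def)
        have "(\<Sum>j\<in>I. a (fst j) (snd j) * b j x)
            = (\<Sum>L\<in>\<T>. \<Sum>\<alpha> | (\<Sum>i\<in>UNIV. \<alpha> i) \<le> k. a L \<alpha> * (indicator (interior L) x * monomial \<alpha> x))"
          unfolding I_def b_def by (simp add: sum.cartesian_product split_beta)
        also have "\<dots> = (\<Sum>L\<in>\<T>. if L = K then f x else 0)"
        proof (rule sum.cong[OF refl])
          fix L assume L: "L \<in> \<T>"
          show "(\<Sum>\<alpha> | (\<Sum>i\<in>UNIV. \<alpha> i) \<le> k. a L \<alpha> * (indicator (interior L) x * monomial \<alpha> x)) = (if L = K then f x else 0)"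
          proof (cases "L = K")
            case True
            then show ?thesis using K a[OF K] by (simp add: indicator_def)
          next
            case False
            then have "x \<notin> interior L" using cells_disjoint[OF L K(1)] K(2) by blast
            then show ?thesis using False by simp
          qed
        qed
        also have "\<dots> = f x" using K finite_cells by simp
        finally show ?thesis by simp
      qed
      then show ?thesis by (intro exI[of _ "\<lambda>j. a (fst j) (snd j)"]) blast
    qed
    show "- (LINT x|lebesgue_on \<Omega>. E x \<bullet> grad (\<lambda>x. a * f x + c * g x) x)
        = a * - (LINT x|lebesgue_on \<Omega>. E x \<bullet> grad f x) + c * - (LINT x|lebesgue_on \<Omega>. E x \<bullet> grad g x)"
      if fg: "f \<in> ?V" "g \<in> ?V" for f g a c
    proof -
      have i: "integrable (lebesgue_on \<Omega>) (\<lambda>x. E x \<bullet> grad f x)" "integrable (lebesgue_on \<Omega>) (\<lambda>x. E x \<bullet> grad g x)"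
        by (rule cellwise_continuous_integrable, intro cellwise_continuous_intros E c fg)+
      have "(LINT x|lebesgue_on \<Omega>. E x \<bullet> grad (\<lambda>x. a * f x + c * g x) x)
          = (LINT x|lebesgue_on \<Omega>. a * (E x \<bullet> grad f x) + c * (E x \<bullet> grad g x))"
      proof (rule cellwise_continuous_LINT_cong)
        show "cellwise_continuous \<T> (\<lambda>x. E x \<bullet> grad (\<lambda>x. a * f x + c * g x) x)"
          by (intro cellwise_continuous_intros E c(2) Q0_linear[OF fg])
        fix K x assume K: "K \<in> \<T>" "x \<in> interior K"
        obtain p where p: "\<And>r. C_diff r p" "\<And>x. x \<in> interior K \<Longrightarrow> f x = p x" using cellwise_smoothE[OF s[OF fg(1)] K(1)] by metis
        obtain q where q: "\<And>r. C_diff r q" "\<And>x. x \<in> interior K \<Longrightarrow> g x = q x" using cellwise_smoothE[OF s[OF fg(2)] K(1)] by metis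
        note d = C_diff_differentiable[OF p(1)[of "Suc 0"]] C_diff_differentiable[OF q(1)[of "Suc 0"]]
        have der: "((\<lambda>x. a * p x + c * q x) has_derivative (\<lambda>v. a * frechet_derivative p (at x) v + c * frechet_derivative q (at x) v)) (at x)"
          by (intro has_derivative_add has_derivative_mult_right C_diff_has_derivative p q)
        have "grad (\<lambda>x. a * f x + c * g x) x = grad (\<lambda>x. a * p x + c * q x) x"
          by (rule grad_cell[of K]) (use K p(2) q(2) differentiableI[OF der] in auto)
        also have "\<dots> = a *\<^sub>R grad p x + c *\<^sub>R grad q x"
          by (simp add: grad_def vec_eq_iff frechet_derivative_eqI[OF der])
        also have "\<dots> = a *\<^sub>R grad f x + c *\<^sub>R grad g x"
          using grad_cell[OF p(2) K(2) d(1)] grad_cell[OF q(2) K(2) d(2)] by simp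
        finally show "E x \<bullet> grad (\<lambda>x. a * f x + c * g x) x = a * (E x \<bullet> grad f x) + c * (E x \<bullet> grad g x)"
          by (simp add: inner_add_right)
      qed
      then show ?thesis using i by simp
    qed
    show "- (LINT x|lebesgue_on \<Omega>. E x \<bullet> grad f x) = 0" if f: "f \<in> ?V" and 0: "\<And>x. x \<in> D \<Longrightarrow> f x = 0" for f
    proof -
      have "(LINT x|lebesgue_on \<Omega>. E x \<bullet> grad f x) = (LINT x|lebesgue_on \<Omega>. 0)"
      proof (rule cellwise_continuous_LINT_cong)
        show "cellwise_continuous \<T> (\<lambda>x. E x \<bullet> grad f x)" by (intro cellwise_continuous_intros E c f)
        fix K x assume K: "K \<in> \<T>" "x \<in> interior K"
        have "grad f x = grad (\<lambda>x. 0) x"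
          by (rule grad_cell[of K]) (use K 0 in \<open>auto simp: D_def\<close>)
        then show "E x \<bullet> grad f x = 0" by (simp add: grad_def inner_vec_def)
      qed
      then show ?thesis by simp
    qed
  qed
  then show ?thesis .
qed

lemma discrete_div_properties:
  assumes "cellwise_continuous \<T> E"
  shows "discrete_div \<Omega> \<T> k E \<in> Q0_space \<Omega> \<T> (k + 1)"
    and "\<And>\<phi>. \<phi> \<in> Q0_space \<Omega> \<T> (k + 1) \<Longrightarrow>
      (LINT x|lebesgue_on \<Omega>. discrete_div \<Omega> \<T> k E x * \<phi> x) = - (LINT x|lebesgue_on \<Omega>. E x \<bullet> grad \<phi> x)"
proof -
  have "\<exists>d. d \<in> Q0_space \<Omega> \<T> (k + 1) \<and> (\<forall>\<phi>\<in>Q0_space \<Omega> \<T> (k + 1).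
     (LINT x|lebesgue_on \<Omega>. d x * \<phi> x) = - (LINT x|lebesgue_on \<Omega>. E x \<bullet> grad \<phi> x))"
    using discrete_div_exists[OF assms] by blast
  from someI_ex[OF this] show "discrete_div \<Omega> \<T> k E \<in> Q0_space \<Omega> \<T> (k + 1)"
    and "\<And>\<phi>. \<phi> \<in> Q0_space \<Omega> \<T> (k + 1) \<Longrightarrow>
      (LINT x|lebesgue_on \<Omega>. discrete_div \<Omega> \<T> k E x * \<phi> x) = - (LINT x|lebesgue_on \<Omega>. E x \<bullet> grad \<phi> x)"
    unfolding discrete_div_def by blast+
qed

end


section \<open>Exact integration in time\<close>

lemma interp_0 [simp]: "interp 0 u u' = u'" and interp_1 [simp]: "interp 1 u u' = u"
  by (simp_all add: interp_def)

lemma interp_has_vector_derivative: "((\<lambda>\<xi>. interp \<xi> u u') has_vector_derivative (u - u')) (at \<xi> within A)"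
  unfolding interp_def by (auto intro!: derivative_eq_intros)

lemma interp_has_field_derivative:
  "((\<lambda>\<xi>. interp \<xi> u u') has_field_derivative (u - u')) (at \<xi> within A)" for u u' :: real
  using interp_has_vector_derivative by (simp add: has_real_derivative_iff_has_vector_derivative)

lemma interp_square_has_field_derivative:
  fixes u u' :: "'b::real_inner"
  shows "((\<lambda>\<xi>. interp \<xi> u u' \<bullet> interp \<xi> u u') has_field_derivative (2 * (interp \<xi> u u' \<bullet> (u - u')))) (at \<xi> within A)"
proof -
  have "((\<lambda>\<xi>. interp \<xi> u u' \<bullet> interp \<xi> u u') has_vector_derivative
     (interp \<xi> u u' \<bullet> (u - u') + (u - u') \<bullet> interp \<xi> u u')) (at \<xi> within A)"
    by (rule bounded_bilinear.has_vector_derivative[OF bounded_bilinear_inner])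
       (rule interp_has_vector_derivative)+
  then show ?thesis by (simp add: has_real_derivative_iff_has_vector_derivative inner_commute)
qed

lemma continuous_on_interp:
  fixes f g :: "'a::topological_space \<Rightarrow> 'b::real_normed_vector"
  shows "continuous_on A f \<Longrightarrow> continuous_on A g \<Longrightarrow> continuous_on A h \<Longrightarrow> continuous_on A (\<lambda>x. interp (h x) (f x) (g x))"
  unfolding interp_def by (intro continuous_intros)

lemma gam_pos: "gam S u > 0"
proof -
  have "1 + (u \<bullet> u) / ((mass S)\<^sup>2 * (light S)\<^sup>2) > 0"
    by (intro add_pos_nonneg divide_nonneg_nonneg) auto
  then show ?thesis by (simp add: gam_def)
qed

lemma continuous_on_gam: "continuous_on A f \<Longrightarrow> continuous_on A (\<lambda>x. gam S (f x))"
  unfolding gam_def divide_inverse by (intro continuous_intros)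

lemma gam_velocity:
  assumes "mass S > 0"
  shows "gam S ((mass S / r) *\<^sub>R M) = sqrt (1 + (M \<bullet> M) / (r\<^sup>2 * (light S)\<^sup>2))"
  using assms by (cases "r = 0") (auto simp: gam_def power2_eq_square)

text \<open>The density of kinetic energy \<open>r (g - 1) c\<^sup>2\<close> as a function of time through \<open>r\<close> and
  \<open>s = |M|\<^sup>2\<close>; its two partial derivatives are, up to constant factors, the fields that the scheme
  projects.\<close>

lemma energy_density_derivative:
  fixes r s :: "real \<Rightarrow> real"
  assumes r: "(r has_field_derivative r') (at \<xi> within A)" and s: "(s has_field_derivative s') (at \<xi> within A)"
    and "r \<xi> \<noteq> 0" "s \<xi> \<ge> 0" "c > 0" and g: "g = sqrt (1 + s \<xi> / ((r \<xi>)\<^sup>2 * c\<^sup>2))"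
  shows "((\<lambda>\<xi>. r \<xi> * (sqrt (1 + s \<xi> / ((r \<xi>)\<^sup>2 * c\<^sup>2)) - 1) * c\<^sup>2) has_field_derivative
      (c\<^sup>2 * r' * (g - 1 - s \<xi> / (c\<^sup>2 * (r \<xi>)\<^sup>2 * g)) + s' / (2 * r \<xi> * g))) (at \<xi> within A)"
proof -
  have pos: "1 + s \<xi> / ((r \<xi>)\<^sup>2 * c\<^sup>2) > 0" using assms by (intro add_pos_nonneg divide_nonneg_nonneg) auto
  then have g0: "g > 0" by (simp add: g)
  have nz: "(r \<xi>)\<^sup>2 * c\<^sup>2 \<noteq> 0" using assms by simp
  have q: "((\<lambda>\<xi>. 1 + s \<xi> / ((r \<xi>)\<^sup>2 * c\<^sup>2)) has_field_derivative
      (s' / ((r \<xi>)\<^sup>2 * c\<^sup>2) - 2 * s \<xi> * r' / ((r \<xi>) ^ 3 * c\<^sup>2))) (at \<xi> within A)"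
    by (rule DERIV_cong[OF DERIV_add[OF DERIV_const[of 1]
          DERIV_divide[OF s DERIV_mult[OF DERIV_power[OF r, of 2] DERIV_const[of "c\<^sup>2"]] nz]]])
       (use assms in \<open>simp add: field_simps power2_eq_square power3_eq_cube\<close>)
  define Q where "Q = s' / ((r \<xi>)\<^sup>2 * c\<^sup>2) - 2 * s \<xi> * r' / ((r \<xi>) ^ 3 * c\<^sup>2)"
  have "((\<lambda>\<xi>. sqrt (1 + s \<xi> / ((r \<xi>)\<^sup>2 * c\<^sup>2))) has_field_derivative (Q / (2 * g))) (at \<xi> within A)"
    by (rule DERIV_cong[OF DERIV_chain2[where f = sqrt and x = \<xi> and g = "\<lambda>\<xi>. 1 + s \<xi> / ((r \<xi>)\<^sup>2 * c\<^sup>2)", OF DERIV_real_sqrt[OF pos] q]])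
       (unfold g[symmetric] Q_def[symmetric], use g0 in \<open>simp add: field_simps\<close>)
  from DERIV_mult[OF DERIV_mult[OF r DERIV_diff[OF this DERIV_const[of 1]]] DERIV_const[of "c\<^sup>2"]]
  show ?thesis
  proof (rule DERIV_cong, unfold g[symmetric])
    have "r \<xi> * Q * c\<^sup>2 / (2 * g) = s' / (2 * r \<xi> * g) - r' * s \<xi> / ((r \<xi>)\<^sup>2 * g)"
      unfolding Q_def using assms(3,5) g0 by (simp add: field_simps power2_eq_square power3_eq_cube)
    moreover have "c\<^sup>2 * r' * (g - 1 - s \<xi> / (c\<^sup>2 * (r \<xi>)\<^sup>2 * g)) = c\<^sup>2 * r' * (g - 1) - r' * s \<xi> / ((r \<xi>)\<^sup>2 * g)"
      using assms(3,5) g0 by (simp add: field_simps power2_eq_square)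
    ultimately show "(r' * (g - 1) + (Q / (2 * g) - 0) * r \<xi>) * c\<^sup>2 + 0 * (r \<xi> * (g - 1))
       = c\<^sup>2 * r' * (g - 1 - s \<xi> / (c\<^sup>2 * (r \<xi>)\<^sup>2 * g)) + s' / (2 * r \<xi> * g)"
      by (simp add: algebra_simps)
  qed
qed

lemma integral_inner_right:
  fixes f :: "real \<Rightarrow> 'b::euclidean_space"
  assumes "f integrable_on {a..b}"
  shows "integral {a..b} (\<lambda>\<xi>. v \<bullet> f \<xi>) = v \<bullet> integral {a..b} f"
  using integral_linear[OF assms bounded_linear_inner_right[of v]] by (simp add: o_def)

text \<open>The fundamental theorem of calculus along the segment between two states: the energy changes by
  the pairing of the increments with the time averages of the derivatives of the energy.\<close>

lemma fluid_energy_increment: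
  fixes M0 M1 :: "real^3"
  assumes c: "light S > 0" and m: "mass S > 0" and nz: "\<And>\<xi>. \<xi> \<in> {0..1} \<Longrightarrow> interp \<xi> r0 r1 \<noteq> 0"
  shows "r1 * (gam S ((mass S / r1) *\<^sub>R M1) - 1) * (light S)\<^sup>2 - r0 * (gam S ((mass S / r0) *\<^sub>R M0) - 1) * (light S)\<^sup>2
    = (light S)\<^sup>2 * ((r1 - r0) * integral {0..1} (\<lambda>\<xi>. let r = interp \<xi> r0 r1; M = interp \<xi> M0 M1;
          g = gam S ((mass S / r) *\<^sub>R M) in g - 1 - (norm M)\<^sup>2 / ((light S)\<^sup>2 * r\<^sup>2 * g)))
      + (M1 - M0) \<bullet> integral {0..1} (\<lambda>\<xi>. let r = interp \<xi> r0 r1; M = interp \<xi> M0 M1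
          in (1 / (r * gam S ((mass S / r) *\<^sub>R M))) *\<^sub>R M)"
proof -
  define r where "r \<xi> = interp \<xi> r0 r1" for \<xi>
  define M where "M \<xi> = interp \<xi> M0 M1" for \<xi>
  define g where "g \<xi> = gam S ((mass S / r \<xi>) *\<^sub>R M \<xi>)" for \<xi>
  define G where "G \<xi> = g \<xi> - 1 - (norm (M \<xi>))\<^sup>2 / ((light S)\<^sup>2 * (r \<xi>)\<^sup>2 * g \<xi>)" for \<xi>
  define W where "W \<xi> = (1 / (r \<xi> * g \<xi>)) *\<^sub>R M \<xi>" for \<xi>
  define h where "h \<xi> = r \<xi> * (g \<xi> - 1) * (light S)\<^sup>2" for \<xi>
  have geq: "g \<xi> = sqrt (1 + (M \<xi> \<bullet> M \<xi>) / ((r \<xi>)\<^sup>2 * (light S)\<^sup>2))" for \<xi>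
    unfolding g_def by (rule gam_velocity[OF m])
  have g0: "g \<xi> > 0" for \<xi> unfolding g_def by (rule gam_pos)
  have cr: "continuous_on {0..1} r" and cM: "continuous_on {0..1} M"
    unfolding r_def M_def by (intro continuous_on_interp continuous_intros)+
  have rnz: "r \<xi> \<noteq> 0" if "\<xi> \<in> {0..1}" for \<xi> using nz[OF that] by (simp add: r_def)
  have cg: "continuous_on {0..1} g"
    unfolding g_def using rnz by (intro continuous_on_gam continuous_intros cr cM) auto
  have cG: "continuous_on {0..1} G"
    unfolding G_def using rnz g0 c by (intro continuous_intros cr cM cg) (auto simp: less_imp_neq[symmetric])
  have cW: "continuous_on {0..1} W"
    unfolding W_def using rnz g0 by (intro continuous_intros cr cM cg) (auto simp: less_imp_neq[symmetric])
  have iG: "G integrable_on {0..1}" and iW: "W integrable_on {0..1}"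
    using cG cW by (auto intro: integrable_continuous_real)
  have der: "(h has_field_derivative ((light S)\<^sup>2 * (r0 - r1) * G \<xi> + (M0 - M1) \<bullet> W \<xi>)) (at \<xi> within {0..1})"
    if \<xi>: "\<xi> \<in> {0..1}" for \<xi>
  proof -
    have "(h has_field_derivative ((light S)\<^sup>2 * (r0 - r1) * (g \<xi> - 1 - (M \<xi> \<bullet> M \<xi>) / ((light S)\<^sup>2 * (r \<xi>)\<^sup>2 * g \<xi>))
         + 2 * (M \<xi> \<bullet> (M0 - M1)) / (2 * r \<xi> * g \<xi>))) (at \<xi> within {0..1})"
      unfolding h_def geq
      by (rule energy_density_derivative)
         (auto simp: r_def M_def nz[OF \<xi>] c intro: interp_has_field_derivative interp_square_has_field_derivative)
    moreover have "2 * (M \<xi> \<bullet> (M0 - M1)) / (2 * r \<xi> * g \<xi>) = (M0 - M1) \<bullet> W \<xi>"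
      by (simp add: W_def inner_commute)
    ultimately show ?thesis by (simp add: G_def power2_norm_eq_inner)
  qed
  have "((\<lambda>\<xi>. (light S)\<^sup>2 * (r0 - r1) * G \<xi> + (M0 - M1) \<bullet> W \<xi>) has_integral (h 1 - h 0)) {0..1}"
    by (rule fundamental_theorem_of_calculus)
       (use der in \<open>auto simp: has_real_derivative_iff_has_vector_derivative[symmetric]\<close>)
  then have "h 1 - h 0 = integral {0..1} (\<lambda>\<xi>. (light S)\<^sup>2 * (r0 - r1) * G \<xi> + (M0 - M1) \<bullet> W \<xi>)"
    by (simp add: integral_unique)
  also have "\<dots> = integral {0..1} (\<lambda>\<xi>. (light S)\<^sup>2 * (r0 - r1) * G \<xi>) + integral {0..1} (\<lambda>\<xi>. (M0 - M1) \<bullet> W \<xi>)"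
    by (rule Henstock_Kurzweil_Integration.integral_add)
       (intro integrable_continuous_real continuous_intros cG cW)+
  also have "\<dots> = (light S)\<^sup>2 * (r0 - r1) * integral {0..1} G + (M0 - M1) \<bullet> integral {0..1} W"
    using iG by (simp add: integral_inner_right[OF iW])
  finally have "h 0 - h 1 = (light S)\<^sup>2 * ((r1 - r0) * integral {0..1} G) + (M1 - M0) \<bullet> integral {0..1} W"
    by (simp add: algebra_simps inner_diff_left)
  then show ?thesis
    unfolding h_def G_def W_def g_def r_def M_def Let_def by simp
qed

lemma particle_energy_increment:
  assumes c: "light S > 0" and m: "mass S > 0"
  shows "(gam S u1 - 1) * mass S * (light S)\<^sup>2 - (gam S u0 - 1) * mass S * (light S)\<^sup>2
    = (u1 - u0) \<bullet> integral {0..1} (\<lambda>\<xi>. let v = interp \<xi> u0 u1 in (1 / (mass S * gam S v)) *\<^sub>R v)"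
proof -
  define v where "v \<xi> = interp \<xi> u0 u1" for \<xi>
  define W where "W \<xi> = (1 / (mass S * gam S (v \<xi>))) *\<^sub>R v \<xi>" for \<xi>
  define h where "h \<xi> = (gam S (v \<xi>) - 1) * mass S * (light S)\<^sup>2" for \<xi>
  have cv: "continuous_on {0..1} v" unfolding v_def by (intro continuous_on_interp continuous_intros)
  have cW: "continuous_on {0..1} W"
    unfolding W_def using gam_pos[of S] m
    by (intro continuous_intros continuous_on_gam cv) (auto simp: less_imp_neq[symmetric])
  have der: "(h has_field_derivative ((u0 - u1) \<bullet> W \<xi>)) (at \<xi> within {0..1})" for \<xi>
  proof -
    let ?a = "(mass S)\<^sup>2 * (light S)\<^sup>2"
    have pos: "1 + (v \<xi> \<bullet> v \<xi>) / ?a > 0" by (intro add_pos_nonneg divide_nonneg_nonneg) auto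
    have "((\<lambda>\<xi>. 1 + (v \<xi> \<bullet> v \<xi>) / ?a) has_field_derivative (2 * (v \<xi> \<bullet> (u0 - u1)) / ?a)) (at \<xi> within {0..1})"
      unfolding v_def
      using DERIV_add[OF DERIV_const[of 1] DERIV_cdivide[OF interp_square_has_field_derivative[of u0 u1 \<xi> "{0..1}"], of ?a]]
      by simp
    from DERIV_chain2[where f = sqrt and x = \<xi> and g = "\<lambda>\<xi>. 1 + (v \<xi> \<bullet> v \<xi>) / ?a", OF DERIV_real_sqrt[OF pos] this]
    have "((\<lambda>\<xi>. gam S (v \<xi>)) has_field_derivative ((v \<xi> \<bullet> (u0 - u1)) / (?a * gam S (v \<xi>)))) (at \<xi> within {0..1})"
      by (simp add: gam_def field_simps)
    from DERIV_mult[OF DERIV_mult[OF DERIV_diff[OF this DERIV_const[of 1]] DERIV_const[of "mass S"]] DERIV_const[of "(light S)\<^sup>2"]]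
    have "(h has_field_derivative (v \<xi> \<bullet> (u0 - u1)) / (?a * gam S (v \<xi>)) * mass S * (light S)\<^sup>2) (at \<xi> within {0..1})"
      by (simp add: h_def[abs_def])
    then show ?thesis
      by (rule DERIV_cong) (use c m gam_pos[of S "v \<xi>"] in \<open>simp add: W_def field_simps power2_eq_square inner_commute\<close>)
  qed
  have "((\<lambda>\<xi>. (u0 - u1) \<bullet> W \<xi>) has_integral (h 1 - h 0)) {0..1}"
    by (rule fundamental_theorem_of_calculus)
       (use der in \<open>auto simp: has_real_derivative_iff_has_vector_derivative[symmetric]\<close>)
  from integral_unique[OF this] have "h 1 - h 0 = (u0 - u1) \<bullet> integral {0..1} W"
    unfolding integral_inner_right[OF integrable_continuous_real[OF cW]] by simp
  then have "h 0 - h 1 = (u1 - u0) \<bullet> integral {0..1} W" by (simp add: inner_diff_left)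
  then show ?thesis unfolding h_def W_def v_def Let_def by simp
qed

lemma continuous_on_time_averages:
  fixes p0 p1 :: "real^3 \<Rightarrow> real" and m0 m1 :: "real^3 \<Rightarrow> real^3"
  assumes p: "continuous_on K p0" "continuous_on K p1" "continuous_on K m0" "continuous_on K m1"
    and nz: "\<And>x \<xi>. x \<in> K \<Longrightarrow> \<xi> \<in> {0..1} \<Longrightarrow> interp \<xi> (p0 x) (p1 x) \<noteq> 0" and c: "light S > 0"
  shows "continuous_on K (\<lambda>x. integral {0..1} (\<lambda>\<xi>. let r = interp \<xi> (p0 x) (p1 x); M = interp \<xi> (m0 x) (m1 x)
          in (1 / (r * gam S ((mass S / r) *\<^sub>R M))) *\<^sub>R M))" (is ?W)
    and "continuous_on K (\<lambda>x. integral {0..1} (\<lambda>\<xi>. let r = interp \<xi> (p0 x) (p1 x); M = interp \<xi> (m0 x) (m1 x);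
          g = gam S ((mass S / r) *\<^sub>R M) in g - 1 - (norm M)\<^sup>2 / ((light S)\<^sup>2 * r\<^sup>2 * g)))" (is ?G)
proof -
  let ?D = "K \<times> cbox (0::real) 1"
  let ?r = "\<lambda>z. interp (snd z) (p0 (fst z)) (p1 (fst z))"
  let ?M = "\<lambda>z. interp (snd z) (m0 (fst z)) (m1 (fst z))"
  have comp: "continuous_on ?D (\<lambda>z. f (fst z))" if "continuous_on K f" for f :: "real^3 \<Rightarrow> 'c::topological_space"
    by (rule continuous_on_compose2[OF that]) (auto intro: continuous_intros)
  have cr: "continuous_on ?D ?r" by (intro continuous_on_interp comp p continuous_on_snd continuous_on_id)
  have cM: "continuous_on ?D ?M" by (intro continuous_on_interp comp p continuous_on_snd continuous_on_id)
  have rnz: "?r z \<noteq> 0" if "z \<in> ?D" for z using that nz by auto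
  have cg: "continuous_on ?D (\<lambda>z. gam S ((mass S / ?r z) *\<^sub>R ?M z))"
    using rnz by (intro continuous_on_gam continuous_intros cr cM) auto
  have gnz: "gam S u \<noteq> 0" for u using gam_pos[of S u] by simp
  have "continuous_on ?D (\<lambda>z. (1 / (?r z * gam S ((mass S / ?r z) *\<^sub>R ?M z))) *\<^sub>R ?M z)"
    using rnz gnz by (intro continuous_intros cr cM cg) auto
  then show ?W
    using integral_continuous_on_param[of K 0 1 "\<lambda>x \<xi>. (1 / (?r (x, \<xi>) * gam S ((mass S / ?r (x, \<xi>)) *\<^sub>R ?M (x, \<xi>)))) *\<^sub>R ?M (x, \<xi>)"]
    by (simp add: split_beta Let_def)
  have "continuous_on ?D (\<lambda>z. gam S ((mass S / ?r z) *\<^sub>R ?M z) - 1 - (norm (?M z))\<^sup>2 / ((light S)\<^sup>2 * (?r z)\<^sup>2 * gam S ((mass S / ?r z) *\<^sub>R ?M z)))"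
    using rnz gnz c by (intro continuous_intros cr cM cg) auto
  then show ?G
    using integral_continuous_on_param[of K 0 1 "\<lambda>x \<xi>. gam S ((mass S / ?r (x, \<xi>)) *\<^sub>R ?M (x, \<xi>)) - 1 - (norm (?M (x, \<xi>)))\<^sup>2 / ((light S)\<^sup>2 * (?r (x, \<xi>))\<^sup>2 * gam S ((mass S / ?r (x, \<xi>)) *\<^sub>R ?M (x, \<xi>)))"]
    by (simp add: split_beta Let_def)
qed

section \<open>Particle paths\<close>

lemma tendsto_within_finite_Union:
  assumes "finite \<T>" "\<And>K. K \<in> \<T> \<Longrightarrow> (f \<longlongrightarrow> l) (at x within A K)"
  shows "(f \<longlongrightarrow> l) (at x within (\<Union>K\<in>\<T>. A K))"
  using assms
proof (induction \<T> rule: finite_induct)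
  case (insert K \<T>)
  then have "(f \<longlongrightarrow> l) (at x within A K)" "(f \<longlongrightarrow> l) (at x within (\<Union>K\<in>\<T>. A K))" by auto
  then show ?case by (simp add: Lim_within_Un)
qed simp

text \<open>The matrices turn the displacement of the particle into the displacement along the sub-segment.
  A component in which the particle does not move contributes 0 to both sides.\<close>

lemma Dmat_inner:
  assumes "brk d p i - brk d p (i - 1) = l *\<^sub>R (pos u' p - pos u p)"
  shows "(Dmat u d u' p i *v a) \<bullet> (pos u' p - pos u p) = a \<bullet> (brk d p i - brk d p (i - 1))"
proof -
  define X where "X = pos u' p - pos u p"
  define A where "A = brk d p i - brk d p (i - 1)"
  have A: "A = l *\<^sub>R X" using assms by (simp add: A_def X_def)
  show ?thesis
  proof (cases "X = 0")
    case True
    then show ?thesis unfolding X_def[symmetric] A_def[symmetric] using A by simp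
  next
    case False
    define e where "e j = (if X $ j \<noteq> 0 then A $ j / X $ j else (THE r. A = r *\<^sub>R X))" for j
    have D: "(Dmat u d u' p i *v a) $ j = e j * a $ j" for j
    proof -
      have "Dmat u d u' p i $ j $ l = (if l = j then e j else 0)" for l
        using False unfolding Dmat_def e_def X_def[symmetric] A_def[symmetric] by (simp add: Let_def)
      then have "(Dmat u d u' p i *v a) $ j = (\<Sum>l\<in>UNIV. (if l = j then e j else 0) * a $ l)"
        by (simp add: matrix_vector_mult_def)
      also have "\<dots> = (\<Sum>l\<in>UNIV. if l = j then e j * a $ j else 0)" by (rule sum.cong) auto
      finally show ?thesis by simp
    qed
    have "e j * a $ j * X $ j = a $ j * A $ j" for j
      by (cases "X $ j = 0") (auto simp: e_def A)
    then have "(\<Sum>j\<in>UNIV. e j * a $ j * X $ j) = (\<Sum>j\<in>UNIV. a $ j * A $ j)" by (rule sum.cong[OF refl])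
    then have "(Dmat u d u' p i *v a) \<bullet> X = a \<bullet> A" by (simp only: inner_vec_def D inner_real_def)
    then show ?thesis unfolding X_def A_def .
  qed
qed

lemma integral_grad_along_segment:
  fixes q :: "real^3 \<Rightarrow> real"
  assumes q: "\<And>r. C_diff r q"
  shows "(a - b) \<bullet> integral {0..1} (\<lambda>\<xi>. grad q ((1 - \<xi>) *\<^sub>R a + \<xi> *\<^sub>R b)) = q a - q b"
proof -
  define y where "y \<xi> = (1 - \<xi>) *\<^sub>R a + \<xi> *\<^sub>R b" for \<xi> :: real
  have cy: "continuous_on {0..1} y" unfolding y_def by (intro continuous_intros)
  have c: "continuous_on {0..1} (\<lambda>\<xi>. grad q (y \<xi>))"
    by (rule continuous_on_compose2[OF C_diff_continuous[OF C_diff_grad[OF q, of 0]] cy]) simp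
  have der: "((\<lambda>\<xi>. q (y \<xi>)) has_field_derivative ((b - a) \<bullet> grad q (y \<xi>))) (at \<xi>)" for \<xi>
  proof -
    have "((\<lambda>s. q (a + s *\<^sub>R (b - a))) has_field_derivative frechet_derivative q (at (a + \<xi> *\<^sub>R (b - a))) (b - a)) (at \<xi>)"
      by (rule C_diff_line_derivative[OF q])
    moreover have "y s = a + s *\<^sub>R (b - a)" for s by (simp add: y_def algebra_simps)
    ultimately show ?thesis
      using grad_inner[OF C_diff_differentiable[OF q[of "Suc 0"]], of "y \<xi>" "b - a"] by (simp add: inner_commute)
  qed
  have "((\<lambda>\<xi>. (b - a) \<bullet> grad q (y \<xi>)) has_integral (q (y 1) - q (y 0))) {0..1}"
    by (rule fundamental_theorem_of_calculus)
       (use der in \<open>auto simp: has_real_derivative_iff_has_vector_derivative[symmetric] intro: has_field_derivative_at_within\<close>)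
  from integral_unique[OF this] have "(b - a) \<bullet> integral {0..1} (\<lambda>\<xi>. grad q (y \<xi>)) = q b - q a"
    unfolding integral_inner_right[OF integrable_continuous_real[OF c]] by (simp add: y_def)
  then show ?thesis by (simp add: y_def inner_diff_left)
qed

context fe_mesh
begin

lemma point_value_eq_cell_trace:
  assumes f: "f \<in> Q0_space \<Omega> \<T> k" and K: "K \<in> \<T>" "x \<in> K"
  shows "point_value \<T> f x = cell_trace K f x"
  unfolding point_value_def
proof (rule tendsto_Lim)
  have "x islimpt interior K" using islimpt_interior_convex[OF cell_convex[OF K(1)] cell_interior[OF K(1)] K(2)] .
  then have "x islimpt (\<Union>K\<in>\<T>. interior K)" by (rule islimpt_subset) (use K in blast)
  then show "at x within (\<Union>K\<in>\<T>. interior K) \<noteq> bot" by (simp add: trivial_limit_within)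
  have s: "cellwise_smooth \<T> f" using f smooth_Q by (auto simp: Q0_space_def)
  show "(f \<longlongrightarrow> cell_trace K f x) (at x within (\<Union>K\<in>\<T>. interior K))"
  proof (rule tendsto_within_finite_Union[OF finite_cells])
    fix L assume L: "L \<in> \<T>"
    show "(f \<longlongrightarrow> cell_trace K f x) (at x within interior L)"
    proof (cases "x \<in> L")
      case True
      obtain p where p: "\<And>r. C_diff r p" "\<And>x. x \<in> interior L \<Longrightarrow> f x = p x" using cellwise_smoothE[OF s L] by metis
      have "(p \<longlongrightarrow> p x) (at x within interior L)"
        using C_diff_continuous[OF p(1)[of 0]] by (meson UNIV_I continuous_on_def subset_UNIV tendsto_within_subset)
      then have "(f \<longlongrightarrow> p x) (at x within interior L)"
        by (rule Lim_transform_eventually) (auto simp: eventually_at_filter p(2))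
      moreover have "p x = cell_trace K f x"
        using cell_trace_smooth[OF L True p(1) p(2)] Q0_traces_agree[OF f K L True] by simp
      ultimately show ?thesis by simp
    next
      case False
      then have "\<not> x islimpt interior L"
        using cell_closed[OF L] interior_subset[of L] closed_limpt islimpt_subset by blast
      then have "at x within interior L = bot" by (simp add: trivial_limit_within)
      then show ?thesis by simp
    qed
  qed
qed

lemma integral_trace_grad_along_segment:
  assumes f: "f \<in> Q0_space \<Omega> \<T> k" and K: "K \<in> \<T>" and ab: "closed_segment b a \<subseteq> K"
  shows "(a - b) \<bullet> integral {0..1} (\<lambda>\<xi>. cell_trace K (grad f) ((1 - \<xi>) *\<^sub>R a + \<xi> *\<^sub>R b))
     = point_value \<T> f a - point_value \<T> f b"
proof -
  have s: "cellwise_smooth \<T> f" using f smooth_Q by (auto simp: Q0_space_def)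
  obtain p where p: "\<And>r. C_diff r p" "\<And>x. x \<in> interior K \<Longrightarrow> f x = p x" using cellwise_smoothE[OF s K] by metis
  have dp: "p differentiable (at y)" for y by (rule C_diff_differentiable[OF p(1)[of "Suc 0"]])
  have seg: "(1 - \<xi>) *\<^sub>R a + \<xi> *\<^sub>R b \<in> K" if "\<xi> \<in> {0..1}" for \<xi>
  proof -
    have "(1 - \<xi>) *\<^sub>R a + \<xi> *\<^sub>R b \<in> closed_segment a b" using that by (auto simp: in_segment)
    then show ?thesis using ab by (auto simp: closed_segment_commute)
  qed
  have "cell_trace K (grad f) ((1 - \<xi>) *\<^sub>R a + \<xi> *\<^sub>R b) = grad p ((1 - \<xi>) *\<^sub>R a + \<xi> *\<^sub>R b)" if "\<xi> \<in> {0..1}" for \<xi>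
    by (rule cell_trace_smooth[OF K seg[OF that] C_diff_grad[OF p(1)]]) (rule grad_cell[OF p(2) _ dp])
  then have "integral {0..1} (\<lambda>\<xi>. cell_trace K (grad f) ((1 - \<xi>) *\<^sub>R a + \<xi> *\<^sub>R b))
      = integral {0..1} (\<lambda>\<xi>. grad p ((1 - \<xi>) *\<^sub>R a + \<xi> *\<^sub>R b))"
    by (rule integral_cong)
  moreover have "a \<in> K" "b \<in> K" using seg[of 0] seg[of 1] by auto
  then have "point_value \<T> f a = p a" "point_value \<T> f b = p b"
    using point_value_eq_cell_trace[OF f K] cell_trace_smooth[OF K _ p(1) p(2)] by auto
  ultimately show ?thesis using integral_grad_along_segment[OF p(1), of a b] by simp
qed

end


section \<open>One step of the scheme\<close>

lemma face_integral_mult: "face_integral F (\<lambda>x. f x * c) = face_integral F f * c"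
  unfolding face_integral_def Let_def by simp

lemma face_integral_eq_0:
  assumes "\<And>x. x \<in> F \<Longrightarrow> f x = 0" shows "face_integral F f = 0"
  unfolding face_integral_def Let_def
  by (rule trans[OF Bochner_Integration.integral_cong[OF refl, where g = "\<lambda>_. 0"]]) (use assms in auto)

lemma is_L2_projectionD:
  "is_L2_projection \<Omega> V f g \<Longrightarrow> v \<in> V \<Longrightarrow>
     (LINT x|lebesgue_on \<Omega>. g x \<bullet> v x) = (LINT x|lebesgue_on \<Omega>. f x \<bullet> v x)"
  by (simp add: is_L2_projection_def)

lemma finterp_eq: "finterp \<alpha> f g = (\<lambda>x. (1 - \<alpha>) *\<^sub>R g x + \<alpha> *\<^sub>R f x)"
  by (simp add: finterp_def interp_def)

locale scheme_step = fe_mesh "dom S" "cells S" for S :: setting +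
  fixes u u' :: state and d :: step_data
  assumes orientation: "face_orientation S"
    and light_pos: "light S > 0" and mass_pos: "mass S > 0" and dt_pos: "dt S > 0"
    and adm: "admissible S u" and adm': "admissible S u'"
    and step: "IF_step S u d u'"
begin

abbreviation E_mid :: "real^3 \<Rightarrow> real^3" where "E_mid \<equiv> finterp (1/2) (elec u) (elec u')"
abbreviation B_mid :: "real^3 \<Rightarrow> real^3" where "B_mid \<equiv> finterp (1/2) (magn u) (magn u')"

lemma in_spaces:
  "rho u \<in> DG_space (dom S) (cells S) (deg S + 1)" "rho u' \<in> DG_space (dom S) (cells S) (deg S + 1)"
  "mom u \<in> RT_space (dom S) (cells S) (deg S)" "mom u' \<in> RT_space (dom S) (cells S) (deg S)"
  "elec u \<in> N0_space (dom S) (cells S) (deg S)" "elec u' \<in> N0_space (dom S) (cells S) (deg S)"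
  "magn u \<in> RT0_space (dom S) (cells S) (deg S)" "magn u' \<in> RT0_space (dom S) (cells S) (deg S)"
  "wh d \<in> RT_space (dom S) (cells S) (deg S)" "Gh d \<in> DG_space (dom S) (cells S) (deg S + 1)"
  using adm adm' step
  by (simp_all add: admissible_def IF_step_def velocity_projection_def G_projection_def is_L2_projection_def)

lemma E_mid_N0: "E_mid \<in> N0_space (dom S) (cells S) (deg S)"
  unfolding finterp_eq by (rule N0_linear[OF in_spaces(6,5)])

lemma B_mid_RT0: "B_mid \<in> RT0_space (dom S) (cells S) (deg S)"
  unfolding finterp_eq by (rule RT0_linear[OF in_spaces(8,7)])

lemma smooth_N0: "v \<in> N0_space (dom S) (cells S) k \<Longrightarrow> cellwise_smooth (cells S) v"
  by (rule smooth_N[of v "dom S" "cells S" k]) (simp add: N0_space_def)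

lemma smooth_RT0: "v \<in> RT0_space (dom S) (cells S) k \<Longrightarrow> cellwise_smooth (cells S) v"
  by (rule smooth_RT[of v "dom S" "cells S" k]) (simp add: RT0_space_def)

lemmas smooth_fields =
  smooth_DG[OF in_spaces(1)] smooth_DG[OF in_spaces(2)] smooth_RT[OF in_spaces(3)] smooth_RT[OF in_spaces(4)]
  smooth_N0[OF in_spaces(5)] smooth_N0[OF in_spaces(6)] smooth_RT0[OF in_spaces(7)] smooth_RT0[OF in_spaces(8)]
  smooth_RT[OF in_spaces(9)] smooth_DG[OF in_spaces(10)]
  smooth_N0[OF E_mid_N0] smooth_RT0[OF B_mid_RT0]

lemmas continuous_fields = smooth_fields[THEN cellwise_smooth_continuous]

lemma face_cells:
  assumes "F \<in> interior_faces (cells S)"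
  shows "cell1 S F \<in> cells S" "cell2 S F \<in> cells S" "x \<in> F \<Longrightarrow> x \<in> cell1 S F" "x \<in> F \<Longrightarrow> x \<in> cell2 S F"
proof -
  have o: "cell1 S F \<in> cells S \<and> cell2 S F \<in> cells S \<and> cell1 S F \<noteq> cell2 S F \<and> F = cell1 S F \<inter> cell2 S F"
    using orientation assms unfolding face_orientation_def by (rule bspec)
  then show "cell1 S F \<in> cells S" "cell2 S F \<in> cells S" by simp_all
  from o have F: "F = cell1 S F \<inter> cell2 S F" by simp
  show "x \<in> F \<Longrightarrow> x \<in> cell1 S F" by (subst (asm) F) simp
  show "x \<in> F \<Longrightarrow> x \<in> cell2 S F" by (subst (asm) F) simp
qed

lemma density_step:
  assumes "\<phi> \<in> DG_space (dom S) (cells S) (deg S + 1)"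
  shows "(LINT x|lebesgue_on (dom S). (rho u' x - rho u x) * \<phi> x) / dt S
     = (LINT x|lebesgue_on (dom S). finterp (theta S) (rho u) (rho u') x * (wh d x \<bullet> grad \<phi> x))
     - (\<Sum>F\<in>interior_faces (cells S). face_integral F (\<lambda>x.
          upwind_flux S (upw d) F (\<lambda>y. finterp (theta2 S) (rho u) (rho u') y *\<^sub>R wh d y) x \<bullet> sjump S F \<phi> x))"
proof -
  have "density_eq S u d u'" using step by (simp add: IF_step_def)
  from bspec[OF this[unfolded density_eq_def] assms] show ?thesis
    by (simp add: times_divide_eq_left)
qed

text \<open>Without jumps of the test function the numerical fluxes drop out, whatever they are.\<close>

lemma density_step_continuous_test:
  assumes \<phi>: "\<phi> \<in> DG_space (dom S) (cells S) (deg S + 1)"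
    and "\<And>K L x. K \<in> cells S \<Longrightarrow> L \<in> cells S \<Longrightarrow> x \<in> K \<Longrightarrow> x \<in> L \<Longrightarrow> cell_trace K \<phi> x = cell_trace L \<phi> x"
  shows "(LINT x|lebesgue_on (dom S). (rho u' x - rho u x) * \<phi> x)
     = dt S * (LINT x|lebesgue_on (dom S). finterp (theta S) (rho u) (rho u') x * (wh d x \<bullet> grad \<phi> x))"
proof -
  have "sjump S F \<phi> x = 0" if "F \<in> interior_faces (cells S)" "x \<in> F" for F x
    using assms(2)[OF face_cells(1)[OF that(1)] face_cells(2)[OF that(1)] face_cells(3)[OF that] face_cells(4)[OF that]]
    by (simp add: sjump_def)
  then have "(\<Sum>F\<in>interior_faces (cells S). face_integral F (\<lambda>x.
          upwind_flux S (upw d) F (\<lambda>y. finterp (theta2 S) (rho u) (rho u') y *\<^sub>R wh d y) x \<bullet> sjump S F \<phi> x)) = 0"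
    by (intro sum.neutral ballI face_integral_eq_0) simp
  then show ?thesis using density_step[OF \<phi>] dt_pos by (simp add: field_simps)
qed

lemma constant_in_DG: "(\<lambda>x. 1) \<in> DG_space (dom S) (cells S) k"
proof -
  have "cellwise (cells S) (polys k) (\<lambda>x. 1)"
    unfolding cellwise_def by (intro ballI bexI[of _ "\<lambda>x. 1"]) (auto intro: polys_const)
  then show ?thesis
    using cellwise_continuous_L2[OF cellwise_continuous_const[of _ "1::real"]] by (simp add: DG_space_def)
qed

lemma fluid_mass_step: "fluid_mass S u' = fluid_mass S u"
proof -
  have tr: "cell_trace K (\<lambda>x. 1 :: real) x = 1" if "K \<in> cells S" "x \<in> K" for K x
    by (rule cell_trace_smooth[OF that C_diff_const]) simp
  have "(LINT x|lebesgue_on (dom S). (rho u' x - rho u x) * 1)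
     = dt S * (LINT x|lebesgue_on (dom S). finterp (theta S) (rho u) (rho u') x * (wh d x \<bullet> grad (\<lambda>x. 1) x))"
    by (rule density_step_continuous_test[OF constant_in_DG]) (simp add: tr)
  moreover have "grad (\<lambda>x. 1) x = 0" for x by (simp add: grad_def vec_eq_iff)
  ultimately show ?thesis
    using cellwise_continuous_integrable[OF continuous_fields(1)] cellwise_continuous_integrable[OF continuous_fields(2)]
    by (simp add: fluid_mass_def)
qed

subsection \<open>Energy\<close>

text \<open>Continuous extensions of the fields to a closed cell. The condition on the density concerns its
  traces, so it carries over to the extensions, also at the faces.\<close>

lemma cell_representatives:
  assumes K: "K \<in> cells S"
  obtains p0 p1 m0 m1 where
    "continuous_on K p0" "continuous_on K p1" "continuous_on K m0" "continuous_on K m1"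
    "\<forall>x\<in>interior K. rho u x = p0 x \<and> rho u' x = p1 x \<and> mom u x = m0 x \<and> mom u' x = m1 x"
    "\<forall>x\<in>K. \<forall>\<xi>\<in>{0..1}. interp \<xi> (p0 x) (p1 x) \<noteq> 0"
proof -
  obtain p0 where p0: "\<And>r. C_diff r p0" "\<And>x. x \<in> interior K \<Longrightarrow> rho u x = p0 x"
    using cellwise_smoothE[OF smooth_fields(1) K] by metis
  obtain p1 where p1: "\<And>r. C_diff r p1" "\<And>x. x \<in> interior K \<Longrightarrow> rho u' x = p1 x"
    using cellwise_smoothE[OF smooth_fields(2) K] by metis
  obtain m0 where m0: "\<And>r. C_diff r m0" "\<And>x. x \<in> interior K \<Longrightarrow> mom u x = m0 x"
    using cellwise_smoothE[OF smooth_fields(3) K] by metis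
  obtain m1 where m1: "\<And>r. C_diff r m1" "\<And>x. x \<in> interior K \<Longrightarrow> mom u' x = m1 x"
    using cellwise_smoothE[OF smooth_fields(4) K] by metis
  have nv: "nonvanishing_density S u u'" using step by (simp add: IF_step_def)
  have nz: "interp \<xi> (p0 x) (p1 x) \<noteq> 0" if x: "x \<in> K" and "\<xi> \<in> {0..1}" for x \<xi>
    using nv K that cell_trace_smooth[OF K x p0(1) p0(2)] cell_trace_smooth[OF K x p1(1) p1(2)]
    unfolding nonvanishing_density_def by metis
  have c: "continuous_on K f" if "\<And>r. C_diff r f" for f :: "real^3 \<Rightarrow> 'c::real_normed_vector"
    using C_diff_continuous[OF that[of 0]] continuous_on_subset by blast
  show ?thesis
    by (rule that[of p0 p1 m0 m1]) (use c[OF p0(1)] c[OF p1(1)] c[OF m0(1)] c[OF m1(1)] p0(2) p1(2) m0(2) m1(2) nz in auto)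
qed

lemma fluid_energy_step:
  "(LINT x|lebesgue_on (dom S). rho u' x * (gam S ((mass S / rho u' x) *\<^sub>R mom u' x) - 1) * (light S)\<^sup>2)
   - (LINT x|lebesgue_on (dom S). rho u x * (gam S ((mass S / rho u x) *\<^sub>R mom u x) - 1) * (light S)\<^sup>2)
   = (light S)\<^sup>2 * (LINT x|lebesgue_on (dom S). (rho u' x - rho u x) * Gh d x)
     + (LINT x|lebesgue_on (dom S). (mom u' x - mom u x) \<bullet> wh d x)"
proof -
  define W where "W = (\<lambda>x. integral {0..1} (\<lambda>\<xi>.
          let r = finterp \<xi> (rho u) (rho u') x; M = finterp \<xi> (mom u) (mom u') x
          in (1 / (r * gam S ((mass S / r) *\<^sub>R M))) *\<^sub>R M))"
  define G where "G = (\<lambda>x. integral {0..1} (\<lambda>\<xi>.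
          let r = finterp \<xi> (rho u) (rho u') x; M = finterp \<xi> (mom u) (mom u') x;
              g = gam S ((mass S / r) *\<^sub>R M)
          in g - 1 - (norm M)\<^sup>2 / ((light S)\<^sup>2 * r\<^sup>2 * g)))"
  define H where "H v x = rho v x * (gam S ((mass S / rho v x) *\<^sub>R mom v x) - 1) * (light S)\<^sup>2" for v :: state and x
  have cell: "\<exists>p q h h'. (continuous_on K p \<and> (\<forall>x\<in>interior K. W x = p x)) \<and> (continuous_on K q \<and> (\<forall>x\<in>interior K. G x = q x))
      \<and> (continuous_on K h \<and> (\<forall>x\<in>interior K. H u x = h x)) \<and> (continuous_on K h' \<and> (\<forall>x\<in>interior K. H u' x = h' x))
      \<and> (\<forall>x\<in>interior K. H u' x - H u x = (light S)\<^sup>2 * ((rho u' x - rho u x) * G x) + (mom u' x - mom u x) \<bullet> W x)"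
    if K: "K \<in> cells S" for K
  proof -
    obtain p0 p1 m0 m1 where c: "continuous_on K p0" "continuous_on K p1" "continuous_on K m0" "continuous_on K m1"
      and eq': "\<forall>x\<in>interior K. rho u x = p0 x \<and> rho u' x = p1 x \<and> mom u x = m0 x \<and> mom u' x = m1 x"
      and nz': "\<forall>x\<in>K. \<forall>\<xi>\<in>{0..1}. interp \<xi> (p0 x) (p1 x) \<noteq> 0"
      using cell_representatives[OF K] .
    note eq = bspec[OF eq'] and nz = bspec[OF bspec[OF nz']]
    define p where "p x = integral {0..1} (\<lambda>\<xi>. let r = interp \<xi> (p0 x) (p1 x); M = interp \<xi> (m0 x) (m1 x)
          in (1 / (r * gam S ((mass S / r) *\<^sub>R M))) *\<^sub>R M)" for x
    define q where "q x = integral {0..1} (\<lambda>\<xi>. let r = interp \<xi> (p0 x) (p1 x); M = interp \<xi> (m0 x) (m1 x);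
          g = gam S ((mass S / r) *\<^sub>R M) in g - 1 - (norm M)\<^sup>2 / ((light S)\<^sup>2 * r\<^sup>2 * g))" for x
    define h where "h x = p0 x * (gam S ((mass S / p0 x) *\<^sub>R m0 x) - 1) * (light S)\<^sup>2" for x
    define h' where "h' x = p1 x * (gam S ((mass S / p1 x) *\<^sub>R m1 x) - 1) * (light S)\<^sup>2" for x
    have cp: "continuous_on K p" and cq: "continuous_on K q"
      unfolding p_def q_def by (rule continuous_on_time_averages[OF c nz light_pos]; assumption)+
    have nz01: "p0 x \<noteq> 0" "p1 x \<noteq> 0" if "x \<in> K" for x
      using nz[OF that, of 1] nz[OF that, of 0] by simp_all
    have ch: "continuous_on K h" "continuous_on K h'"
      unfolding h_def h'_def using nz01 by (intro continuous_intros continuous_on_gam c; simp)+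
    have W: "W x = p x" and G: "G x = q x" if "x \<in> interior K" for x
      using eq[OF that] by (simp_all add: W_def G_def p_def q_def finterp_def)
    have H: "H u x = h x" "H u' x = h' x" if "x \<in> interior K" for x
      using eq[OF that] by (simp_all add: H_def h_def h'_def)
    have "H u' x - H u x = (light S)\<^sup>2 * ((rho u' x - rho u x) * G x) + (mom u' x - mom u x) \<bullet> W x"
      if x: "x \<in> interior K" for x
    proof -
      have "x \<in> K" using x interior_subset by blast
      from fluid_energy_increment[OF light_pos mass_pos nz[OF this], of "m1 x" "m0 x"]
      show ?thesis using eq[OF x] W[OF x] G[OF x] by (simp add: H_def p_def q_def)
    qed
    then show ?thesis using cp cq ch W G H by (intro exI[of _ p] exI[of _ q] exI[of _ h] exI[of _ h']) auto
  qed
  have cW: "cellwise_continuous (cells S) W" and cG: "cellwise_continuous (cells S) G"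
    and cH: "cellwise_continuous (cells S) (H u)" "cellwise_continuous (cells S) (H u')"
    unfolding cellwise_continuous_def using cell by meson+
  have incr: "H u' x - H u x = (light S)\<^sup>2 * ((rho u' x - rho u x) * G x) + (mom u' x - mom u x) \<bullet> W x"
    if "K \<in> cells S" "x \<in> interior K" for K x
    using cell[OF that(1)] that(2) by blast
  note cf = continuous_fields
  have i1: "integrable (lebesgue_on (dom S)) (\<lambda>x. (rho u' x - rho u x) * G x)"
    and i2: "integrable (lebesgue_on (dom S)) (\<lambda>x. (mom u' x - mom u x) \<bullet> W x)"
    by (rule cellwise_continuous_integrable, intro cellwise_continuous_intros cf cG cW)+
  have iH: "integrable (lebesgue_on (dom S)) (H u)" "integrable (lebesgue_on (dom S)) (H u')"
    by (rule cellwise_continuous_integrable[OF cH(1)], rule cellwise_continuous_integrable[OF cH(2)])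
  have "(LINT x|lebesgue_on (dom S). H u' x) - (LINT x|lebesgue_on (dom S). H u x)
      = (LINT x|lebesgue_on (dom S). H u' x - H u x)" using iH by simp
  also have "\<dots> = (LINT x|lebesgue_on (dom S). (light S)\<^sup>2 * ((rho u' x - rho u x) * G x) + (mom u' x - mom u x) \<bullet> W x)"
    by (rule cellwise_continuous_LINT_cong[OF cellwise_continuous_diff[OF cH(2,1)] incr])
  also have "\<dots> = (light S)\<^sup>2 * (LINT x|lebesgue_on (dom S). (rho u' x - rho u x) * G x)
      + (LINT x|lebesgue_on (dom S). (mom u' x - mom u x) \<bullet> W x)" using i1 i2 by simp
  also have "(LINT x|lebesgue_on (dom S). (rho u' x - rho u x) * G x) = (LINT x|lebesgue_on (dom S). (rho u' x - rho u x) * Gh d x)"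
  proof -
    have "G_projection S u d u'" using step by (simp add: IF_step_def)
    then have "is_L2_projection (dom S) (DG_space (dom S) (cells S) (deg S + 1)) G (Gh d)"
      unfolding G_projection_def G_def .
    moreover have "(\<lambda>x. rho u' x - rho u x) \<in> DG_space (dom S) (cells S) (deg S + 1)"
      using DG_linear[OF in_spaces(2,1), of 1 "-1"] by simp
    ultimately have "(LINT x|lebesgue_on (dom S). Gh d x \<bullet> (rho u' x - rho u x)) = (LINT x|lebesgue_on (dom S). G x \<bullet> (rho u' x - rho u x))"
      by (rule is_L2_projectionD)
    then show ?thesis by (simp add: mult.commute)
  qed
  also have "(LINT x|lebesgue_on (dom S). (mom u' x - mom u x) \<bullet> W x) = (LINT x|lebesgue_on (dom S). (mom u' x - mom u x) \<bullet> wh d x)"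
  proof -
    have "velocity_projection S u d u'" using step by (simp add: IF_step_def)
    then have "is_L2_projection (dom S) (RT_space (dom S) (cells S) (deg S)) W (wh d)"
      unfolding velocity_projection_def W_def .
    moreover have "(\<lambda>x. mom u' x - mom u x) \<in> RT_space (dom S) (cells S) (deg S)"
      using RT_linear[OF in_spaces(4,3), of 1 "-1"] by simp
    ultimately have "(LINT x|lebesgue_on (dom S). wh d x \<bullet> (mom u' x - mom u x)) = (LINT x|lebesgue_on (dom S). W x \<bullet> (mom u' x - mom u x))"
      by (rule is_L2_projectionD)
    then show ?thesis by (simp add: inner_commute)
  qed
  finally show ?thesis by (simp add: H_def)
qed

text \<open>Testing the momentum equation with \<open>wh\<close> and the density equation with \<open>Gh\<close>: the transport
  terms and their fluxes vanish by antisymmetry, the pressure-like terms and their fluxes cancel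
  each other, and only the work of the electric field is left.\<close>

lemma fluid_work:
  "(light S)\<^sup>2 * (LINT x|lebesgue_on (dom S). (rho u' x - rho u x) * Gh d x)
     + (LINT x|lebesgue_on (dom S). (mom u' x - mom u x) \<bullet> wh d x)
   = dt S * (charge S / mass S *
       (LINT x|lebesgue_on (dom S). finterp (theta S) (rho u) (rho u') x * (wh d x \<bullet> E_mid x)))"
proof -
  let ?T = "LINT x|lebesgue_on (dom S). finterp (theta S) (rho u) (rho u') x * (wh d x \<bullet> grad (Gh d) x)"
  let ?fl = "\<lambda>F x. upwind_flux S (upw d) F (\<lambda>y. finterp (theta2 S) (rho u) (rho u') y *\<^sub>R wh d y) x \<bullet> sjump S F (Gh d) x"
  let ?J = "LINT x|lebesgue_on (dom S). finterp (theta S) (rho u) (rho u') x * (wh d x \<bullet> E_mid x)"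
  have rot: "face_integral F (\<lambda>x. upwind_flux S (upw d) F
            (\<lambda>y. cross3 (face_normal S F) (finterp (theta3 S) (mom u) (mom u') y)) x
          \<bullet> vjump S F (\<lambda>y. cross3 (wh d y) (wh d y)) x) = 0" if F: "F \<in> interior_faces (cells S)" for F
  proof (rule face_integral_eq_0)
    fix x assume x: "x \<in> F"
    have "cell_trace K (\<lambda>y. 0 :: real^3) x = 0" if "K \<in> cells S" "x \<in> K" for K
      by (rule cell_trace_smooth[OF that C_diff_const]) simp
    then have "vjump S F (\<lambda>y. cross3 (wh d y) (wh d y)) x = 0"
      using face_cells(1,2)[OF F] face_cells(3,4)[OF F x] by (simp add: vjump_def)
    then show "upwind_flux S (upw d) F (\<lambda>y. cross3 (face_normal S F) (finterp (theta3 S) (mom u) (mom u') y)) x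
          \<bullet> vjump S F (\<lambda>y. cross3 (wh d y) (wh d y)) x = 0" by simp
  qed
  have lor: "(E_mid x + cross3 (wh d x) ((1 / light S) *\<^sub>R B_mid x)) \<bullet> wh d x = wh d x \<bullet> E_mid x" for x
    by (simp add: inner_commute[of _ "wh d x"] inner_add_right dot_cross_self)
  have rot_sum: "(\<Sum>F\<in>interior_faces (cells S). face_integral F (\<lambda>x. upwind_flux S (upw d) F
            (\<lambda>y. cross3 (face_normal S F) (finterp (theta3 S) (mom u) (mom u') y)) x
          \<bullet> vjump S F (\<lambda>y. cross3 (wh d y) (wh d y)) x)) = 0"
    by (rule sum.neutral) (use rot in blast)
  have "momentum_eq S u d u'" using step by (simp add: IF_step_def)
  note raw = bspec[OF this[unfolded momentum_eq_def] in_spaces(9), unfolded Let_def lor rot_sum face_integral_mult sum_distrib_right[symmetric]]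
  have mom: "(LINT x|lebesgue_on (dom S). (mom u' x - mom u x) \<bullet> wh d x) / dt S
     = - ?T * (light S)\<^sup>2 + charge S / mass S * ?J
       + (\<Sum>F\<in>interior_faces (cells S). face_integral F (?fl F)) * (light S)\<^sup>2"
    using raw by simp
  have dens: "(LINT x|lebesgue_on (dom S). (rho u' x - rho u x) * Gh d x) / dt S
     = ?T - (\<Sum>F\<in>interior_faces (cells S). face_integral F (?fl F))"
    by (rule density_step[OF in_spaces(10)])
  have "((light S)\<^sup>2 * (LINT x|lebesgue_on (dom S). (rho u' x - rho u x) * Gh d x)
     + (LINT x|lebesgue_on (dom S). (mom u' x - mom u x) \<bullet> wh d x)) / dt S
     = (light S)\<^sup>2 * ((LINT x|lebesgue_on (dom S). (rho u' x - rho u x) * Gh d x) / dt S)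
       + (LINT x|lebesgue_on (dom S). (mom u' x - mom u x) \<bullet> wh d x) / dt S"
    by (simp add: add_divide_distrib)
  also have "\<dots> = charge S / mass S * ?J" unfolding mom dens by (simp add: algebra_simps)
  finally show ?thesis using dt_pos by (simp add: field_simps)
qed

definition segment_integral :: "(real^3 \<Rightarrow> real^3) \<Rightarrow> nat \<Rightarrow> nat \<Rightarrow> real^3" where
  "segment_integral v p i = integral {0..1} (\<lambda>\<xi>. cell_trace (segcell d p i) v (segpoint d p i \<xi>))"

abbreviation segment :: "nat \<Rightarrow> nat \<Rightarrow> real^3" where
  "segment p i \<equiv> brk d p i - brk d p (i - 1)"

lemma particle_facts:
  assumes "p \<in> {1..npart S}"
  shows "trajectory S u d u' p" "position_eq S u u' p" "impulse_eq S u d u' p"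
  using step assms by (simp_all add: IF_step_def)

lemma segment_parallel:
  assumes p: "p \<in> {1..npart S}" and i: "i \<in> {1..nseg d p}"
  obtains l where "segment p i = l *\<^sub>R (pos u' p - pos u p)"
proof -
  obtain t :: "nat \<Rightarrow> real" where t: "\<forall>i\<le>nseg d p. brk d p i = pos u p + t i *\<^sub>R (pos u' p - pos u p)"
    using particle_facts(1)[OF p] unfolding trajectory_def by blast
  have "brk d p i = pos u p + t i *\<^sub>R (pos u' p - pos u p)"
    "brk d p (i - 1) = pos u p + t (i - 1) *\<^sub>R (pos u' p - pos u p)" using t i by auto
  then have "segment p i = (t i - t (i - 1)) *\<^sub>R (pos u' p - pos u p)"
    by (simp only: scaleR_diff_left) simp
  then show ?thesis by (rule that)
qed

text \<open>The time-averaged velocity is the displacement over \<open>dt\<close>, so the magnetic force does no work,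
  and the matrices redistribute the electric work over the sub-segments exactly as it occurs in the
  particle current of the Ampere law.\<close>

lemma particle_energy_step:
  assumes p: "p \<in> {1..npart S}"
  shows "(gam S (imp u' p) - 1) * mass S * (light S)\<^sup>2 - (gam S (imp u p) - 1) * mass S * (light S)\<^sup>2
    = charge S * (\<Sum>i=1..nseg d p. segment p i \<bullet> segment_integral E_mid p i)"
proof -
  define V where "V = integral {0..1} (\<lambda>\<xi>. let v = interp \<xi> (imp u p) (imp u' p) in (1 / (mass S * gam S v)) *\<^sub>R v)"
  define B where "B = (1 / light S) *\<^sub>R cell_trace (midcell d p) B_mid ((1/2) *\<^sub>R (pos u p + pos u' p))"
  have X: "pos u' p - pos u p = dt S *\<^sub>R V"
  proof -
    have "(1 / dt S) *\<^sub>R (pos u' p - pos u p) = V"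
      using particle_facts(2)[OF p] by (simp add: position_eq_def V_def)
    then have "dt S *\<^sub>R ((1 / dt S) *\<^sub>R (pos u' p - pos u p)) = dt S *\<^sub>R V" by simp
    then show ?thesis using dt_pos by simp
  qed
  have V': "(1 / mass S) *\<^sub>R integral {0..1} (\<lambda>\<xi>. let v = interp \<xi> (imp u p) (imp u' p) in (1 / gam S v) *\<^sub>R v) = V"
    unfolding V_def Let_def
    by (subst integral_cmul[symmetric]) simp
  have U: "imp u' p - imp u p = dt S *\<^sub>R (charge S *\<^sub>R ((\<Sum>i=1..nseg d p. Dmat u d u' p i *v segment_integral E_mid p i) + cross3 V B))"
  proof -
    have "(1 / dt S) *\<^sub>R (imp u' p - imp u p) = charge S *\<^sub>R ((\<Sum>i=1..nseg d p. Dmat u d u' p i *v segment_integral E_mid p i) + cross3 V B)"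
      using particle_facts(3)[OF p] V' unfolding impulse_eq_def segment_integral_def B_def by simp
    then have "dt S *\<^sub>R ((1 / dt S) *\<^sub>R (imp u' p - imp u p)) = dt S *\<^sub>R (charge S *\<^sub>R ((\<Sum>i=1..nseg d p. Dmat u d u' p i *v segment_integral E_mid p i) + cross3 V B))"
      by simp
    then show ?thesis using dt_pos by simp
  qed
  have "(gam S (imp u' p) - 1) * mass S * (light S)\<^sup>2 - (gam S (imp u p) - 1) * mass S * (light S)\<^sup>2 = (imp u' p - imp u p) \<bullet> V"
    unfolding V_def by (rule particle_energy_increment[OF light_pos mass_pos])
  also have "\<dots> = charge S * ((\<Sum>i=1..nseg d p. Dmat u d u' p i *v segment_integral E_mid p i) \<bullet> (pos u' p - pos u p))"
    unfolding U X by (simp add: inner_add_left dot_cross_self)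
  also have "(\<Sum>i=1..nseg d p. Dmat u d u' p i *v segment_integral E_mid p i) \<bullet> (pos u' p - pos u p)
      = (\<Sum>i=1..nseg d p. segment p i \<bullet> segment_integral E_mid p i)"
    unfolding inner_sum_left
  proof (rule sum.cong[OF refl])
    fix i assume i: "i \<in> {1..nseg d p}"
    obtain l where "segment p i = l *\<^sub>R (pos u' p - pos u p)" using segment_parallel[OF p i] .
    from Dmat_inner[OF this]
    show "(Dmat u d u' p i *v segment_integral E_mid p i) \<bullet> (pos u' p - pos u p) = segment p i \<bullet> segment_integral E_mid p i"
      by (simp add: inner_commute)
  qed
  finally show ?thesis .
qed

lemma ampere_step:
  assumes \<nu>: "\<nu> \<in> N0_space (dom S) (cells S) (deg S)"
  shows "(LINT x|lebesgue_on (dom S). (elec u' x - elec u x) \<bullet> \<nu> x)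
     = dt S * (light S * (LINT x|lebesgue_on (dom S). B_mid x \<bullet> curl \<nu> x)
     - 4 * pi * charge S / mass S *
         (LINT x|lebesgue_on (dom S). finterp (theta S) (rho u) (rho u') x * (wh d x \<bullet> \<nu> x)))
     - 4 * pi * charge S * (\<Sum>p=1..npart S. weight S p * (\<Sum>i=1..nseg d p. segment p i \<bullet> segment_integral \<nu> p i))"
proof -
  let ?S = "\<Sum>p=1..npart S. weight S p * (\<Sum>i=1..nseg d p. segment p i \<bullet> segment_integral \<nu> p i)"
  have "(\<Sum>p=1..npart S. \<Sum>i=1..nseg d p. weight S p * (((1 / dt S) *\<^sub>R segment p i) \<bullet> segment_integral \<nu> p i)) = ?S / dt S"
    by (simp add: sum_distrib_left sum_divide_distrib)
  moreover have "ampere_eq S u d u'" using step by (simp add: IF_step_def)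
  note bspec[OF this[unfolded ampere_eq_def] \<nu>, folded segment_integral_def]
  ultimately have "(LINT x|lebesgue_on (dom S). (elec u' x - elec u x) \<bullet> \<nu> x) / dt S
     = light S * (LINT x|lebesgue_on (dom S). B_mid x \<bullet> curl \<nu> x)
     - 4 * pi * charge S / mass S *
         (LINT x|lebesgue_on (dom S). finterp (theta S) (rho u) (rho u') x * (wh d x \<bullet> \<nu> x))
     - 4 * pi * charge S * (?S / dt S)"
    by simp
  then show ?thesis using dt_pos by (simp add: field_simps)
qed

lemma faraday_step:
  assumes "\<tau> \<in> RT0_space (dom S) (cells S) (deg S)"
  shows "(LINT x|lebesgue_on (dom S). (magn u' x - magn u x) \<bullet> \<tau> x)
     = - dt S * light S * (LINT x|lebesgue_on (dom S). \<tau> x \<bullet> curl E_mid x)"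
proof -
  have "faraday_eq S u u'" using step by (simp add: IF_step_def)
  from bspec[OF this[unfolded faraday_eq_def] assms]
  have "(LINT x|lebesgue_on (dom S). (magn u' x - magn u x) \<bullet> \<tau> x) / dt S
      = - light S * (LINT x|lebesgue_on (dom S). \<tau> x \<bullet> curl E_mid x)" by simp
  then show ?thesis using dt_pos by (simp add: field_simps)
qed

lemma square_increment: "(norm b)\<^sup>2 - (norm a)\<^sup>2 = 2 * ((b - a) \<bullet> interp (1/2) a b)" for a b :: "real^3"
  unfolding interp_def power2_norm_eq_inner by (simp add: algebra_simps inner_commute)

lemma field_energy_step:
  "(LINT x|lebesgue_on (dom S). (norm (elec u' x))\<^sup>2 + (norm (magn u' x))\<^sup>2)
   - (LINT x|lebesgue_on (dom S). (norm (elec u x))\<^sup>2 + (norm (magn u x))\<^sup>2)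
   = 2 * ((LINT x|lebesgue_on (dom S). (elec u' x - elec u x) \<bullet> E_mid x)
        + (LINT x|lebesgue_on (dom S). (magn u' x - magn u x) \<bullet> B_mid x))"
proof -
  note cf = continuous_fields
  have i: "integrable (lebesgue_on (dom S)) (\<lambda>x. (norm (elec u' x))\<^sup>2 + (norm (magn u' x))\<^sup>2)"
    "integrable (lebesgue_on (dom S)) (\<lambda>x. (norm (elec u x))\<^sup>2 + (norm (magn u x))\<^sup>2)"
    "integrable (lebesgue_on (dom S)) (\<lambda>x. (elec u' x - elec u x) \<bullet> E_mid x)"
    "integrable (lebesgue_on (dom S)) (\<lambda>x. (magn u' x - magn u x) \<bullet> B_mid x)"
    by (rule cellwise_continuous_integrable, intro cellwise_continuous_intros cf)+
  have eq: "((norm (elec u' x))\<^sup>2 + (norm (magn u' x))\<^sup>2) - ((norm (elec u x))\<^sup>2 + (norm (magn u x))\<^sup>2)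
      = 2 * ((elec u' x - elec u x) \<bullet> E_mid x) + 2 * ((magn u' x - magn u x) \<bullet> B_mid x)" for x
    using square_increment[of "elec u' x" "elec u x"] square_increment[of "magn u' x" "magn u x"]
    by (simp add: finterp_def)
  show ?thesis
    unfolding Bochner_Integration.integral_diff[OF i(1,2), symmetric] eq using i(3,4) by simp
qed

text \<open>The works done on the fluid and on the particles are those that the two currents take out of
  the field; the curl terms of the Ampere and Faraday laws cancel.\<close>

lemma total_energy_step: "total_energy S u' = total_energy S u"
proof -
  let ?J = "LINT x|lebesgue_on (dom S). finterp (theta S) (rho u) (rho u') x * (wh d x \<bullet> E_mid x)"
  let ?P = "\<Sum>p=1..npart S. weight S p * (\<Sum>i=1..nseg d p. segment p i \<bullet> segment_integral E_mid p i)"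
  have fluid: "(LINT x|lebesgue_on (dom S). rho u' x * (gam S ((mass S / rho u' x) *\<^sub>R mom u' x) - 1) * (light S)\<^sup>2)
   - (LINT x|lebesgue_on (dom S). rho u x * (gam S ((mass S / rho u x) *\<^sub>R mom u x) - 1) * (light S)\<^sup>2)
   = dt S * (charge S / mass S * ?J)"
    using fluid_energy_step fluid_work by simp
  have part: "(\<Sum>p=1..npart S. weight S p * (gam S (imp u' p) - 1) * mass S * (light S)\<^sup>2)
     - (\<Sum>p=1..npart S. weight S p * (gam S (imp u p) - 1) * mass S * (light S)\<^sup>2) = charge S * ?P"
  proof -
    have "(\<Sum>p=1..npart S. weight S p * (gam S (imp u' p) - 1) * mass S * (light S)\<^sup>2)
     - (\<Sum>p=1..npart S. weight S p * (gam S (imp u p) - 1) * mass S * (light S)\<^sup>2)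
     = (\<Sum>p=1..npart S. weight S p * ((gam S (imp u' p) - 1) * mass S * (light S)\<^sup>2 - (gam S (imp u p) - 1) * mass S * (light S)\<^sup>2))"
      by (simp add: sum_subtractf[symmetric] algebra_simps)
    also have "\<dots> = (\<Sum>p=1..npart S. weight S p * (charge S * (\<Sum>i=1..nseg d p. segment p i \<bullet> segment_integral E_mid p i)))"
      by (rule sum.cong[OF refl]) (simp only: particle_energy_step)
    also have "\<dots> = charge S * ?P" by (simp add: sum_distrib_left mult.left_commute)
    finally show ?thesis .
  qed
  have "(LINT x|lebesgue_on (dom S). (elec u' x - elec u x) \<bullet> E_mid x)
      + (LINT x|lebesgue_on (dom S). (magn u' x - magn u x) \<bullet> B_mid x)
    = - 4 * pi * (dt S * (charge S / mass S * ?J) + charge S * ?P)"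
    unfolding ampere_step[OF E_mid_N0] faraday_step[OF B_mid_RT0] by (simp add: algebra_simps)
  then have field: "(LINT x|lebesgue_on (dom S). (norm (elec u' x))\<^sup>2 + (norm (magn u' x))\<^sup>2)
   - (LINT x|lebesgue_on (dom S). (norm (elec u x))\<^sup>2 + (norm (magn u x))\<^sup>2)
   = - 8 * pi * (dt S * (charge S / mass S * ?J) + charge S * ?P)"
    unfolding field_energy_step by simp
  have "1 / (8 * pi) * (LINT x|lebesgue_on (dom S). (norm (elec u' x))\<^sup>2 + (norm (magn u' x))\<^sup>2)
    - 1 / (8 * pi) * (LINT x|lebesgue_on (dom S). (norm (elec u x))\<^sup>2 + (norm (magn u x))\<^sup>2)
    = - (dt S * (charge S / mass S * ?J) + charge S * ?P)"
    unfolding Rings.right_diff_distrib[symmetric] field by simp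
  then show ?thesis unfolding total_energy_def using fluid part by linarith
qed

subsection \<open>The Gauss law\<close>

text \<open>The contributions of the sub-segments telescope because the test function takes the same value
  from both cells at each breakpoint.\<close>

lemma particle_work_of_gradient:
  assumes \<phi>: "\<phi> \<in> Q0_space (dom S) (cells S) k" and p: "p \<in> {1..npart S}"
  shows "(\<Sum>i=1..nseg d p. segment p i \<bullet> segment_integral (grad \<phi>) p i)
    = point_value (cells S) \<phi> (pos u' p) - point_value (cells S) \<phi> (pos u p)"
proof -
  have tr: "brk d p 0 = pos u p" "brk d p (nseg d p) = pos u' p"
    "\<forall>i\<in>{1..nseg d p}. segcell d p i \<in> cells S \<and> closed_segment (brk d p (i - 1)) (brk d p i) \<subseteq> segcell d p i"
    using particle_facts(1)[OF p] by (simp_all add: trajectory_def)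
  have "(\<Sum>i=1..nseg d p. segment p i \<bullet> segment_integral (grad \<phi>) p i)
      = (\<Sum>i=1..nseg d p. point_value (cells S) \<phi> (brk d p i) - point_value (cells S) \<phi> (brk d p (i - 1)))"
  proof (rule sum.cong[OF refl])
    fix i assume "i \<in> {1..nseg d p}"
    with tr(3) have "segcell d p i \<in> cells S" "closed_segment (brk d p (i - 1)) (brk d p i) \<subseteq> segcell d p i" by blast+
    then show "segment p i \<bullet> segment_integral (grad \<phi>) p i
        = point_value (cells S) \<phi> (brk d p i) - point_value (cells S) \<phi> (brk d p (i - 1))"
      unfolding segment_integral_def segpoint_def by (rule integral_trace_grad_along_segment[OF \<phi>])
  qed
  also have "\<dots> = point_value (cells S) \<phi> (brk d p (nseg d p)) - point_value (cells S) \<phi> (brk d p 0)"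
  proof -
    have "(\<Sum>i=1..m. f i - f (i - 1)) = f m - f 0" for m and f :: "nat \<Rightarrow> real"
      by (induction m) auto
    from this[of "\<lambda>i. point_value (cells S) \<phi> (brk d p i)"] show ?thesis .
  qed
  finally show ?thesis by (simp only: tr(1,2))
qed

lemma gauss_residual_eq:
  assumes v: "admissible S v" and \<phi>: "\<phi> \<in> Q0_space (dom S) (cells S) (deg S + 1)"
  shows "gauss_residual S v \<phi> = - (LINT x|lebesgue_on (dom S). elec v x \<bullet> grad \<phi> x)
    - 4 * pi * charge S / mass S * (LINT x|lebesgue_on (dom S). rho v x * \<phi> x)
    - 4 * pi * charge S * (\<Sum>p=1..npart S. weight S p * point_value (cells S) \<phi> (pos v p))"
proof -
  have E: "cellwise_continuous (cells S) (elec v)"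
    using v by (intro cellwise_smooth_continuous smooth_N0[of _ "deg S"]) (simp add: admissible_def)
  have \<rho>: "cellwise_continuous (cells S) (rho v)"
    using v by (intro cellwise_smooth_continuous smooth_DG[of _ "dom S" _ "deg S + 1"]) (simp add: admissible_def)
  have s: "cellwise_continuous (cells S) f" if "f \<in> Q0_space (dom S) (cells S) (deg S + 1)" for f
    using that by (intro cellwise_smooth_continuous smooth_Q[of _ "dom S" _ "deg S + 1"]) (simp add: Q0_space_def)
  note D = discrete_div_properties[OF E, where k = "deg S"]
  have i: "integrable (lebesgue_on (dom S)) (\<lambda>x. discrete_div (dom S) (cells S) (deg S) (elec v) x * \<phi> x)"
    "integrable (lebesgue_on (dom S)) (\<lambda>x. rho v x * \<phi> x)"
    by (rule cellwise_continuous_integrable, intro cellwise_continuous_intros s[OF D(1)] s[OF \<phi>] \<rho>)+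
  have "(LINT x|lebesgue_on (dom S). (discrete_div (dom S) (cells S) (deg S) (elec v) x
         - 4 * pi * charge S * (rho v x / mass S)) * \<phi> x)
     = (LINT x|lebesgue_on (dom S). discrete_div (dom S) (cells S) (deg S) (elec v) x * \<phi> x
         - 4 * pi * charge S / mass S * (rho v x * \<phi> x))"
    by (rule Bochner_Integration.integral_cong[OF refl]) (simp add: algebra_simps)
  also have "\<dots> = (LINT x|lebesgue_on (dom S). discrete_div (dom S) (cells S) (deg S) (elec v) x * \<phi> x)
     - 4 * pi * charge S / mass S * (LINT x|lebesgue_on (dom S). rho v x * \<phi> x)"
    using i by simp
  finally show ?thesis unfolding gauss_residual_def by (simp add: D(2)[OF \<phi>])
qed

text \<open>The gradient of the test function is an admissible test field of the Ampere law, without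
  curl; and the test function itself is admissible in the density equation, without jumps. The fluid
  currents in the two equations agree, and the particle current telescopes.\<close>

lemma gauss_residual_step:
  assumes \<phi>: "\<phi> \<in> Q0_space (dom S) (cells S) (deg S + 1)"
  shows "gauss_residual S u' \<phi> = gauss_residual S u \<phi>"
proof -
  have Q: "\<phi> \<in> Q_space (dom S) (cells S) (deg S + 1)" using \<phi> by (simp add: Q0_space_def)
  have s: "cellwise_smooth (cells S) \<phi>" by (rule smooth_Q[OF Q])
  note c = cellwise_smooth_continuous[OF s] cellwise_smooth_continuous[OF cellwise_smooth_grad[OF s]]
  have DG: "\<phi> \<in> DG_space (dom S) (cells S) (deg S + 1)"
    using Q by (simp add: Q_space_def DG_space_def H1_def)
  have N0: "grad \<phi> \<in> N0_space (dom S) (cells S) (deg S)" using grad_in_N0 \<phi> by simp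
  let ?J = "LINT x|lebesgue_on (dom S). finterp (theta S) (rho u) (rho u') x * (wh d x \<bullet> grad \<phi> x)"
  let ?PV = "\<lambda>v. \<Sum>p=1..npart S. weight S p * point_value (cells S) \<phi> (pos v p)"
  have curl0: "(LINT x|lebesgue_on (dom S). B_mid x \<bullet> curl (grad \<phi>) x) = 0"
  proof -
    have "(LINT x|lebesgue_on (dom S). B_mid x \<bullet> curl (grad \<phi>) x) = (LINT x|lebesgue_on (dom S). 0)"
    proof (rule cellwise_continuous_LINT_cong)
      show "cellwise_continuous (cells S) (\<lambda>x. B_mid x \<bullet> curl (grad \<phi>) x)"
        by (intro cellwise_continuous_intros continuous_fields
            cellwise_smooth_continuous[OF cellwise_smooth_curl[OF cellwise_smooth_grad[OF s]]])
      fix K x assume K: "K \<in> cells S" "x \<in> interior K"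
      obtain p where p: "\<And>r. C_diff r p" "\<And>x. x \<in> interior K \<Longrightarrow> \<phi> x = p x" using cellwise_smoothE[OF s K(1)] by metis
      have g: "grad \<phi> y = grad p y" if "y \<in> interior K" for y
        by (rule grad_cell[OF p(2) that C_diff_differentiable[OF p(1)[of "Suc 0"]]])
      have "curl (grad \<phi>) x = curl (grad p) x"
        by (rule curl_cell[OF g K(2) C_diff_differentiable[OF C_diff_grad[OF p(1)[of "Suc (Suc 0)"]]]])
      then show "B_mid x \<bullet> curl (grad \<phi>) x = 0" using curl_grad_eq_0[OF p(1)] by simp
    qed
    then show ?thesis by simp
  qed
  have dens: "(LINT x|lebesgue_on (dom S). (rho u' x - rho u x) * \<phi> x) = dt S * ?J"
    by (rule density_step_continuous_test[OF DG]) (rule Q0_traces_agree[OF \<phi>])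
  have "(\<Sum>p=1..npart S. weight S p * (\<Sum>i=1..nseg d p. segment p i \<bullet> segment_integral (grad \<phi>) p i)) = ?PV u' - ?PV u"
    unfolding sum_subtractf[symmetric]
    by (rule sum.cong[OF refl]) (simp only: particle_work_of_gradient[OF \<phi>] Rings.right_diff_distrib)
  then have amp: "(LINT x|lebesgue_on (dom S). (elec u' x - elec u x) \<bullet> grad \<phi> x)
     = - 4 * pi * charge S / mass S * (dt S * ?J) - 4 * pi * charge S * (?PV u' - ?PV u)"
    unfolding ampere_step[OF N0] curl0 by simp
  have i: "integrable (lebesgue_on (dom S)) (\<lambda>x. rho u' x * \<phi> x)" "integrable (lebesgue_on (dom S)) (\<lambda>x. rho u x * \<phi> x)"
    "integrable (lebesgue_on (dom S)) (\<lambda>x. elec u' x \<bullet> grad \<phi> x)" "integrable (lebesgue_on (dom S)) (\<lambda>x. elec u x \<bullet> grad \<phi> x)"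
    by (rule cellwise_continuous_integrable, intro cellwise_continuous_intros continuous_fields c)+
  have r: "(LINT x|lebesgue_on (dom S). rho u' x * \<phi> x) = (LINT x|lebesgue_on (dom S). rho u x * \<phi> x) + dt S * ?J"
    using i dens by (simp add: Rings.left_diff_distrib)
  have e: "(LINT x|lebesgue_on (dom S). elec u' x \<bullet> grad \<phi> x) = (LINT x|lebesgue_on (dom S). elec u x \<bullet> grad \<phi> x)
     - 4 * pi * charge S / mass S * (dt S * ?J) - 4 * pi * charge S * (?PV u' - ?PV u)"
    using i amp by (simp add: inner_diff_left)
  show ?thesis
    unfolding gauss_residual_eq[OF adm \<phi>] gauss_residual_eq[OF adm' \<phi>] r e by (simp add: algebra_simps)
qed

subsection \<open>The divergence of the magnetic field\<close>

text \<open>The curl of the discrete electric field is an admissible test field, so the residual of the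
  Faraday law can be tested with itself.\<close>

lemma faraday_pointwise:
  assumes K: "K \<in> cells S" "x \<in> interior K"
  shows "magn u' x = magn u x - (dt S * light S) *\<^sub>R curl E_mid x"
proof -
  define \<tau> where "\<tau> = (\<lambda>x. 1 *\<^sub>R (1 *\<^sub>R magn u' x + (-1) *\<^sub>R magn u x) + (dt S * light S) *\<^sub>R curl E_mid x)"
  have \<tau>: "\<tau> \<in> RT0_space (dom S) (cells S) (deg S)"
    unfolding \<tau>_def by (intro RT0_linear in_spaces curl_in_RT0 E_mid_N0)
  note c\<tau> = cellwise_smooth_continuous[OF smooth_RT0[OF \<tau>]]
  note cc = cellwise_smooth_continuous[OF cellwise_smooth_curl[OF smooth_fields(11)]]
  have i: "integrable (lebesgue_on (dom S)) (\<lambda>x. (magn u' x - magn u x) \<bullet> \<tau> x)"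
     "integrable (lebesgue_on (dom S)) (\<lambda>x. \<tau> x \<bullet> curl E_mid x)"
    by (rule cellwise_continuous_integrable, intro cellwise_continuous_intros continuous_fields c\<tau> cc)+
  have "(norm (\<tau> x))\<^sup>2 = (magn u' x - magn u x) \<bullet> \<tau> x + (dt S * light S) * (\<tau> x \<bullet> curl E_mid x)" for x
  proof -
    have "\<tau> x = (magn u' x - magn u x) + (dt S * light S) *\<^sub>R curl E_mid x" by (simp add: \<tau>_def)
    then have "\<tau> x \<bullet> \<tau> x = ((magn u' x - magn u x) + (dt S * light S) *\<^sub>R curl E_mid x) \<bullet> \<tau> x" by simp
    also have "\<dots> = (magn u' x - magn u x) \<bullet> \<tau> x + (dt S * light S) * (curl E_mid x \<bullet> \<tau> x)"
      by (simp only: inner_add_left inner_scaleR_left)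
    finally show ?thesis by (simp only: power2_norm_eq_inner inner_commute[of "curl E_mid x"])
  qed
  then have "(LINT x|lebesgue_on (dom S). (norm (\<tau> x))\<^sup>2)
     = (LINT x|lebesgue_on (dom S). (magn u' x - magn u x) \<bullet> \<tau> x) + (dt S * light S) * (LINT x|lebesgue_on (dom S). \<tau> x \<bullet> curl E_mid x)"
    using i by simp
  also have "\<dots> = 0" using faraday_step[OF \<tau>] by simp
  finally have "\<tau> x = 0" using cellwise_smooth_square_integral_0[OF smooth_RT0[OF \<tau>] _ K] by simp
  then show ?thesis by (simp add: \<tau>_def algebra_simps)
qed

lemma weak_div_step:
  assumes D: "has_weak_div (dom S) (magn u) D" shows "has_weak_div (dom S) (magn u') D"
  unfolding has_weak_div_def
proof (intro conjI ballI)
  show "D \<in> L2 (dom S)" using D by (simp add: has_weak_div_def)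
  fix \<psi> :: "real^3 \<Rightarrow> real" assume \<psi>: "\<psi> \<in> test_functions (dom S)"
  note cc = cellwise_smooth_continuous[OF cellwise_smooth_curl[OF smooth_fields(11)]]
  note cg = test_functions_cellwise_continuous[OF test_functions_grad[OF \<psi>]]
  have i: "integrable (lebesgue_on (dom S)) (\<lambda>x. magn u x \<bullet> grad \<psi> x)" "integrable (lebesgue_on (dom S)) (\<lambda>x. curl E_mid x \<bullet> grad \<psi> x)"
    by (rule cellwise_continuous_integrable, intro cellwise_continuous_intros continuous_fields cc cg)+
  have "E_mid \<in> Hcurl (dom S)" using E_mid_N0 by (simp add: N0_space_def N_space_def)
  from curl_has_weak_div_0[OF this smooth_fields(11)]
  have 0: "(LINT x|lebesgue_on (dom S). curl E_mid x \<bullet> grad \<psi> x) = 0" using \<psi> by (simp add: has_weak_div_def)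
  have "(LINT x|lebesgue_on (dom S). magn u' x \<bullet> grad \<psi> x)
     = (LINT x|lebesgue_on (dom S). magn u x \<bullet> grad \<psi> x - (dt S * light S) * (curl E_mid x \<bullet> grad \<psi> x))"
    by (rule cellwise_continuous_LINT_cong, intro cellwise_continuous_intros continuous_fields cg)
       (simp add: faraday_pointwise inner_diff_left)
  also have "\<dots> = (LINT x|lebesgue_on (dom S). magn u x \<bullet> grad \<psi> x)" using i 0 by simp
  also have "\<dots> = - (LINT x|lebesgue_on (dom S). D x * \<psi> x)" using D \<psi> by (simp add: has_weak_div_def)
  finally show "(LINT x|lebesgue_on (dom S). magn u' x \<bullet> grad \<psi> x) = - (LINT x|lebesgue_on (dom S). D x * \<psi> x)" .
qed

end

theorem proposition4p2:
  fixes S :: setting and u :: "nat \<Rightarrow> state"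
  assumes "bounded_domain (dom S)"
    and "conforming_mesh (dom S) (cells S)"
    and "face_orientation S"
    and "light S > 0" and "mass S > 0" and "charge S \<noteq> 0"
    and "theta S \<in> {0..1}" and "theta2 S \<in> {0..1}" and "theta3 S \<in> {0..1}"
    and "dt S > 0"
    and "IF_solution S u"
  shows "(\<forall>n. fluid_mass S (u n) = fluid_mass S (u 0))
    \<and> (\<forall>n. particle_mass S (u n) = particle_mass S (u 0))
    \<and> (\<forall>n. total_energy S (u n) = total_energy S (u 0))
    \<and> (\<forall>\<phi>\<in>Q0_space (dom S) (cells S) (deg S + 1).
         \<forall>n. gauss_residual S (u n) \<phi> = gauss_residual S (u 0) \<phi>)
    \<and> (\<exists>D. \<forall>n. has_weak_div (dom S) (magn (u n)) D)"
proof -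
  have adm: "admissible S (u n)" for n using assms(11) by (simp add: IF_solution_def)
  have step: "\<exists>d. scheme_step S (u n) (u (Suc n)) d" for n
  proof -
    obtain d where "IF_step S (u n) d (u (Suc n))" using assms(11) unfolding IF_solution_def by blast
    then have "scheme_step S (u n) (u (Suc n)) d"
      by (intro scheme_step.intro fe_mesh.intro scheme_step_axioms.intro assms adm)
    then show ?thesis by blast
  qed
  have const: "\<forall>n. q (u n) = q (u 0)" if "\<And>v v' d. scheme_step S v v' d \<Longrightarrow> q v' = q v" for q :: "state \<Rightarrow> real"
  proof
    fix n show "q (u n) = q (u 0)"
    proof (induction n)
      case (Suc n)
      obtain d where "scheme_step S (u n) (u (Suc n)) d" using step by blast
      from that[OF this] Suc.IH show ?case by simp
    qed simp
  qed
  have "\<exists>D. has_weak_div (dom S) (magn (u 0)) D"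
    using adm[of 0] by (auto simp: admissible_def RT0_space_def RT_space_def Hdiv_def)
  then obtain D where D: "has_weak_div (dom S) (magn (u 0)) D" by blast
  have "has_weak_div (dom S) (magn (u n)) D" for n
  proof (induction n)
    case (Suc n)
    obtain d where "scheme_step S (u n) (u (Suc n)) d" using step by blast
    then show ?case using Suc.IH by (rule scheme_step.weak_div_step)
  qed (rule D)
  then have "\<exists>D. \<forall>n. has_weak_div (dom S) (magn (u n)) D" by blast
  moreover have "\<forall>n. fluid_mass S (u n) = fluid_mass S (u 0)"
    by (rule const) (rule scheme_step.fluid_mass_step)
  moreover have "\<forall>n. particle_mass S (u n) = particle_mass S (u 0)"
    by (simp add: particle_mass_def)
  moreover have "\<forall>n. total_energy S (u n) = total_energy S (u 0)"
    by (rule const) (rule scheme_step.total_energy_step)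
  moreover have "\<forall>n. gauss_residual S (u n) \<phi> = gauss_residual S (u 0) \<phi>"
    if "\<phi> \<in> Q0_space (dom S) (cells S) (deg S + 1)" for \<phi>
    by (rule const) (rule scheme_step.gauss_residual_step[OF _ that])
  ultimately show ?thesis by blast
qed

end
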